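(* Let $\Omega\subset\mathbb{R}^3$ be a bounded domain with smooth boundary surface $S$, let $\mathbf{n}(\mathbf{x})$ denote the outward unit normal at $\mathbf{x}\in S$, and let $f:S\to\mathbb{R}$ be smooth. For $\mathbf{y}\in S$ let $$v(\mathbf{y})=\int_S \frac{\bigl(f(\mathbf{x})\mathbf{n}(\mathbf{y})+f(\mathbf{y})\mathbf{n}(\mathbf{x})\bigr)\cdot(\mathbf{y}-\mathbf{x})}{4\pi|\mathbf{x}-\mathbf{y}|^3}\,dS(\mathbf{x})+\tfrac12 f(\mathbf{y}),$$ and for $\delta>0$ let $$v_\delta(\mathbf{y})=\int_S \frac{\bigl(f(\mathbf{x})\mathbf{n}(\mathbf{y})+f(\mathbf{y})\mathbf{n}(\mathbf{x})\bigr)\cdot(\mathbf{y}-\mathbf{x})\; s_5(|\mathbf{x}-\mathbf{y}|/\delta)}{4\pi|\mathbf{x}-\mathbf{y}|^3}\,dS(\mathbf{x})+\tfrac12 f(\mathbf{y}),$$ where $$s_5(\rho)=\operatorname{erf}(\rho)-\frac{2}{\sqrt{\pi}}\Bigl(\rho-\frac{2\rho^3}{3}\Bigr)e^{-\rho^2}.$$ Then for every $\mathbf{y}\in S$, $v_\delta(\mathbf{y})-v(\mathbf{y})=O(\delta^5)$ as $\delta\to0^+$.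
   Context: $\operatorname{erf}(\rho)=\frac{2}{\sqrt{\pi}}\int_0^\rho e^{-t^2}\,dt$ is the error function. The quantity $v(\mathbf{y})$ is the adjoint double layer potential $\int_S \frac{\mathbf{n}(\mathbf{y})\cdot(\mathbf{y}-\mathbf{x})}{4\pi|\mathbf{x}-\mathbf{y}|^3}f(\mathbf{x})\,dS(\mathbf{x})$, written in modified form. The factor $s_5$ corresponds to replacing $\nabla G(\mathbf{x})$, where $G(\mathbf{x})=-\frac{1}{4\pi|\mathbf{x}|}$, by $\nabla G(\mathbf{x})\,s_5(|\mathbf{x}|/\delta)$. *)

theory Defs
  imports "HOL-Analysis.Analysis" "HOL-Library.Landau_Symbols"
begin

primrec continuously_differentiable_on ::
    "nat \<Rightarrow> ('a::euclidean_space \<Rightarrow> 'b::real_normed_vector) \<Rightarrow> 'a set \<Rightarrow> bool" where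
  "continuously_differentiable_on 0 f U \<longleftrightarrow> continuous_on U f"
| "continuously_differentiable_on (Suc k) f U \<longleftrightarrow>
     (\<forall>x\<in>U. f differentiable (at x)) \<and>
     (\<forall>b\<in>Basis. continuously_differentiable_on k (\<lambda>x. frechet_derivative f (at x) b) U)"

(* Only used for open U. *)
definition smooth_on ::
    "('a::euclidean_space \<Rightarrow> 'b::real_normed_vector) \<Rightarrow> 'a set \<Rightarrow> bool" where
  "smooth_on f U \<longleftrightarrow> (\<forall>k. continuously_differentiable_on k f U)"

definition smooth_on_surface :: "(real^3 \<Rightarrow> real) \<Rightarrow> (real^3) set \<Rightarrow> bool" where
  "smooth_on_surface f S \<longleftrightarrow>
     (\<forall>p\<in>S. \<exists>W F. open W \<and> p \<in> W \<and> smooth_on F W \<and> (\<forall>x\<in>W \<inter> S. F x = f x))"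

(* Near each boundary point, and after an orthogonal change of coordinates,
   the set is the region on one side of the graph of a smooth function. *)
definition smooth_boundary :: "(real^3) set \<Rightarrow> bool" where
  "smooth_boundary \<Omega> \<longleftrightarrow>
     (\<forall>p\<in>frontier \<Omega>. \<exists>r>0. \<exists>T :: real^3 \<Rightarrow> real^3. \<exists>h :: real^2 \<Rightarrow> real.
        orthogonal_transformation T \<and> smooth_on h UNIV \<and>
        \<Omega> \<inter> ball p r = {x \<in> ball p r. T x $ 3 > h (vector [T x $ 1, T x $ 2])})"

definition bounded_smooth_domain :: "(real^3) set \<Rightarrow> bool" where
  "bounded_smooth_domain \<Omega> \<longleftrightarrow>
     open \<Omega> \<and> connected \<Omega> \<and> \<Omega> \<noteq> {} \<and> bounded \<Omega> \<and> smooth_boundary \<Omega>"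

definition tangent_space :: "(real^3) set \<Rightarrow> real^3 \<Rightarrow> (real^3) set" where
  "tangent_space S p =
     {v. \<exists>c :: real \<Rightarrow> real^3. \<exists>\<epsilon>>0. c 0 = p \<and> (\<forall>t\<in>{-\<epsilon><..<\<epsilon>}. c t \<in> S) \<and>
           (c has_vector_derivative v) (at 0)}"

definition outward_unit_normal :: "(real^3) set \<Rightarrow> real^3 \<Rightarrow> real^3" where
  "outward_unit_normal \<Omega> x =
     (THE n. norm n = 1 \<and> (\<forall>v\<in>tangent_space (frontier \<Omega>) x. n \<bullet> v = 0) \<and>
             (\<exists>\<epsilon>>0. \<forall>t\<in>{0<..<\<epsilon>}. x + t *\<^sub>R n \<notin> closure \<Omega>))"

definition area_density :: "(real^2 \<Rightarrow> real^3) \<Rightarrow> real^2 \<Rightarrow> real" where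
  "area_density \<phi> u =
     norm (cross3 (frechet_derivative \<phi> (at u) (axis 1 1)) (frechet_derivative \<phi> (at u) (axis 2 1)))"

definition regular_patch :: "(real^3) set \<Rightarrow> (real^2) set \<Rightarrow> (real^2 \<Rightarrow> real^3) \<Rightarrow> bool" where
  "regular_patch S U \<phi> \<longleftrightarrow>
     open U \<and> smooth_on \<phi> U \<and> openin (top_of_set S) (\<phi> ` U) \<and>
     (\<exists>\<psi>. homeomorphism U (\<phi> ` U) \<phi> \<psi>) \<and> (\<forall>u\<in>U. area_density \<phi> u \<noteq> 0)"

(* The Borel measure on S given in every regular parametrization by the
   area element |d\<phi>/du \<times> d\<phi>/dv| du dv.  The patches of a smooth closed surface
   cover it, so these conditions determine the measure. *)
definition surface_measure :: "(real^3) set \<Rightarrow> (real^3) measure" where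
  "surface_measure S =
     (THE M. sets M = sets (restrict_space borel S) \<and>
        (\<forall>U \<phi>. regular_patch S U \<phi> \<longrightarrow>
           (\<forall>A\<in>sets M. A \<subseteq> \<phi> ` U \<longrightarrow>
              emeasure M A = (\<integral>\<^sup>+u\<in>U \<inter> \<phi> -` A. ennreal (area_density \<phi> u) \<partial>lborel))))"

definition erf :: "real \<Rightarrow> real" where
  "erf \<rho> = 2 / sqrt pi * (LBINT t=0..\<rho>. exp (- t\<^sup>2))"

definition s5 :: "real \<Rightarrow> real" where
  "s5 \<rho> = erf \<rho> - 2 / sqrt pi * (\<rho> - 2 * \<rho>^3 / 3) * exp (- \<rho>\<^sup>2)"

(* At x = y the integrands are 0, because division by zero is; this point has measure zero. *)
definition layer_potential :: "(real^3) set \<Rightarrow> (real^3 \<Rightarrow> real) \<Rightarrow> real^3 \<Rightarrow> real" where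
  "layer_potential \<Omega> f y =
     (\<integral>x. ((f x *\<^sub>R outward_unit_normal \<Omega> y + f y *\<^sub>R outward_unit_normal \<Omega> x) \<bullet> (y - x))
           / (4 * pi * norm (x - y) ^ 3) \<partial>surface_measure (frontier \<Omega>))
     + 1/2 * f y"

definition regularized_layer_potential ::
    "(real^3) set \<Rightarrow> (real^3 \<Rightarrow> real) \<Rightarrow> real \<Rightarrow> real^3 \<Rightarrow> real" where
  "regularized_layer_potential \<Omega> f \<delta> y =
     (\<integral>x. ((f x *\<^sub>R outward_unit_normal \<Omega> y + f y *\<^sub>R outward_unit_normal \<Omega> x) \<bullet> (y - x))
           * s5 (norm (x - y) / \<delta>)
           / (4 * pi * norm (x - y) ^ 3) \<partial>surface_measure (frontier \<Omega>))
     + 1/2 * f y"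

end

theory Submission
  imports Defs "HOL-Probability.Distributions" "HOL-Real_Asymp.Real_Asymp"
begin

text \<open>
  Why the error is of fifth order. Away from \<open>y\<close> the defect \<open>s5 (r / \<delta>) - 1\<close> is exponentially small in
  \<open>1 / \<delta>\<close>, so only a neighbourhood of \<open>y\<close> matters. There the surface is a graph over its tangent plane,
  \<open>x = y + u1 e1 + u2 e2 + \<eta>(u) n\<close> with \<open>\<eta>\<close> vanishing to second order (\<open>tangent_patch\<close>), and the error is
  the integral of \<open>N(u) (s5 (r / \<delta>) - 1) / (4 \<pi> r^3)\<close> over a disc, where \<open>r^2 = |u|^2 + \<eta>(u)^2\<close>.
  A numerator of size \<open>|u|^k\<close> contributes \<open>O(\<delta>^(k - 1))\<close> by scaling.

  The normal times the area element is \<open>n - \<eta>_1 e1 - \<eta>_2 e2\<close>, hence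
  \<open>N = f(y) (u . grad \<eta> - \<eta>) - F \<eta>\<close>, where \<open>F\<close> is \<open>f\<close> times the area density and \<open>F(0) = f(y)\<close>.
  On the quadratic part of \<open>\<eta>\<close> the operator \<open>u . grad\<close> is multiplication by 2, so the quadratic parts
  cancel: this is what the symmetric numerator achieves. Thus \<open>N = N3 + N4 + N5 + O(|u|^6)\<close> with homogeneous
  \<open>N3, N4, N5\<close> (\<open>numerator_expansion\<close>), and the remainder is harmless. Replacing \<open>\<eta>\<close> in \<open>r\<close> by its quadratic
  part changes \<open>r\<close> by \<open>O(|u|^4)\<close>, again a contribution \<open>O(\<delta>^5)\<close>. The new radius is even in \<open>u\<close>, so \<open>N3\<close>
  and \<open>N5\<close> integrate to zero. In the term with \<open>N4\<close> the radius may be replaced by \<open>|u|\<close>, and what is left is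
  a multiple of the integral of \<open>\<rho>^2 (s5 (\<rho> / \<delta>) - 1)\<close>. Over the half line this moment vanishes, because of
  the particular cubic in \<open>s5\<close>: the function \<open>moment_primitive\<close> is an explicit primitive that is zero at 0 and
  decays at infinity. These steps are \<open>graph_defect_estimate\<close>.

  The outward normal and the surface measure are given by definite descriptions, so their existence and
  uniqueness are part of the proof. In a boundary chart the domain is \<open>{F > 0}\<close> with nonvanishing gradient,
  which identifies the normal (\<open>normal_eq\<close>). The measure is glued from finitely many graph charts. That it has
  the prescribed value on an arbitrary regular patch is seen by projecting the patch to the base plane of a
  graph chart: the projection is differentiable and injective on the part in question, which is what the
  change of variables formula asks for (\<open>patch_compare\<close>).
\<close>

section \<open>Functions of class C^k\<close>

abbreviation Ck :: "nat \<Rightarrow> ('a::euclidean_space \<Rightarrow> 'b::real_normed_vector) \<Rightarrow> 'a set \<Rightarrow> bool" where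
  "Ck \<equiv> continuously_differentiable_on"

lemma Ck_cong:
  assumes "open U" "\<And>x. x \<in> U \<Longrightarrow> f x = g x"
  shows "Ck k f U \<longleftrightarrow> Ck k g U"
  using assms(2)
proof (induction k arbitrary: f g)
  case 0
  then show ?case by (simp cong: continuous_on_cong)
next
  case (Suc k)
  have d: "(f has_derivative D) (at x) \<longleftrightarrow> (g has_derivative D) (at x)" if "x \<in> U" for x D
    using Suc.prems \<open>open U\<close> that has_derivative_transform_within_open[of f D x UNIV U g]
      has_derivative_transform_within_open[of g D x UNIV U f] by auto
  then have "f differentiable at x \<longleftrightarrow> g differentiable at x" if "x \<in> U" for x
    using that by (auto simp: differentiable_def)
  moreover have "frechet_derivative f (at x) = frechet_derivative g (at x)" if "x \<in> U" for x
    using that d by (simp add: frechet_derivative_def)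
  ultimately show ?case
    using Suc.IH[of "\<lambda>x. frechet_derivative f (at x) b" "\<lambda>x. frechet_derivative g (at x) b" for b]
    by simp
qed

lemma Ck_subset:
  assumes "Ck k f U" "V \<subseteq> U"
  shows "Ck k f V"
  using assms
proof (induction k arbitrary: f)
  case 0
  then show ?case using continuous_on_subset by auto
next
  case (Suc k)
  then show ?case by auto
qed

lemma Ck_Suc_imp:
  assumes "Ck (Suc k) f U"
  shows "Ck k f U"
  using assms
proof (induction k arbitrary: f)
  case 0
  then show ?case
    by (auto intro!: continuous_at_imp_continuous_on differentiable_imp_continuous_within)
next
  case (Suc k)
  then show ?case by (simp only: continuously_differentiable_on.simps) blast
qed

lemma Ck_imp_continuous: "Ck k f U \<Longrightarrow> continuous_on U f"
proof (induction k)
  case (Suc k)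
  show ?case by (rule Suc.IH[OF Ck_Suc_imp[OF Suc.prems]])
qed simp

text \<open>
  The class is defined through the total function \<open>frechet_derivative\<close>; this introduction rule accepts a
  derivative in any form.
\<close>

lemma Ck_SucI:
  assumes "open U" "\<And>x. x \<in> U \<Longrightarrow> (f has_derivative D x) (at x)"
    "\<And>b. b \<in> Basis \<Longrightarrow> Ck k (\<lambda>x. D x b) U"
  shows "Ck (Suc k) f U"
proof -
  have "frechet_derivative f (at x) = D x" if "x \<in> U" for x
    using frechet_derivative_at[OF assms(2)[OF that]] by simp
  then have "Ck k (\<lambda>x. frechet_derivative f (at x) b) U"
    if "b \<in> Basis" for b
    using assms(3)[OF that] Ck_cong[OF assms(1), of "\<lambda>x. frechet_derivative f (at x) b" "\<lambda>x. D x b" k] by simp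
  then show ?thesis using assms(2) by (auto simp: differentiable_def)
qed

lemma Ck_SucD:
  assumes "Ck (Suc k) f U" "x \<in> U"
  shows "(f has_derivative frechet_derivative f (at x)) (at x)"
  using assms by (simp add: frechet_derivative_works)

lemma Ck_const [simp]: "open U \<Longrightarrow> Ck k (\<lambda>x. c) U"
  by (induction k arbitrary: c) auto

lemma Ck_bounded_linear:
  assumes "bounded_linear L" "open U" "Ck k f U"
  shows "Ck k (\<lambda>x. L (f x)) U"
  using assms(3)
proof (induction k arbitrary: f)
  case 0
  then show ?case using bounded_linear.continuous_on[OF assms(1)] by simp
next
  case (Suc k)
  show ?case
  proof (rule Ck_SucI[OF \<open>open U\<close>])
    show "((\<lambda>x. L (f x)) has_derivative (\<lambda>v. L (frechet_derivative f (at x) v))) (at x)"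
      if "x \<in> U" for x
      using bounded_linear.has_derivative[OF assms(1) Ck_SucD[OF Suc.prems that]] .
    show "Ck k (\<lambda>x. L (frechet_derivative f (at x) b)) U"
      if "b \<in> Basis" for b
      using Suc.IH[of "\<lambda>x. frechet_derivative f (at x) b"] Suc.prems that by (simp only: continuously_differentiable_on.simps)
  qed
qed

lemma Ck_ident: "open U \<Longrightarrow> Ck k (\<lambda>x. x) U"
  by (cases k) simp_all

lemma Ck_linear: "bounded_linear L \<Longrightarrow> open U \<Longrightarrow> Ck k L U"
  by (rule Ck_bounded_linear[where f = "\<lambda>x. x", OF _ _ Ck_ident])

lemma Ck_add:
  assumes "open U" "Ck k f U" "Ck k g U"
  shows "Ck k (\<lambda>x. f x + g x) U"
  using assms(2,3)
proof (induction k arbitrary: f g)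
  case 0
  then show ?case by (simp add: continuous_on_add)
next
  case (Suc k)
  show ?case
  proof (rule Ck_SucI[OF \<open>open U\<close>])
    show "((\<lambda>x. f x + g x) has_derivative
        (\<lambda>v. frechet_derivative f (at x) v + frechet_derivative g (at x) v)) (at x)"
      if "x \<in> U" for x
      using Ck_SucD[OF Suc.prems(1) that] Ck_SucD[OF Suc.prems(2) that] by (rule has_derivative_add)
    show "Ck k
        (\<lambda>x. frechet_derivative f (at x) b + frechet_derivative g (at x) b) U"
      if "b \<in> Basis" for b
      using Suc.prems that by (intro Suc.IH) simp_all
  qed
qed

lemma Ck_sum:
  assumes "open U" "\<And>i. i \<in> I \<Longrightarrow> Ck k (f i) U"
  shows "Ck k (\<lambda>x. \<Sum>i\<in>I. f i x) U"
  using assms(2) by (induction I rule: infinite_finite_induct) (simp_all add: Ck_add assms(1))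

lemma Ck_scaleR:
  fixes f :: "'a::euclidean_space \<Rightarrow> real" and g :: "'a \<Rightarrow> 'b::real_normed_vector"
  assumes "open U" "Ck k f U" "Ck k g U"
  shows "Ck k (\<lambda>x. f x *\<^sub>R g x) U"
  using assms(2,3)
proof (induction k arbitrary: f g)
  case 0
  then show ?case by (simp add: continuous_on_scaleR)
next
  case (Suc k)
  show ?case
  proof (rule Ck_SucI[OF \<open>open U\<close>])
    show "((\<lambda>x. f x *\<^sub>R g x) has_derivative
        (\<lambda>v. f x *\<^sub>R frechet_derivative g (at x) v + frechet_derivative f (at x) v *\<^sub>R g x)) (at x)"
      if "x \<in> U" for x
      using Ck_SucD[OF Suc.prems(1) that] Ck_SucD[OF Suc.prems(2) that] by (rule has_derivative_scaleR)
    show "Ck k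
        (\<lambda>x. f x *\<^sub>R frechet_derivative g (at x) b + frechet_derivative f (at x) b *\<^sub>R g x) U"
      if "b \<in> Basis" for b
      using Suc.prems that Ck_Suc_imp[OF Suc.prems(1)] Ck_Suc_imp[OF Suc.prems(2)]
      by (intro Ck_add assms(1) Suc.IH) auto
  qed
qed

lemma Ck_mult:
  fixes f g :: "'a::euclidean_space \<Rightarrow> real"
  assumes "open U" "Ck k f U" "Ck k g U"
  shows "Ck k (\<lambda>x. f x * g x) U"
  using Ck_scaleR[OF assms] by simp

lemma Ck_compose:
  fixes f :: "'b::euclidean_space \<Rightarrow> 'c::real_normed_vector" and g :: "'a::euclidean_space \<Rightarrow> 'b"
  assumes "open U" "open V" "Ck k g U"
    "Ck k f V" "g ` U \<subseteq> V"
  shows "Ck k (\<lambda>x. f (g x)) U"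
  using assms(3,4)
proof (induction k arbitrary: f)
  case 0
  then show ?case using assms(5) continuous_on_compose2 by (metis continuously_differentiable_on.simps(1))
next
  case (Suc k)
  show ?case
  proof (rule Ck_SucI[OF \<open>open U\<close>])
    fix x assume x: "x \<in> U"
    have g: "(g has_derivative frechet_derivative g (at x)) (at x)" using Ck_SucD[OF Suc.prems(1) x] .
    have f: "(f has_derivative frechet_derivative f (at (g x))) (at (g x))"
      using Ck_SucD[OF Suc.prems(2)] x assms(5) by blast
    have D: "((\<lambda>x. f (g x)) has_derivative (\<lambda>v. frechet_derivative f (at (g x)) (frechet_derivative g (at x) v))) (at x)"
      using has_derivative_compose[OF g f] .
    have rep: "frechet_derivative f (at (g x)) w = (\<Sum>c\<in>Basis. (w \<bullet> c) *\<^sub>R frechet_derivative f (at (g x)) c)" for w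
    proof -
      interpret linear "frechet_derivative f (at (g x))"
        using has_derivative_linear[OF f] .
      have "frechet_derivative f (at (g x)) w = frechet_derivative f (at (g x)) (\<Sum>c\<in>Basis. (w \<bullet> c) *\<^sub>R c)"
        by (simp add: euclidean_representation)
      then show ?thesis by (simp add: sum scaleR)
    qed
    show "((\<lambda>x. f (g x)) has_derivative
       (\<lambda>v. \<Sum>c\<in>Basis. (frechet_derivative g (at x) v \<bullet> c) *\<^sub>R frechet_derivative f (at (g x)) c)) (at x)"
      using D by (subst rep[symmetric])
  next
    fix b :: 'a assume b: "b \<in> Basis"
    show "Ck k
       (\<lambda>x. \<Sum>c\<in>Basis. (frechet_derivative g (at x) b \<bullet> c) *\<^sub>R frechet_derivative f (at (g x)) c) U"
    proof (intro Ck_sum Ck_scaleR \<open>open U\<close>)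
      fix c :: 'b assume c: "c \<in> Basis"
      show "Ck k (\<lambda>x. frechet_derivative g (at x) b \<bullet> c) U"
        using Suc.prems(1) b by (intro Ck_bounded_linear[OF bounded_linear_inner_left] \<open>open U\<close>) simp
      show "Ck k (\<lambda>x. frechet_derivative f (at (g x)) c) U"
        using Suc.prems(2) c by (intro Suc.IH[OF Ck_Suc_imp[OF Suc.prems(1)]]) simp
    qed
  qed
qed

text \<open>
  All exponents are treated at once because differentiation lowers the exponent by 1; reciprocals and square
  roots are the instances needed later.
\<close>

lemma Ck_powr:
  fixes g :: "'a::euclidean_space \<Rightarrow> real"
  assumes "open U" "Ck k g U" "\<And>x. x \<in> U \<Longrightarrow> g x > 0"
  shows "Ck k (\<lambda>x. g x powr p) U"
  using assms(2)
proof (induction k arbitrary: p)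
  case 0
  then show ?case using assms(3) by (auto intro!: continuous_on_powr simp: less_imp_neq[symmetric])
next
  case (Suc k)
  show ?case
  proof (rule Ck_SucI[OF \<open>open U\<close>])
    fix x assume x: "x \<in> U"
    have g: "(g has_derivative frechet_derivative g (at x)) (at x)" using Ck_SucD[OF Suc.prems(1) x] .
    have "((\<lambda>t::real. t powr p) has_real_derivative p * g x powr (p - 1)) (at (g x))"
      using assms(3)[OF x] by (auto intro!: derivative_eq_intros simp: powr_diff)
    then have "((\<lambda>t::real. t powr p) has_derivative (*) (p * g x powr (p - 1))) (at (g x))"
      by (simp only: has_field_derivative_def)
    from has_derivative_compose[OF g this]
    show "((\<lambda>x. g x powr p) has_derivative
       (\<lambda>v. p * g x powr (p - 1) * frechet_derivative g (at x) v)) (at x)"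
      by (simp add: mult_ac)
  next
    fix b :: 'a assume "b \<in> Basis"
    then show "Ck k
       (\<lambda>x. p * g x powr (p - 1) * frechet_derivative g (at x) b) U"
      using Suc Ck_Suc_imp[OF Suc.prems(1)] by (intro Ck_mult Ck_const \<open>open U\<close>) auto
  qed
qed

lemma Ck_vector:
  fixes f :: "'a::euclidean_space \<Rightarrow> real^'n"
  assumes "open U" "\<And>i. Ck k (\<lambda>x. f x $ i) U"
  shows "Ck k f U"
proof -
  have "f x = (\<Sum>i\<in>UNIV. f x $ i *\<^sub>R axis i 1)" for x
    using basis_expansion[of "f x"] by (simp add: scalar_mult_eq_scaleR)
  then have e: "f = (\<lambda>x. \<Sum>i\<in>UNIV. f x $ i *\<^sub>R axis i 1)" by blast
  show ?thesis by (subst e) (intro Ck_sum Ck_scaleR Ck_const assms)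
qed

lemma smooth_on_Ck: "smooth_on f U \<Longrightarrow> Ck k f U"
  by (simp add: smooth_on_def)

lemma smooth_onI: "(\<And>k. Ck k f U) \<Longrightarrow> smooth_on f U"
  by (simp add: smooth_on_def)

lemma smooth_on_has_derivative:
  "smooth_on f U \<Longrightarrow> x \<in> U \<Longrightarrow> (f has_derivative frechet_derivative f (at x)) (at x)"
  unfolding smooth_on_def by (blast intro: Ck_SucD)

lemma smooth_on_continuous: "smooth_on f U \<Longrightarrow> continuous_on U f"
  unfolding smooth_on_def by (blast intro: Ck_imp_continuous)

lemma smooth_on_partial:
  "smooth_on f U \<Longrightarrow> b \<in> Basis \<Longrightarrow> smooth_on (\<lambda>x. frechet_derivative f (at x) b) U"
  by (rule smooth_onI) (use smooth_on_Ck[of f U "Suc _"] in simp)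

lemma vector_2_axis: "vector [a, b] = a *\<^sub>R axis 1 1 + b *\<^sub>R (axis 2 1 :: real^2)"
  by (simp add: vec_eq_iff forall_2 axis_def)

lemma vector_3_axis: "vector [a, b, c] = a *\<^sub>R axis 1 1 + b *\<^sub>R axis 2 1 + c *\<^sub>R (axis 3 1 :: real^3)"
  by (simp add: vec_eq_iff forall_3 axis_def)

lemma linear_real2_expand:
  assumes "linear (L :: real^2 \<Rightarrow> 'a::real_vector)"
  shows "L v = v $ 1 *\<^sub>R L (axis 1 1) + v $ 2 *\<^sub>R L (axis 2 1)"
proof -
  have "v = v $ 1 *\<^sub>R axis 1 1 + v $ 2 *\<^sub>R axis 2 (1::real)"
    by (simp add: vec_eq_iff forall_2 axis_def)
  then have "L v = L (v $ 1 *\<^sub>R axis 1 1 + v $ 2 *\<^sub>R axis 2 1)" by simp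
  then show ?thesis by (simp add: linear_add[OF assms] linear_scale[OF assms])
qed

text \<open>
  Bootstrapping: the derivative of the inverse at \<open>v\<close> is the inverse matrix of the derivative of \<open>\<tau>\<close> at
  \<open>\<psi> v\<close>, a rational expression in functions composed with \<open>\<psi>\<close>, so each order of smoothness of \<open>\<psi>\<close> yields the
  next one. The inverse determinant is written as \<open>d * (d * d) powr (-1)\<close> because \<open>d\<close> may be negative.
\<close>

lemma smooth_inverse:
  fixes \<tau> \<psi> :: "real^2 \<Rightarrow> real^2"
  assumes V: "open V" and W: "open W" and \<psi>W: "\<psi> ` V \<subseteq> W" and \<tau>: "smooth_on \<tau> W" and c: "continuous_on V \<psi>"
    and der: "\<And>v. v \<in> V \<Longrightarrow> (\<psi> has_derivative inv (frechet_derivative \<tau> (at (\<psi> v)))) (at v)"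
    and bij: "\<And>v. v \<in> V \<Longrightarrow> bij (frechet_derivative \<tau> (at (\<psi> v)))"
  shows "smooth_on \<psi> V"
proof (rule smooth_onI)
  define a where "a i j w = frechet_derivative \<tau> (at w) (axis j 1) $ i" for i j w
  define d where "d w = a 1 1 w * a 2 2 w - a 1 2 w * a 2 1 w" for w
  have aC: "Ck k (a i j) W" for k i j
    unfolding a_def[abs_def]
    by (intro Ck_bounded_linear[OF bounded_linear_vec_nth W] smooth_on_Ck smooth_on_partial[OF \<tau>]) auto
  have dC: "Ck k d W" for k
  proof -
    have "Ck k (\<lambda>w. a 1 1 w * a 2 2 w + (-1) * (a 1 2 w * a 2 1 w)) W"
      by (intro Ck_add Ck_mult W aC Ck_const)
    then show ?thesis unfolding d_def[abs_def] by simp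
  qed
  have lin: "linear (frechet_derivative \<tau> (at (\<psi> v)))" if "v \<in> V" for v
    using smooth_on_has_derivative[OF \<tau>, of "\<psi> v"] that \<psi>W by (auto intro: has_derivative_linear)
  have ex: "frechet_derivative \<tau> (at (\<psi> v)) x $ i = x $ 1 * a i 1 (\<psi> v) + x $ 2 * a i 2 (\<psi> v)" if "v \<in> V" for v x i
    by (subst linear_real2_expand[OF lin[OF that]]) (simp add: a_def)
  have dnz: "d (\<psi> v) \<noteq> 0" if "v \<in> V" for v
  proof -
    have "det (matrix (frechet_derivative \<tau> (at (\<psi> v)))) \<noteq> 0"
      using det_nz_iff_inj[OF lin[OF that]] bij[OF that] by (simp add: bij_def)
    then show ?thesis by (simp add: det_2 matrix_def d_def a_def)
  qed
  have inv_eq: "inv (frechet_derivative \<tau> (at (\<psi> v))) b =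
     vector [(a 2 2 (\<psi> v) * b $ 1 - a 1 2 (\<psi> v) * b $ 2) / d (\<psi> v), (a 1 1 (\<psi> v) * b $ 2 - a 2 1 (\<psi> v) * b $ 1) / d (\<psi> v)]"
    (is "_ = ?x") if v: "v \<in> V" for v b
  proof (rule inv_f_eq)
    show "inj (frechet_derivative \<tau> (at (\<psi> v)))" using bij[OF v] by (simp add: bij_def)
    show "frechet_derivative \<tau> (at (\<psi> v)) ?x = b"
      using dnz[OF v] by (simp add: vec_eq_iff forall_2 ex[OF v] field_simps) (simp add: d_def algebra_simps)
  qed
  fix k show "Ck k \<psi> V"
  proof (induction k)
    case 0
    then show ?case using c by simp
  next
    case (Suc k)
    have aP: "Ck k (\<lambda>v. a i j (\<psi> v)) V" for i j
      by (rule Ck_compose[OF V W Suc aC \<psi>W])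
    have dP: "Ck k (\<lambda>v. d (\<psi> v)) V" by (rule Ck_compose[OF V W Suc dC \<psi>W])
    have iP: "Ck k (\<lambda>v. d (\<psi> v) * (d (\<psi> v) * d (\<psi> v)) powr (-1)) V"
      using dnz by (intro Ck_mult Ck_powr V dP) (auto simp: zero_less_mult_iff linorder_neq_iff)
    have e: "x / d (\<psi> v) = x * (d (\<psi> v) * (d (\<psi> v) * d (\<psi> v)) powr (-1))" if "v \<in> V" for x v
      using dnz[OF that] by (simp add: powr_minus_divide field_simps)
    show ?case
    proof (rule Ck_SucI[OF V der])
      fix b :: "real^2"
      have C1: "Ck k
        (\<lambda>v. (a 2 2 (\<psi> v) * b $ 1 + (-1) * (a 1 2 (\<psi> v) * b $ 2)) * (d (\<psi> v) * (d (\<psi> v) * d (\<psi> v)) powr (-1))) V"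
        by (intro Ck_mult[OF V _ iP] Ck_add Ck_mult V aP Ck_const)
      have C2: "Ck k
        (\<lambda>v. (a 1 1 (\<psi> v) * b $ 2 + (-1) * (a 2 1 (\<psi> v) * b $ 1)) * (d (\<psi> v) * (d (\<psi> v) * d (\<psi> v)) powr (-1))) V"
        by (intro Ck_mult[OF V _ iP] Ck_add Ck_mult V aP Ck_const)
      have "Ck k (\<lambda>v. vector
         [(a 2 2 (\<psi> v) * b $ 1 + (-1) * (a 1 2 (\<psi> v) * b $ 2)) * (d (\<psi> v) * (d (\<psi> v) * d (\<psi> v)) powr (-1)),
          (a 1 1 (\<psi> v) * b $ 2 + (-1) * (a 2 1 (\<psi> v) * b $ 1)) * (d (\<psi> v) * (d (\<psi> v) * d (\<psi> v)) powr (-1))] :: real^2) V"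
      proof (rule Ck_vector[OF V])
        fix i :: 2 show "Ck k (\<lambda>v. (vector
         [(a 2 2 (\<psi> v) * b $ 1 + (-1) * (a 1 2 (\<psi> v) * b $ 2)) * (d (\<psi> v) * (d (\<psi> v) * d (\<psi> v)) powr (-1)),
          (a 1 1 (\<psi> v) * b $ 2 + (-1) * (a 2 1 (\<psi> v) * b $ 1)) * (d (\<psi> v) * (d (\<psi> v) * d (\<psi> v)) powr (-1))] :: real^2) $ i) V"
          using C1 C2 exhaust_2[of i] by (elim disjE) (simp_all only: vector_2)
      qed
      then show "Ck k (\<lambda>v. inv (frechet_derivative \<tau> (at (\<psi> v))) b) V"
        by (subst Ck_cong[OF V]) (auto simp: inv_eq e)
    qed
  qed
qed

section \<open>Taylor expansion into homogeneous parts\<close>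

lemma mean_value_bound_ray:
  fixes q :: "'a::euclidean_space \<Rightarrow> real"
  assumes "q 0 = 0" "\<And>t. 0 \<le> t \<Longrightarrow> t \<le> 1 \<Longrightarrow> ((\<lambda>t. q (t *\<^sub>R u)) has_real_derivative D t) (at t)"
    "\<And>t. 0 \<le> t \<Longrightarrow> t \<le> 1 \<Longrightarrow> \<bar>D t\<bar> \<le> B"
  shows "\<bar>q u\<bar> \<le> B"
proof -
  obtain t where t: "0 < t" "t < 1" "q (1 *\<^sub>R u) - q (0 *\<^sub>R u) = (1 - 0) * D t"
    using MVT2[of 0 1 "\<lambda>t. q (t *\<^sub>R u)" D] assms(2) by (metis zero_less_one)
  then show ?thesis using assms(1) assms(3)[of t] by auto
qed

text \<open>
  Taylor's formula in which only the homogeneity of the parts is recorded: this is all that parity and scaling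
  arguments use. By induction, integrating the expansions of the partial derivatives along rays divides the
  part of degree \<open>k\<close> by \<open>k\<close>. The same expansions give the radial derivative, on which the part of degree \<open>k\<close>
  appears with the factor \<open>k\<close>. Homogeneity for all real \<open>c\<close>, negative ones included, encodes parity.
\<close>

lemma homogeneous_Taylor:
  fixes f :: "'a::euclidean_space \<Rightarrow> real"
  assumes "Ck n f (ball 0 R)" "0 < R"
  shows "\<exists>P C. (\<forall>k. continuous_on UNIV (P k)) \<and> (\<forall>k c u. P k (c *\<^sub>R u) = c ^ k * P k u) \<and>
    (\<forall>k. \<exists>M. \<forall>u. \<bar>P k u\<bar> \<le> M * norm u ^ k) \<and>
    (\<forall>u\<in>ball 0 (R/2). \<bar>f u - (\<Sum>k<n. P k u)\<bar> \<le> C * norm u ^ n) \<and>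
    (\<forall>u\<in>ball 0 (R/2). 0 < n \<longrightarrow>
      \<bar>frechet_derivative f (at u) u - (\<Sum>k<n. real k * P k u)\<bar> \<le> C * norm u ^ n)"
  using assms(1)
proof (induction n arbitrary: f)
  case 0
  have "compact (f ` cball 0 (R/2))"
    using 0 assms(2) by (intro compact_continuous_image) (auto elim!: continuous_on_subset)
  then obtain C where C: "\<And>x. x \<in> cball 0 (R/2) \<Longrightarrow> \<bar>f x\<bar> \<le> C"
    by (force dest!: compact_imp_bounded simp: bounded_iff)
  then show ?case by (intro exI[of _ "\<lambda>_ _. 0"] exI[of _ C]) (auto intro!: exI[of _ 0])
next
  case (Suc n)
  define d where "d b u = frechet_derivative f (at u) b" for b u
  have "\<forall>b\<in>Basis. \<exists>P C. (\<forall>k. continuous_on UNIV (P k)) \<and> (\<forall>k c u. P k (c *\<^sub>R u) = c ^ k * P k u) \<and>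
    (\<forall>k. \<exists>M. \<forall>u. \<bar>P k u\<bar> \<le> M * norm u ^ k) \<and>
    (\<forall>u\<in>ball 0 (R/2). \<bar>d b u - (\<Sum>k<n. P k u)\<bar> \<le> C * norm u ^ n)"
  proof
    fix b :: 'a assume "b \<in> Basis"
    then have "Ck n (d b) (ball 0 R)"
      using Suc.prems by (simp add: d_def[abs_def])
    from Suc.IH[OF this] show "\<exists>P C. (\<forall>k. continuous_on UNIV (P k)) \<and> (\<forall>k c u. P k (c *\<^sub>R u) = c ^ k * P k u) \<and>
    (\<forall>k. \<exists>M. \<forall>u. \<bar>P k u\<bar> \<le> M * norm u ^ k) \<and>
    (\<forall>u\<in>ball 0 (R/2). \<bar>d b u - (\<Sum>k<n. P k u)\<bar> \<le> C * norm u ^ n)" by blast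
  qed
  then obtain P C where cont: "\<And>b k. b \<in> Basis \<Longrightarrow> continuous_on UNIV (P b k)"
    and hom: "\<And>b k c u. b \<in> Basis \<Longrightarrow> P b k (c *\<^sub>R u) = c ^ k * P b k u"
    and bd: "\<And>b k. b \<in> Basis \<Longrightarrow> \<exists>M. \<forall>u. \<bar>P b k u\<bar> \<le> M * norm u ^ k"
    and app: "\<And>b u. b \<in> Basis \<Longrightarrow> u \<in> ball 0 (R/2) \<Longrightarrow> \<bar>d b u - (\<Sum>k<n. P b k u)\<bar> \<le> C b * norm u ^ n"
    by metis
  define Q where "Q k u = (case k of 0 \<Rightarrow> f 0 | Suc j \<Rightarrow> (\<Sum>b\<in>Basis. (u \<bullet> b) * P b j u) / real (Suc j))" for k u
  define K where "K = (\<Sum>b\<in>Basis. C b)"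
  have Q0: "Q 0 u = f 0" and QS: "real (Suc j) * Q (Suc j) u = (\<Sum>b\<in>Basis. (u \<bullet> b) * P b j u)" for u j
    by (simp_all add: Q_def)
  have Qcont: "continuous_on UNIV (Q k)" for k
    by (cases k) (auto simp: Q_def intro!: continuous_intros cont)
  have Qhom: "Q k (c *\<^sub>R u) = c ^ k * Q k u" for k c u
    by (cases k) (auto simp: Q_def hom sum_distrib_left sum_divide_distrib mult_ac)
  have C0: "0 \<le> C b" if b: "b \<in> Basis" for b
  proof -
    obtain b0 :: 'a where b0: "b0 \<in> Basis" using nonempty_Basis by blast
    have "0 \<le> C b * norm ((R/3) *\<^sub>R b0) ^ n"
      using app[OF b, of "(R/3) *\<^sub>R b0"] b0 assms(2) by auto
    moreover have "0 < norm ((R/3) *\<^sub>R b0) ^ n" using b0 assms(2) by simp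
    ultimately show ?thesis by (meson mult_neg_pos not_le)
  qed
  have Qbd: "\<exists>M. \<forall>u. \<bar>Q k u\<bar> \<le> M * norm u ^ k" for k
  proof (cases k)
    case 0 then show ?thesis by (auto simp: Q_def)
  next
    case (Suc j)
    obtain M where M: "\<And>b u. b \<in> Basis \<Longrightarrow> \<bar>P b j u\<bar> \<le> M b * norm u ^ j"
      using bchoice[of Basis "\<lambda>b M. \<forall>u. \<bar>P b j u\<bar> \<le> M * norm u ^ j"] bd[of _ j] by blast
    have "\<bar>Q k u\<bar> \<le> ((\<Sum>b\<in>Basis. M b) / real (Suc j)) * norm u ^ k" for u
    proof -
      have "\<bar>\<Sum>b\<in>Basis. (u \<bullet> b) * P b j u\<bar> \<le> (\<Sum>b\<in>Basis. norm u * (M b * norm u ^ j))"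
        using M Basis_le_norm[of _ u] by (auto intro!: order_trans[OF sum_abs] sum_mono mult_mono simp: abs_mult)
      also have "\<dots> = (\<Sum>b\<in>Basis. M b) * norm u ^ k"
        unfolding Suc sum_distrib_right by (intro sum.cong) simp_all
      finally show ?thesis by (simp add: Q_def Suc divide_right_mono)
    qed
    then show ?thesis by blast
  qed
  have fd: "(f has_derivative frechet_derivative f (at u)) (at u)" if "u \<in> ball 0 R" for u
    using Ck_SucD[OF Suc.prems that] .
  have fdu: "frechet_derivative f (at x) u = (\<Sum>b\<in>Basis. (u \<bullet> b) * d b x)" if "x \<in> ball 0 R" for x u
  proof -
    interpret linear "frechet_derivative f (at x)" using has_derivative_linear[OF fd[OF that]] .
    have "frechet_derivative f (at x) u = frechet_derivative f (at x) (\<Sum>c\<in>Basis. (u \<bullet> c) *\<^sub>R c)"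
      by (simp add: euclidean_representation)
    then show ?thesis by (simp add: sum scaleR d_def)
  qed
  have key: "\<bar>(\<Sum>b\<in>Basis. (u \<bullet> b) * d b (t *\<^sub>R u)) - (\<Sum>b\<in>Basis. (u \<bullet> b) * (\<Sum>k<n. P b k (t *\<^sub>R u)))\<bar>
      \<le> K * norm u ^ Suc n" if u: "u \<in> ball 0 (R/2)" and t: "0 \<le> t" "t \<le> 1" for u t
  proof -
    have n: "norm (t *\<^sub>R u) \<le> norm u" using t by (simp add: mult_left_le_one_le)
    then have tu: "t *\<^sub>R u \<in> ball 0 (R/2)" using u by auto
    have "\<bar>\<Sum>b\<in>Basis. (u \<bullet> b) * (d b (t *\<^sub>R u) - (\<Sum>k<n. P b k (t *\<^sub>R u)))\<bar>
      \<le> (\<Sum>b\<in>Basis. norm u * (C b * norm u ^ n))"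
    proof (rule order_trans[OF sum_abs sum_mono])
      fix b :: 'a assume b: "b \<in> Basis"
      have "\<bar>d b (t *\<^sub>R u) - (\<Sum>k<n. P b k (t *\<^sub>R u))\<bar> \<le> C b * norm u ^ n"
        using app[OF b tu] C0[OF b] n by (meson mult_left_mono norm_ge_zero order_trans power_mono)
      then show "\<bar>(u \<bullet> b) * (d b (t *\<^sub>R u) - (\<Sum>k<n. P b k (t *\<^sub>R u)))\<bar> \<le> norm u * (C b * norm u ^ n)"
        using Basis_le_norm[OF b, of u] by (auto simp: abs_mult intro!: mult_mono)
    qed
    also have "\<dots> = K * norm u ^ Suc n"
      unfolding K_def sum_distrib_right by (intro sum.cong) simp_all
    finally show ?thesis by (simp only: right_diff_distrib sum_subtractf)
  qed
  have rad: "(\<Sum>k<Suc n. real k * Q k u) = (\<Sum>b\<in>Basis. (u \<bullet> b) * (\<Sum>k<n. P b k u))" for u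
  proof -
    have "(\<Sum>k<Suc n. real k * Q k u) = (\<Sum>k<n. real (Suc k) * Q (Suc k) u)"
      by (subst sum.lessThan_Suc_shift) simp
    also have "\<dots> = (\<Sum>b\<in>Basis. (u \<bullet> b) * (\<Sum>k<n. P b k u))"
      by (simp only: QS sum_distrib_left) (rule sum.swap)
    finally show ?thesis .
  qed
  have a1: "\<bar>frechet_derivative f (at u) u - (\<Sum>k<Suc n. real k * Q k u)\<bar> \<le> K * norm u ^ Suc n"
    if "u \<in> ball 0 (R/2)" for u
    using key[OF that, of 1] that assms(2) fdu[of u u] unfolding rad by simp
  have a2: "\<bar>f u - (\<Sum>k<Suc n. Q k u)\<bar> \<le> K * norm u ^ Suc n" if u: "u \<in> ball 0 (R/2)" for u
  proof (rule mean_value_bound_ray[where q = "\<lambda>u. f u - (\<Sum>k<Suc n. Q k u)" and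
        D = "\<lambda>t. (\<Sum>b\<in>Basis. (u \<bullet> b) * d b (t *\<^sub>R u)) - (\<Sum>b\<in>Basis. (u \<bullet> b) * (\<Sum>k<n. P b k (t *\<^sub>R u)))"])
    have "Q (Suc k) 0 = 0" for k by (simp add: Q_def)
    then show "f 0 - (\<Sum>k<Suc n. Q k 0) = 0" by (subst sum.lessThan_Suc_shift) (simp add: Q0)
    fix t :: real assume t: "0 \<le> t" "t \<le> 1"
    show "\<bar>(\<Sum>b\<in>Basis. (u \<bullet> b) * d b (t *\<^sub>R u)) - (\<Sum>b\<in>Basis. (u \<bullet> b) * (\<Sum>k<n. P b k (t *\<^sub>R u)))\<bar>
      \<le> K * norm u ^ Suc n" by (rule key[OF u t])
    have "norm (t *\<^sub>R u) \<le> norm u" using t by (simp add: mult_left_le_one_le)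
    then have tu: "t *\<^sub>R u \<in> ball 0 R" using u assms(2) by auto
    have 1: "((\<lambda>t. f (t *\<^sub>R u)) has_real_derivative frechet_derivative f (at (t *\<^sub>R u)) u) (at t)"
    proof -
      have "((\<lambda>t. t *\<^sub>R u) has_derivative (\<lambda>h. h *\<^sub>R u)) (at t)" by (auto intro!: derivative_eq_intros)
      from has_derivative_compose[OF this fd[OF tu]]
      have "((\<lambda>t. f (t *\<^sub>R u)) has_derivative (\<lambda>h. frechet_derivative f (at (t *\<^sub>R u)) (h *\<^sub>R u))) (at t)" .
      moreover have "(\<lambda>h. frechet_derivative f (at (t *\<^sub>R u)) (h *\<^sub>R u)) = (*) (frechet_derivative f (at (t *\<^sub>R u)) u)"
        by (rule ext) (simp add: linear_cmul[OF has_derivative_linear[OF fd[OF tu]]])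
      ultimately show ?thesis by (simp add: has_field_derivative_def)
    qed
    have 2: "((\<lambda>t. \<Sum>k<Suc n. Q k (t *\<^sub>R u)) has_real_derivative
        (\<Sum>b\<in>Basis. (u \<bullet> b) * (\<Sum>k<n. P b k (t *\<^sub>R u)))) (at t)"
    proof -
      have "((\<lambda>t. \<Sum>k<Suc n. t ^ k * Q k u) has_real_derivative (\<Sum>k<Suc n. real k * t ^ (k - 1) * Q k u)) (at t)"
        by (auto intro!: derivative_eq_intros sum.cong)
      moreover have "(\<Sum>k<Suc n. real k * t ^ (k - 1) * Q k u) = (\<Sum>k<n. t ^ k * (real (Suc k) * Q (Suc k) u))"
        by (subst sum.lessThan_Suc_shift) (simp add: mult_ac)
      moreover have "\<dots> = (\<Sum>b\<in>Basis. (u \<bullet> b) * (\<Sum>k<n. P b k (t *\<^sub>R u)))"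
        unfolding QS sum_distrib_left by (subst sum.swap) (simp add: hom mult_ac)
      ultimately show ?thesis by (simp add: Qhom del: sum.lessThan_Suc)
    qed
    show "((\<lambda>t. f (t *\<^sub>R u) - (\<Sum>k<Suc n. Q k (t *\<^sub>R u))) has_real_derivative
      (\<Sum>b\<in>Basis. (u \<bullet> b) * d b (t *\<^sub>R u)) - (\<Sum>b\<in>Basis. (u \<bullet> b) * (\<Sum>k<n. P b k (t *\<^sub>R u)))) (at t)"
      using DERIV_diff[OF 1 2] fdu[OF tu, of u] by simp
  qed
  show ?case
    using a1 a2 Qcont Qhom Qbd by (intro exI[of _ Q] exI[of _ K]) blast
qed

lemma homogeneous_Taylor_obtain:
  fixes f :: "'a::euclidean_space \<Rightarrow> real"
  assumes "Ck n f (ball 0 R)" "0 < R" "0 < n"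
  obtains P C M where "\<And>k. continuous_on UNIV (P k)" "\<And>k c u. P k (c *\<^sub>R u) = c ^ k * P k u"
    "\<And>k u. \<bar>P k u\<bar> \<le> M k * norm u ^ k" "0 \<le> C"
    "\<And>u. u \<in> ball 0 (R/2) \<Longrightarrow> \<bar>f u - (\<Sum>k<n. P k u)\<bar> \<le> C * norm u ^ n"
    "\<And>u. u \<in> ball 0 (R/2) \<Longrightarrow> \<bar>frechet_derivative f (at u) u - (\<Sum>k<n. real k * P k u)\<bar> \<le> C * norm u ^ n"
proof -
  obtain P C where P: "\<forall>k. continuous_on UNIV (P k)" "\<forall>k c u. P k (c *\<^sub>R u) = c ^ k * P k u"
    "\<forall>k. \<exists>M. \<forall>u. \<bar>P k u\<bar> \<le> M * norm u ^ k"
    "\<forall>u\<in>ball 0 (R/2). \<bar>f u - (\<Sum>k<n. P k u)\<bar> \<le> C * norm u ^ n"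
    "\<forall>u\<in>ball 0 (R/2). 0 < n \<longrightarrow> \<bar>frechet_derivative f (at u) u - (\<Sum>k<n. real k * P k u)\<bar> \<le> C * norm u ^ n"
    using homogeneous_Taylor[OF assms(1,2)] by blast
  from choice[OF P(3)] obtain M where M: "\<forall>k u. \<bar>P k u\<bar> \<le> M k * norm u ^ k" by blast
  have le: "C * norm u ^ n \<le> \<bar>C\<bar> * norm u ^ n" for u :: 'a by (intro mult_right_mono) auto
  have 1: "\<bar>f u - (\<Sum>k<n. P k u)\<bar> \<le> \<bar>C\<bar> * norm u ^ n" if "u \<in> ball 0 (R/2)" for u
    by (rule order_trans[OF bspec[OF P(4) that] le])
  have 2: "\<bar>frechet_derivative f (at u) u - (\<Sum>k<n. real k * P k u)\<bar> \<le> \<bar>C\<bar> * norm u ^ n" if "u \<in> ball 0 (R/2)" for u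
    using bspec[OF P(5) that] assms(3) le[of u] by linarith
  show ?thesis
    by (rule that[of P M "\<bar>C\<bar>"]) (use P(1,2) M 1 2 in auto)
qed

lemma C1_Lipschitz_at_0:
  fixes F :: "'a::euclidean_space \<Rightarrow> real"
  assumes "Ck 1 F (ball 0 R)" "0 < R"
  obtains C where "0 \<le> C" "\<And>u. u \<in> ball 0 (R/2) \<Longrightarrow> \<bar>F u - F 0\<bar> \<le> C * norm u"
proof -
  have n1: "0 < (1::nat)" by simp
  obtain P C M where P: "\<And>k. continuous_on UNIV (P k)" "\<And>k c u. P k (c *\<^sub>R u) = c ^ k * P k u"
    "\<And>k u. \<bar>P k u\<bar> \<le> M k * norm u ^ k" "0 \<le> C"
    "\<And>u. u \<in> ball 0 (R/2) \<Longrightarrow> \<bar>F u - (\<Sum>k<1. P k u)\<bar> \<le> C * norm u ^ 1"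
    "\<And>u. u \<in> ball 0 (R/2) \<Longrightarrow> \<bar>frechet_derivative F (at u) u - (\<Sum>k<1. real k * P k u)\<bar> \<le> C * norm u ^ 1"
    by (rule homogeneous_Taylor_obtain[OF assms n1]) (rule that)
  have c: "P 0 u = P 0 0" for u :: 'a using P(2)[of 0 0 u] by simp
  have b: "\<bar>F u - P 0 u\<bar> \<le> C * norm u" if "u \<in> ball 0 (R/2)" for u using P(5)[OF that] by simp
  have "F 0 = P 0 0" using b[of 0] assms(2) by simp
  then have "\<bar>F u - F 0\<bar> \<le> C * norm u" if "u \<in> ball 0 (R/2)" for u
    using b[OF that] c[of u] by simp
  with P(4) show ?thesis by (rule that)
qed

text \<open>
  Along a ray the sum is a polynomial in \<open>t\<close> of size \<open>O(t^m)\<close>, so its coefficients below order \<open>m\<close> are zero.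
\<close>

lemma homogeneous_parts_vanish:
  fixes P :: "nat \<Rightarrow> 'a::real_normed_vector \<Rightarrow> real"
  assumes hom: "\<And>k c u. P k (c *\<^sub>R u) = c ^ k * P k u" and r: "r > 0"
    and bd: "\<And>u. u \<in> ball 0 r \<Longrightarrow> \<bar>\<Sum>k<n. P k u\<bar> \<le> C * norm u ^ m" and "m \<le> n"
  shows "k < m \<Longrightarrow> P k u = 0"
proof (induction k rule: less_induct)
  case (less k)
  have kn: "k < n" using less.prems \<open>m \<le> n\<close> by simp
  have split: "(\<Sum>j<n. P j (t *\<^sub>R u)) = t ^ k * (\<Sum>j\<in>{k..<n}. t ^ (j - k) * P j u)" for t
  proof -
    have "(\<Sum>j<n. P j (t *\<^sub>R u)) = (\<Sum>j\<in>{k..<n}. P j (t *\<^sub>R u))"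
      using less by (intro sum.mono_neutral_right) (auto simp: hom)
    also have "\<dots> = t ^ k * (\<Sum>j\<in>{k..<n}. t ^ (j - k) * P j u)"
      unfolding sum_distrib_left hom by (intro sum.cong) (auto simp flip: power_add mult.assoc)
    finally show ?thesis .
  qed
  (* The polynomial with t^k divided out: its value at 0 is P k u, and it is O(t^(m - k)). *)
  let ?g = "\<lambda>t. \<Sum>j\<in>{k..<n}. t ^ (j - k) * P j u"
  have "(?g \<longlongrightarrow> ?g 0) (at_right 0)"
    by (intro tendsto_intros tendsto_ident_at)
  moreover have "?g 0 = P k u"
  proof -
    have "{k..<n} = insert k {Suc k..<n}" using kn by auto
    moreover have "(\<Sum>j\<in>{Suc k..<n}. 0 ^ (j - k) * P j u) = 0"
      by (intro sum.neutral) (auto simp: power_0_left)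
    ultimately show ?thesis by simp
  qed
  ultimately have l1: "((\<lambda>t. \<bar>?g t\<bar>) \<longlongrightarrow> \<bar>P k u\<bar>) (at_right 0)" by (intro tendsto_rabs) simp
  have "((\<lambda>t. C * t ^ (m - k) * norm u ^ m) \<longlongrightarrow> C * 0 ^ (m - k) * norm u ^ m) (at_right 0)"
    by (intro tendsto_intros tendsto_ident_at)
  then have l2: "((\<lambda>t. C * t ^ (m - k) * norm u ^ m) \<longlongrightarrow> 0) (at_right 0)" using less.prems by (simp add: power_0_left)
  have "eventually (\<lambda>t. \<bar>?g t\<bar> \<le> C * t ^ (m - k) * norm u ^ m) (at_right 0)"
  proof -
    have "eventually (\<lambda>t. t \<in> {0<..<r / (norm u + 1)}) (at_right (0::real))"
      using r by (intro eventually_at_right_real divide_pos_pos add_nonneg_pos) auto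
    then show ?thesis
    proof (rule eventually_mono)
      fix t :: real assume t: "t \<in> {0<..<r / (norm u + 1)}"
      then have "t * (norm u + 1) < r" by (simp add: pos_less_divide_eq add_nonneg_pos)
      then have "t * norm u < r" using t by (simp add: distrib_left)
      then have "t *\<^sub>R u \<in> ball 0 r" using t by simp
      from bd[OF this] have "t ^ k * \<bar>?g t\<bar> \<le> C * (t * norm u) ^ m"
        using t by (simp only: split abs_mult) simp
      also have "\<dots> = t ^ k * (C * t ^ (m - k) * norm u ^ m)"
      proof -
        have "t ^ m = t ^ k * t ^ (m - k)" using less.prems by (simp flip: power_add)
        then show ?thesis by (simp add: power_mult_distrib mult_ac)
      qed
      finally show "\<bar>?g t\<bar> \<le> C * t ^ (m - k) * norm u ^ m" using t by simp
    qed
  qed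
  from tendsto_le[OF _ l2 l1 this] have "\<bar>P k u\<bar> \<le> 0" by (simp add: trivial_limit_at_right_real)
  then show ?case by simp
qed

section \<open>The boundary as a graph and its outward normal\<close>

lemma area_density_eqI:
  assumes "(\<phi> has_derivative D) (at u)"
  shows "area_density \<phi> u = norm (cross3 (D (axis 1 1)) (D (axis 2 1)))"
  using frechet_derivative_at[OF assms] by (simp add: area_density_def)

text \<open>
  The cross product of the transformed tangent vectors is the old one times the determinant.
\<close>

lemma area_density_chain:
  assumes "(\<gamma> has_derivative D) (at (\<tau> u))" "(\<tau> has_derivative E) (at u)"
  shows "area_density (\<lambda>u. \<gamma> (\<tau> u)) u = \<bar>det (matrix E)\<bar> * area_density \<gamma> (\<tau> u)"
proof -
  note D = linear_real2_expand[OF has_derivative_linear[OF assms(1)]]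
  have "cross3 (D (E (axis 1 1))) (D (E (axis 2 1))) = det (matrix E) *\<^sub>R cross3 (D (axis 1 1)) (D (axis 2 1))"
    unfolding D[of "E _"]
    by (simp add: det_2 matrix_def cross_add_left cross_add_right cross_mult_left cross_mult_right
        algebra_simps cross_skew[of "D (axis 2 1)" "D (axis 1 1)"])
  then show ?thesis
    by (simp add: area_density_eqI[OF has_derivative_compose[OF assms(2,1)]] area_density_eqI[OF assms(1)])
qed

lemma area_density_continuous:
  assumes "smooth_on \<phi> U" shows "continuous_on U (area_density \<phi>)"
  unfolding area_density_def[abs_def]
  by (intro continuous_on_norm continuous_on_cross smooth_on_continuous smooth_on_partial assms) auto

text \<open>
  \<open>base T\<close> and \<open>lift T h\<close> are the projection to the base plane and the graph parametrization in the
  coordinates \<open>T\<close>; \<open>downward T h\<close> is the normal \<open>(grad h, -1)\<close> of the graph, transported back, which points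
  out of the region above the graph.
\<close>

definition base :: "(real^3 \<Rightarrow> real^3) \<Rightarrow> real^3 \<Rightarrow> real^2" where
  "base T x = vector [T x $ 1, T x $ 2]"

definition lift :: "(real^3 \<Rightarrow> real^3) \<Rightarrow> (real^2 \<Rightarrow> real) \<Rightarrow> real^2 \<Rightarrow> real^3" where
  "lift T h w = inv T (vector [w $ 1, w $ 2, h w])"

definition downward :: "(real^3 \<Rightarrow> real^3) \<Rightarrow> (real^2 \<Rightarrow> real) \<Rightarrow> real^2 \<Rightarrow> real^3" where
  "downward T h w = inv T (vector [frechet_derivative h (at w) (axis 1 1),
     frechet_derivative h (at w) (axis 2 1), -1])"

locale graph_chart =
  fixes \<Omega> :: "(real^3) set" and p :: "real^3" and r :: real
    and T :: "real^3 \<Rightarrow> real^3" and h :: "real^2 \<Rightarrow> real"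
  assumes T: "orthogonal_transformation T" and h: "smooth_on h UNIV" and op: "open \<Omega>"
    and graph: "\<Omega> \<inter> ball p r = {x \<in> ball p r. T x $ 3 > h (vector [T x $ 1, T x $ 2])}"
begin

abbreviation "\<pi> \<equiv> base T"
abbreviation "\<gamma> \<equiv> lift T h"
abbreviation "m \<equiv> downward T h"
abbreviation "Dh w \<equiv> frechet_derivative h (at w)"
definition "F x = T x $ 3 - h (\<pi> x)"

lemma lin: "linear T" using T by (simp add: orthogonal_transformation_def)
lemma bij: "bij T" using T by (rule orthogonal_transformation_bij)
lemma Tinv[simp]: "T (inv T x) = x" "inv T (T x) = x"
  using bij by (simp_all add: bij_is_surj surj_f_inv_f bij_is_inj)
lemma Tinner: "T v \<bullet> T w = v \<bullet> w" using T by (simp add: orthogonal_transformation_def)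
lemma Tinv_orth: "orthogonal_transformation (inv T)" using T by (rule orthogonal_transformation_inv)
lemma lin_inv: "linear (inv T)" using Tinv_orth by (simp add: orthogonal_transformation_def)
lemma inner_inv: "inv T v \<bullet> inv T w = v \<bullet> w" using Tinv_orth by (simp add: orthogonal_transformation_def)

lemma base_lin: "linear \<pi>"
  using lin by (auto intro!: linearI simp: base_def vec_eq_iff forall_2 linear_add linear_scale)
lemma base_bl: "bounded_linear \<pi>" using base_lin by (simp add: linear_conv_bounded_linear)

lemma base_lift[simp]: "\<pi> (\<gamma> w) = w"
  by (simp add: base_def lift_def vec_eq_iff forall_2)

lemma F_lift[simp]: "F (\<gamma> w) = 0"
  by (simp add: F_def) (simp add: lift_def)

lemma lift_base: "F x = 0 \<Longrightarrow> \<gamma> (\<pi> x) = x"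
proof -
  assume "F x = 0"
  then have "vector [\<pi> x $ 1, \<pi> x $ 2, h (\<pi> x)] = T x"
    by (simp add: F_def vec_eq_iff forall_3) (simp add: base_def)
  then show ?thesis by (simp add: lift_def)
qed

lemma h_deriv: "(h has_derivative Dh w) (at w)"
  using smooth_on_has_derivative[OF h] by simp

lemma Dh_expand: "Dh w v = v $ 1 * Dh w (axis 1 1) + v $ 2 * Dh w (axis 2 1)"
  using linear_real2_expand[OF has_derivative_linear[OF h_deriv], of w v] unfolding real_scaleR_def .

lemma m_inner: "m w \<bullet> v = Dh w (\<pi> v) - T v $ 3"
proof -
  have "m w \<bullet> v = T (m w) \<bullet> T v" by (simp add: Tinner)
  also have "\<dots> = Dh w (axis 1 1) * T v $ 1 + Dh w (axis 2 1) * T v $ 2 - T v $ 3"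
    by (simp add: downward_def inner_vec_def sum_3)
  finally show ?thesis by (subst Dh_expand) (simp add: base_def)
qed

lemma m_nonzero[simp]: "m w \<noteq> 0"
proof
  assume "m w = 0"
  then have "T (m w) $ 3 = 0" using linear_0[OF lin] by simp
  then show False by (simp add: downward_def)
qed

text \<open>
  The gradient of \<open>F\<close> is \<open>-m\<close>; this ties the defining function of the domain to the normal.
\<close>

lemma F_deriv: "(F has_derivative (\<lambda>v. - (m (\<pi> x) \<bullet> v))) (at x)"
proof -
  have "((\<lambda>x. T x $ 3) has_derivative (\<lambda>v. T v $ 3)) (at x)"
    using bounded_linear_imp_has_derivative[OF bounded_linear_compose[OF bounded_linear_vec_nth
        lin[unfolded linear_conv_bounded_linear]]] .
  moreover have "((\<lambda>x. h (\<pi> x)) has_derivative (\<lambda>v. Dh (\<pi> x) (\<pi> v))) (at x)"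
    using has_derivative_compose[OF bounded_linear_imp_has_derivative[OF base_bl] h_deriv] .
  ultimately have "(F has_derivative (\<lambda>v. T v $ 3 - Dh (\<pi> x) (\<pi> v))) (at x)"
    unfolding F_def[abs_def] by (rule has_derivative_diff)
  then show ?thesis by (simp add: m_inner)
qed

lemma F_cont: "continuous_on UNIV F"
  by (intro continuous_at_imp_continuous_on ballI has_derivative_continuous[OF F_deriv])

lemma inside: "x \<in> ball p r \<Longrightarrow> x \<in> \<Omega> \<longleftrightarrow> F x > 0"
  using arg_cong[OF graph, of "\<lambda>A. x \<in> A"] unfolding F_def base_def by force

lemma outside: "x \<in> ball p r \<Longrightarrow> F x < 0 \<Longrightarrow> x \<notin> closure \<Omega>"
proof -
  assume x: "x \<in> ball p r" "F x < 0"
  have "open (ball p r \<inter> F -` {..<0})"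
    using F_cont by (intro open_Int open_ball open_vimage) auto
  moreover have "(ball p r \<inter> F -` {..<0}) \<inter> \<Omega> = {}" using inside by fastforce
  ultimately have "(ball p r \<inter> F -` {..<0}) \<inter> closure \<Omega> = {}"
    using open_Int_closure_eq_empty by blast
  then show ?thesis using x by auto
qed

lemma F_along:
  assumes "F x = 0"
  shows "((\<lambda>t. F (x + t *\<^sub>R v)) has_real_derivative - (m (\<pi> x) \<bullet> v)) (at 0)"
proof -
  have d: "((\<lambda>t. x + t *\<^sub>R v) has_derivative (\<lambda>s. s *\<^sub>R v)) (at 0)"
    by (auto intro!: derivative_eq_intros)
  have "(F has_derivative (\<lambda>v. - (m (\<pi> x) \<bullet> v))) (at (x + 0 *\<^sub>R v))" using F_deriv[of x] by simp
  from has_derivative_compose[OF d this]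
  have "((\<lambda>t. F (x + t *\<^sub>R v)) has_derivative (\<lambda>s. - (m (\<pi> x) \<bullet> (s *\<^sub>R v)))) (at 0)" .
  moreover have "(\<lambda>s. - (m (\<pi> x) \<bullet> (s *\<^sub>R v))) = (*) (- (m (\<pi> x) \<bullet> v))" by auto
  ultimately show ?thesis by (simp add: has_field_derivative_def)
qed

lemma stay_ball:
  assumes "x \<in> ball p r"
  shows "\<exists>d>0. \<forall>t. \<bar>t\<bar> < d \<longrightarrow> x + t *\<^sub>R v \<in> ball p r"
proof -
  have "open ((\<lambda>t. x + t *\<^sub>R v) -` ball p r)"
    by (intro open_vimage open_ball) (auto intro!: continuous_intros)
  moreover have "0 \<in> (\<lambda>t. x + t *\<^sub>R v) -` ball p r" using assms by simp
  ultimately obtain d where "d > 0" "ball 0 d \<subseteq> (\<lambda>t. x + t *\<^sub>R v) -` ball p r"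
    by (meson open_contains_ball)
  then show ?thesis by (intro exI[of _ d]) (auto simp: subset_eq)
qed

lemma exits:
  assumes "x \<in> ball p r" "F x = 0" "m (\<pi> x) \<bullet> v > 0"
  shows "\<exists>d>0. \<forall>t\<in>{0<..<d}. x + t *\<^sub>R v \<notin> closure \<Omega>"
proof -
  obtain d where d: "d > 0" "\<And>t. 0 < t \<Longrightarrow> t < d \<Longrightarrow> F (x + t *\<^sub>R v) < 0"
    using DERIV_neg_dec_right[OF F_along[OF assms(2), of v]] assms by auto
  moreover obtain e where "e > 0" "\<And>t. \<bar>t\<bar> < e \<Longrightarrow> x + t *\<^sub>R v \<in> ball p r"
    using stay_ball[OF assms(1)] by blast
  ultimately show ?thesis using outside by (intro exI[of _ "min d e"]) auto
qed

lemma enters: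
  assumes "x \<in> ball p r" "F x = 0" "m (\<pi> x) \<bullet> v < 0"
  shows "\<exists>d>0. \<forall>t\<in>{0<..<d}. x + t *\<^sub>R v \<in> \<Omega>"
proof -
  obtain d where d: "d > 0" "\<And>t. 0 < t \<Longrightarrow> t < d \<Longrightarrow> F (x + t *\<^sub>R v) > 0"
  proof -
    have "0 < - (m (\<pi> x) \<bullet> v)" using assms(3) by simp
    from DERIV_pos_inc_right[OF F_along[OF assms(2)] this] show ?thesis
      using that assms(2) by (auto simp only: add_0 scaleR_zero_left add_0_right)
  qed
  moreover obtain e where "e > 0" "\<And>t. \<bar>t\<bar> < e \<Longrightarrow> x + t *\<^sub>R v \<in> ball p r"
    using stay_ball[OF assms(1)] by blast
  ultimately show ?thesis using inside by (intro exI[of _ "min d e"]) auto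
qed

text \<open>
  Boundary points of the open set are not inside, and a point with \<open>F < 0\<close> is not in the closure. Conversely
  a point with \<open>F = 0\<close> is a limit of inside points, reached along \<open>-m\<close>.
\<close>

lemma frontier_iff: "x \<in> ball p r \<Longrightarrow> x \<in> frontier \<Omega> \<longleftrightarrow> F x = 0"
proof
  assume x: "x \<in> ball p r" "x \<in> frontier \<Omega>"
  then have "x \<in> closure \<Omega>" "x \<notin> \<Omega>" using op by (auto simp: frontier_def interior_open)
  then show "F x = 0" using outside[of x] inside[of x] x by fastforce
next
  assume x: "x \<in> ball p r" "F x = 0"
  have "m (\<pi> x) \<bullet> (- m (\<pi> x)) < 0" by simp
  from enters[OF x this] obtain d where d: "d > 0" "\<And>t. 0 < t \<Longrightarrow> t < d \<Longrightarrow> x + t *\<^sub>R (- m (\<pi> x)) \<in> \<Omega>"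
    by auto
  have "x \<in> closure \<Omega>"
  proof (rule closure_sequential[THEN iffD2], intro exI conjI allI)
    show "x + (d / real (n + 2)) *\<^sub>R (- m (\<pi> x)) \<in> \<Omega>" for n
      using d(1) by (intro d(2)) (auto simp: field_simps add_pos_nonneg)
    have "(\<lambda>n. x + (d / real (n + 2)) *\<^sub>R (- m (\<pi> x))) \<longlonglongrightarrow> x + 0 *\<^sub>R (- m (\<pi> x))"
      by (intro tendsto_intros) real_asymp
    then show "(\<lambda>n. x + (d / real (n + 2)) *\<^sub>R (- m (\<pi> x))) \<longlonglongrightarrow> x" by simp
  qed
  moreover have "x \<notin> \<Omega>" using inside x by simp
  ultimately show "x \<in> frontier \<Omega>" using op by (auto simp: frontier_def interior_open)
qed

lemma lift_deriv: "(\<gamma> has_derivative (\<lambda>v. inv T (vector [v $ 1, v $ 2, Dh w v]))) (at w)"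
proof -
  have "((\<lambda>w. vector [w $ 1, w $ 2, h w] :: real^3) has_derivative (\<lambda>v. vector [v $ 1, v $ 2, Dh w v])) (at w)"
    unfolding vector_3_axis by (auto intro!: derivative_eq_intros h_deriv bounded_linear_imp_has_derivative[OF bounded_linear_vec_nth])
  from bounded_linear.has_derivative[OF lin_inv[unfolded linear_conv_bounded_linear] this]
  show ?thesis unfolding lift_def[abs_def] .
qed

lemma lift_smooth: "smooth_on \<gamma> UNIV"
proof (rule smooth_onI)
  fix k
  have "\<gamma> = (\<lambda>w. inv T (vector [w $ 1, w $ 2, 0]) + h w *\<^sub>R inv T (axis 3 1))"
  proof
    fix w
    have "vector [w $ 1, w $ 2, h w] = vector [w $ 1, w $ 2, 0] + h w *\<^sub>R (axis 3 1 :: real^3)"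
      by (simp add: vec_eq_iff forall_3 axis_def)
    then show "\<gamma> w = inv T (vector [w $ 1, w $ 2, 0]) + h w *\<^sub>R inv T (axis 3 1)"
      by (simp add: lift_def linear_add[OF lin_inv] linear_scale[OF lin_inv])
  qed
  moreover have L: "linear (\<lambda>w::real^2. inv T (vector [w $ 1, w $ 2, 0]))"
  proof (rule linear_compose[unfolded o_def, OF _ lin_inv])
    show "linear (\<lambda>w::real^2. vector [w $ 1, w $ 2, 0] :: real^3)"
      by (rule linearI) (auto simp: vec_eq_iff forall_3)
  qed
  ultimately show "Ck k \<gamma> UNIV"
    using Ck_add[OF open_UNIV Ck_linear[OF L[unfolded linear_conv_bounded_linear] open_UNIV]
        Ck_scaleR[OF open_UNIV smooth_on_Ck[OF h] Ck_const[OF open_UNIV]]] by simp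
qed

lemma m_lift: "m w \<bullet> inv T (vector [v $ 1, v $ 2, Dh w v]) = 0"
proof -
  have "\<pi> (inv T (vector [v $ 1, v $ 2, Dh w v])) = v" by (simp add: base_def vec_eq_iff forall_2)
  then show ?thesis by (simp add: m_inner)
qed

lemma area_lift_pos: "area_density \<gamma> w > 0"
proof -
  have c: "cross3 (inv T a) (inv T b) \<noteq> 0" if "a \<bullet> a * (b \<bullet> b) - (a \<bullet> b)\<^sup>2 > 0" for a b
  proof
    assume "cross3 (inv T a) (inv T b) = 0"
    then have "(norm (inv T a))\<^sup>2 * (norm (inv T b))\<^sup>2 - (inv T a \<bullet> inv T b)\<^sup>2 = 0"
      using norm_cross[of "inv T a" "inv T b"] by simp
    then show False using that by (simp add: power2_norm_eq_inner inner_inv)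
  qed
  have "cross3 (inv T (vector [1, 0, Dh w (axis 1 1)])) (inv T (vector [0, 1, Dh w (axis 2 1)])) \<noteq> 0"
    by (rule c) (simp add: inner_vec_def sum_3 power2_eq_square algebra_simps add_pos_nonneg)
  then show ?thesis by (simp add: area_density_eqI[OF lift_deriv] axis_def)
qed

definition "G = \<gamma> -` ball p r"

lemma G_open: "open G"
  unfolding G_def using smooth_on_continuous[OF lift_smooth] by (intro open_vimage open_ball) auto

lemma lift_image: "\<gamma> ` G = frontier \<Omega> \<inter> ball p r"
proof
  show "\<gamma> ` G \<subseteq> frontier \<Omega> \<inter> ball p r" using frontier_iff by (auto simp: G_def)
  show "frontier \<Omega> \<inter> ball p r \<subseteq> \<gamma> ` G"
  proof
    fix x assume "x \<in> frontier \<Omega> \<inter> ball p r"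
    then have "\<gamma> (\<pi> x) = x" "x \<in> ball p r" using frontier_iff lift_base by auto
    then show "x \<in> \<gamma> ` G" by (metis G_def image_eqI vimageI)
  qed
qed

lemma lift_homeo: "homeomorphism G (\<gamma> ` G) \<gamma> \<pi>"
proof (rule homeomorphismI)
  show "continuous_on G \<gamma>" using smooth_on_continuous[OF lift_smooth] continuous_on_subset by blast
  show "continuous_on (\<gamma> ` G) \<pi>" using base_bl linear_continuous_on by blast
qed auto

lemma lift_patch: "regular_patch (frontier \<Omega>) G \<gamma>"
  unfolding regular_patch_def
proof (intro conjI ballI)
  show "smooth_on \<gamma> G" using lift_smooth Ck_subset by (fastforce simp: smooth_on_def)
  show "openin (top_of_set (frontier \<Omega>)) (\<gamma> ` G)" unfolding lift_image by (simp add: openin_open_Int)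
  show "\<exists>\<psi>. homeomorphism G (\<gamma> ` G) \<gamma> \<psi>" using lift_homeo by blast
qed (use G_open area_lift_pos less_imp_neq[symmetric] in auto)

lemma G_bounded: "bounded G"
proof -
  have "G \<subseteq> \<pi> ` ball p r" using base_lift by (metis G_def image_eqI subsetI vimageE)
  then show ?thesis using bounded_linear_image[OF bounded_ball base_bl] bounded_subset by blast
qed

text \<open>
  Existence: curves in the surface keep \<open>F = 0\<close>, so their velocities are orthogonal to \<open>m\<close>, and moving along
  \<open>m\<close> leaves the closure. Uniqueness: the coordinate curves of the graph force a competitor to be a multiple
  \<open>s m\<close>, and \<open>s < 0\<close> would point into the domain.
\<close>

lemma normal_eq:
  assumes x: "x \<in> ball p r" "x \<in> frontier \<Omega>"
  shows "outward_unit_normal \<Omega> x = m (\<pi> x) /\<^sub>R norm (m (\<pi> x))"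
  unfolding outward_unit_normal_def
proof (rule the_equality)
  let ?w = "\<pi> x" let ?n = "m (\<pi> x) /\<^sub>R norm (m (\<pi> x))"
  have Fx: "F x = 0" using frontier_iff x by simp
  have gx: "\<gamma> ?w = x" using lift_base[OF Fx] .
  have tan: "?n \<bullet> v = 0" if v: "v \<in> tangent_space (frontier \<Omega>) x" for v
  proof -
    obtain c :: "real \<Rightarrow> real^3" and e where c: "e > 0" "c 0 = x" "\<And>t. t \<in> {-e<..<e} \<Longrightarrow> c t \<in> frontier \<Omega>"
      "(c has_vector_derivative v) (at 0)"
      using v unfolding tangent_space_def by blast
    have dc: "(c has_derivative (\<lambda>s. s *\<^sub>R v)) (at 0)" using c(4) by (simp add: has_vector_derivative_def)
    have "isCont c 0" using has_derivative_continuous[OF dc] .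
    then have "eventually (\<lambda>t. c t \<in> ball p r) (at 0)"
      using x c(2) by (metis isCont_def open_ball topological_tendstoD)
    then obtain d where d: "d > 0" "\<And>t. t \<noteq> 0 \<Longrightarrow> \<bar>t\<bar> < d \<Longrightarrow> c t \<in> ball p r"
      unfolding eventually_at by (auto simp: dist_real_def)
    have z: "F (c t) = 0" if "\<bar>t\<bar> < min d e" for t
    proof -
      have "\<bar>t\<bar> < d" "t \<in> {-e<..<e}" using that by (auto simp: abs_less_iff)
      then show ?thesis using frontier_iff[of "c t"] d(2)[of t] c(2) c(3)[of t] x by (cases "t = 0") auto
    qed
    have "((\<lambda>t. F (c t)) has_derivative (\<lambda>s. - (m ?w \<bullet> (s *\<^sub>R v)))) (at 0)"
      using has_derivative_compose[OF dc F_deriv[of "c 0"]] c(2) by simp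
    moreover have "((\<lambda>t. F (c t)) has_derivative (\<lambda>s. 0)) (at 0)"
    proof (rule has_derivative_transform_within_open[where f = "\<lambda>_. 0" and s = "ball 0 (min d e)"])
      show "0 \<in> ball 0 (min d e)" using d c by simp
    qed (use z in auto)
    ultimately have "(\<lambda>s. - (m ?w \<bullet> (s *\<^sub>R v))) = (\<lambda>s. 0)" by (rule has_derivative_unique)
    from fun_cong[OF this, of 1] show ?thesis by simp
  qed
  have "m ?w \<bullet> ?n > 0" by (simp add: divide_pos_pos)
  from exits[OF x(1) Fx this] tan
  show "norm ?n = 1 \<and> (\<forall>v\<in>tangent_space (frontier \<Omega>) x. ?n \<bullet> v = 0) \<and>
    (\<exists>\<epsilon>>0. \<forall>t\<in>{0<..<\<epsilon>}. x + t *\<^sub>R ?n \<notin> closure \<Omega>)" by auto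
  fix n assume n: "norm n = 1 \<and> (\<forall>v\<in>tangent_space (frontier \<Omega>) x. n \<bullet> v = 0) \<and>
    (\<exists>\<epsilon>>0. \<forall>t\<in>{0<..<\<epsilon>}. x + t *\<^sub>R n \<notin> closure \<Omega>)"
  have perp: "n \<bullet> inv T (vector [v $ 1, v $ 2, Dh ?w v]) = 0" for v
  proof -
    have "inv T (vector [v $ 1, v $ 2, Dh ?w v]) \<in> tangent_space (frontier \<Omega>) x"
    proof -
      let ?c = "\<lambda>t. \<gamma> (?w + t *\<^sub>R v)"
      have c0: "?c 0 = x" using gx by simp
      have dc: "((\<lambda>t. ?w + t *\<^sub>R v) has_derivative (\<lambda>s. s *\<^sub>R v)) (at 0)"
        by (auto intro!: derivative_eq_intros)
      have dcc: "(?c has_derivative (\<lambda>s. inv T (vector [(s *\<^sub>R v) $ 1, (s *\<^sub>R v) $ 2, Dh ?w (s *\<^sub>R v)]))) (at 0)"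
        using has_derivative_compose[OF dc lift_deriv[of "?w + 0 *\<^sub>R v"]] by simp
      have "inv T (vector [(s *\<^sub>R v) $ 1, (s *\<^sub>R v) $ 2, Dh ?w (s *\<^sub>R v)]) = s *\<^sub>R inv T (vector [v $ 1, v $ 2, Dh ?w v])" for s
        by (rule linear_scale[OF has_derivative_linear[OF lift_deriv]])
      with dcc have dv: "(?c has_vector_derivative inv T (vector [v $ 1, v $ 2, Dh ?w v])) (at 0)"
        by (simp add: has_vector_derivative_def)
      have "isCont ?c 0" by (rule has_derivative_continuous[OF dcc])
      then have "eventually (\<lambda>t. ?c t \<in> ball p r) (at 0)"
        using x gx topological_tendstoD[OF _ open_ball, of ?c "?c 0" "at 0" p r] by (simp add: isCont_def)
      then obtain d where d: "d > 0" "\<And>t. t \<noteq> 0 \<Longrightarrow> \<bar>t\<bar> < d \<Longrightarrow> ?c t \<in> ball p r"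
        unfolding eventually_at by (auto simp: dist_real_def)
      have "\<forall>t\<in>{-d<..<d}. ?c t \<in> frontier \<Omega>"
      proof
        fix t assume "t \<in> {-d<..<d}"
        then have "\<bar>t\<bar> < d" by (auto simp: abs_less_iff)
        then have "?c t \<in> ball p r" using d(2)[of t] x gx by (cases "t = 0") auto
        then show "?c t \<in> frontier \<Omega>" using frontier_iff by simp
      qed
      with d(1) c0 dv show ?thesis unfolding tangent_space_def
        by (intro CollectI exI[of _ ?c] exI[of _ d] conjI)
    qed
    then show ?thesis using n by blast
  qed
  (* In the coordinates T the vector m has third component -1, so this is the factor in n = s m. *)
  define s where "s = - (T n $ 3)"
  have i: "n \<bullet> inv T z = T n \<bullet> z" for z using Tinner[of n "inv T z"] by simp
  have "T n $ 1 = s * Dh ?w (axis 1 1)" "T n $ 2 = s * Dh ?w (axis 2 1)"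
    using perp[of "axis 1 1"] perp[of "axis 2 1"] unfolding i
    by (auto simp: s_def inner_vec_def sum_3 axis_def)
  then have "T n = s *\<^sub>R vector [Dh ?w (axis 1 1), Dh ?w (axis 2 1), -1]"
    by (simp add: vec_eq_iff forall_3 s_def)
  then have ns: "n = s *\<^sub>R m ?w"
    by (metis Tinv(2) downward_def lin_inv linear_scale)
  have "\<not> s < 0"
  proof
    assume "s < 0"
    then have "m ?w \<bullet> n < 0" by (simp add: ns mult_neg_pos)
    from enters[OF x(1) Fx this] obtain d where d: "d > 0" "\<And>t. t \<in> {0<..<d} \<Longrightarrow> x + t *\<^sub>R n \<in> \<Omega>" by blast
    obtain e where e: "e > 0" "\<And>t. t \<in> {0<..<e} \<Longrightarrow> x + t *\<^sub>R n \<notin> closure \<Omega>" using n by blast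
    have "min d e / 2 \<in> {0<..<d}" "min d e / 2 \<in> {0<..<e}" using d e by auto
    then show False using d(2) e(2) closure_subset by blast
  qed
  then have "s * norm (m ?w) = 1" using n ns by simp
  then have "s = 1 / norm (m ?w)" by (simp add: eq_divide_eq)
  then show "n = ?n" using ns by (simp add: inverse_eq_divide)
qed

lemma m_continuous: "continuous_on UNIV m"
proof -
  have "continuous_on UNIV (\<lambda>w. vector [Dh w (axis 1 1), Dh w (axis 2 1), -1] :: real^3)"
    unfolding vector_3_axis by (intro continuous_intros smooth_on_continuous smooth_on_partial h) auto
  then show ?thesis unfolding downward_def[abs_def]
    using linear_continuous_on_compose[OF _ lin_inv] by blast
qed

end

lemma chart_exists:
  assumes "bounded_smooth_domain \<Omega>" "p \<in> frontier \<Omega>"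
  shows "\<exists>r T h. r > 0 \<and> graph_chart \<Omega> p r T h"
  using assms unfolding bounded_smooth_domain_def smooth_boundary_def graph_chart_def by meson

lemma outward_unit_normal_norm:
  assumes "bounded_smooth_domain \<Omega>" "x \<in> frontier \<Omega>"
  shows "norm (outward_unit_normal \<Omega> x) = 1"
proof -
  obtain r T h where r: "r > 0" "graph_chart \<Omega> x r T h" using chart_exists[OF assms] by blast
  interpret graph_chart \<Omega> x r T h by (rule r(2))
  have "x \<in> ball x r" using r(1) by simp
  from normal_eq[OF this assms(2)] show ?thesis by simp
qed

lemma outward_unit_normal_continuous:
  assumes "bounded_smooth_domain \<Omega>"
  shows "continuous_on (frontier \<Omega>) (outward_unit_normal \<Omega>)"
proof (rule continuous_on_eq_continuous_within[THEN iffD2], rule ballI)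
  fix p assume p: "p \<in> frontier \<Omega>"
  obtain r T h where r: "r > 0" "graph_chart \<Omega> p r T h" using chart_exists[OF assms p] by blast
  interpret graph_chart \<Omega> p r T h by (rule r(2))
  have "continuous_on UNIV (\<lambda>x. m (\<pi> x))"
    by (rule continuous_on_compose2[OF m_continuous linear_continuous_on[OF base_bl]]) simp
  then have "continuous_on UNIV (\<lambda>x. m (\<pi> x) /\<^sub>R norm (m (\<pi> x)))"
    by (intro continuous_intros) simp_all
  then have "continuous (at p) (\<lambda>x. m (\<pi> x) /\<^sub>R norm (m (\<pi> x)))"
    by (simp add: continuous_on_eq_continuous_at)
  then have "continuous (at p within frontier \<Omega>) (\<lambda>x. m (\<pi> x) /\<^sub>R norm (m (\<pi> x)))"
    by (rule continuous_at_imp_continuous_at_within)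
  then show "continuous (at p within frontier \<Omega>) (outward_unit_normal \<Omega>)"
    by (rule continuous_transform_within[OF _ r(1) p]) (use normal_eq in \<open>auto simp: dist_commute\<close>)
qed

section \<open>Existence and uniqueness of the surface measure\<close>

lemma borel_vimage_open:
  assumes "open U" "continuous_on U \<phi>" "A \<in> sets borel"
  shows "U \<inter> \<phi> -` A \<in> sets borel"
proof -
  have "\<phi> \<in> borel_measurable (restrict_space borel U)"
    by (rule borel_measurable_continuous_on_restrict[OF assms(2)])
  from measurable_sets[OF this assms(3)] show ?thesis
    using assms(1) by (simp add: sets_restrict_space_iff space_restrict_space Int_commute)
qed

lemma set_nn_integral_eq_HK:
  assumes "set_integrable lebesgue B g" "\<And>u. u \<in> B \<Longrightarrow> 0 \<le> g u"
  shows "(\<integral>\<^sup>+u\<in>B. ennreal (g u) \<partial>lborel) = ennreal (integral B g)"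
proof -
  have "(\<integral>\<^sup>+u\<in>B. ennreal (g u) \<partial>lborel) = (\<integral>\<^sup>+u. ennreal (indicat_real B u *\<^sub>R g u) \<partial>lebesgue)"
    unfolding nn_integral_completion by (intro nn_integral_cong) (auto simp: indicator_def)
  also have "\<dots> = ennreal (LINT u|lebesgue. indicat_real B u *\<^sub>R g u)"
    using assms unfolding set_integrable_def
    by (intro nn_integral_eq_integral) (auto simp: indicator_def)
  also have "(LINT u|lebesgue. indicat_real B u *\<^sub>R g u) = integral B g"
    using set_lebesgue_integral_eq_integral(2)[OF assms(1)] by (simp add: set_lebesgue_integral_def)
  finally show ?thesis .
qed

text \<open>
  The integrals are compared as integrals of functions with values in \<open>real^1\<close>, the form of
  \<open>has_absolute_integral_change_of_variables\<close>; positivity turns them into nonnegative integrals.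
\<close>

lemma nn_change_of_variables:
  fixes \<tau> :: "real^2 \<Rightarrow> real^2" and f :: "real^2 \<Rightarrow> real"
  assumes B: "B \<in> sets borel" and der: "\<And>u. u \<in> B \<Longrightarrow> (\<tau> has_derivative E u) (at u)"
    and inj: "inj_on \<tau> B" and f: "set_integrable lebesgue (\<tau> ` B) f" and pos: "\<And>w. 0 \<le> f w"
  shows "(\<integral>\<^sup>+u\<in>B. ennreal (\<bar>det (matrix (E u))\<bar> * f (\<tau> u)) \<partial>lborel) = (\<integral>\<^sup>+w\<in>\<tau> ` B. ennreal (f w) \<partial>lborel)"
proof -
  let ?e = "axis 1 1 :: real^1"
  have bl: "bounded_linear (\<lambda>x. x *\<^sub>R ?e)" by (rule bounded_linear_scaleR_left)
  have fe: "(\<lambda>w. f w *\<^sub>R ?e) absolutely_integrable_on (\<tau> ` B)"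
    using absolutely_integrable_linear[OF f bl] by (simp add: o_def)
  let ?g = "\<lambda>u. \<bar>det (matrix (E u))\<bar> * f (\<tau> u)"
  have "(\<lambda>u. \<bar>det (matrix (E u))\<bar> *\<^sub>R (f (\<tau> u) *\<^sub>R ?e)) absolutely_integrable_on B \<and>
      integral B (\<lambda>u. \<bar>det (matrix (E u))\<bar> *\<^sub>R (f (\<tau> u) *\<^sub>R ?e)) = integral (\<tau> ` B) (\<lambda>w. f w *\<^sub>R ?e)"
    using has_absolute_integral_change_of_variables[of B \<tau> E "\<lambda>w. f w *\<^sub>R ?e" "integral (\<tau> ` B) (\<lambda>w. f w *\<^sub>R ?e)"]
      B der inj fe by (auto intro: has_derivative_at_withinI)
  then have ge: "(\<lambda>u. ?g u *\<^sub>R ?e) absolutely_integrable_on B"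
    and ie: "integral B (\<lambda>u. ?g u *\<^sub>R ?e) = integral (\<tau> ` B) (\<lambda>w. f w *\<^sub>R ?e)" by simp_all
  have g: "?g absolutely_integrable_on B"
    using absolutely_integrable_linear[OF ge bounded_linear_vec_nth[of 1]] by (simp add: o_def)
  have "integral B ?g *\<^sub>R ?e = integral (\<tau> ` B) f *\<^sub>R ?e"
    using integral_linear[OF set_lebesgue_integral_eq_integral(1)[OF g] bl]
      integral_linear[OF set_lebesgue_integral_eq_integral(1)[OF f] bl] ie by (simp add: o_def)
  then have "integral B ?g = integral (\<tau> ` B) f" by (auto simp: axis_def vec_eq_iff)
  then show ?thesis
    using set_nn_integral_eq_HK[OF g] set_nn_integral_eq_HK[OF f] pos by simp
qed

lemma area_density_nonneg[simp]: "0 \<le> area_density \<phi> u" by (simp add: area_density_def)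

lemma regular_patchD:
  assumes "regular_patch S U \<phi>"
  shows "open U" "smooth_on \<phi> U" "continuous_on U \<phi>" "inj_on \<phi> U" "\<phi> ` U \<subseteq> S"
    "openin (top_of_set S) (\<phi> ` U)" "continuous_on U (area_density \<phi>)"
proof -
  show "open U" and sm: "smooth_on \<phi> U" and o: "openin (top_of_set S) (\<phi> ` U)"
    using assms by (auto simp: regular_patch_def)
  show "continuous_on U \<phi>" using smooth_on_continuous[OF sm] .
  show "inj_on \<phi> U" using assms unfolding regular_patch_def homeomorphism_def inj_on_def by metis
  show "\<phi> ` U \<subseteq> S" using openin_imp_subset[OF o] .
  show "continuous_on U (area_density \<phi>)" by (rule area_density_continuous[OF sm])
qed

context graph_chart begin

lemma area_integrable:
  assumes "C \<in> sets borel" "C \<subseteq> G"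
  shows "set_integrable lborel C (area_density \<gamma>)"
proof -
  have "set_integrable lborel (closure G) (area_density \<gamma>)"
    unfolding set_integrable_def
    using G_bounded area_density_continuous[OF lift_smooth]
    by (intro borel_integrable_compact) (auto intro: continuous_on_subset)
  then show ?thesis using assms closure_subset
    by (auto intro!: set_integrable_subset[of lborel "closure G"])
qed

text \<open>
  On \<open>A\<close> the patch factors as \<open>\<gamma> \<circ> \<tau>\<close> with \<open>\<tau> = \<pi> \<circ> \<phi>\<close>. The map \<open>\<tau>\<close> is differentiable as a linear image of
  \<open>\<phi>\<close> and injective because \<open>\<phi>\<close> is, and the area densities differ by its Jacobian.
\<close>

lemma patch_compare:
  assumes P: "regular_patch (frontier \<Omega>) U \<phi>" and A: "A \<in> sets borel" "A \<subseteq> \<phi> ` U" "A \<subseteq> ball p r"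
  shows "(\<integral>\<^sup>+u\<in>U \<inter> \<phi> -` A. ennreal (area_density \<phi> u) \<partial>lborel) =
    (\<integral>\<^sup>+w\<in>G \<inter> \<gamma> -` A. ennreal (area_density \<gamma> w) \<partial>lborel)"
proof -
  note U = regular_patchD[OF P]
  define B where "B = U \<inter> \<phi> -` A"
  let ?\<tau> = "\<lambda>u. \<pi> (\<phi> u)"
  have bB: "B \<in> sets borel" unfolding B_def by (rule borel_vimage_open[OF U(1,3) A(1)])
  have bC: "G \<inter> \<gamma> -` A \<in> sets borel"
    using borel_vimage_open[OF G_open _ A(1), of \<gamma>] lift_homeo by (simp add: homeomorphism_def)
  have ret: "\<gamma> (?\<tau> u) = \<phi> u" if "u \<in> U" "\<phi> u \<in> ball p r" for u
    using frontier_iff[of "\<phi> u"] lift_base U(5) that by auto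
  have img: "?\<tau> ` B = G \<inter> \<gamma> -` A"
  proof
    show "?\<tau> ` B \<subseteq> G \<inter> \<gamma> -` A"
    proof
      fix w assume "w \<in> ?\<tau> ` B"
      then obtain u where u: "u \<in> U" "\<phi> u \<in> A" "w = ?\<tau> u" by (auto simp: B_def)
      then have "\<gamma> w = \<phi> u" using ret A(3) by auto
      then show "w \<in> G \<inter> \<gamma> -` A" using u A(3) by (auto simp: G_def)
    qed
    show "G \<inter> \<gamma> -` A \<subseteq> ?\<tau> ` B"
    proof
      fix w assume w: "w \<in> G \<inter> \<gamma> -` A"
      then obtain u where u: "u \<in> U" "\<gamma> w = \<phi> u" using A(2) by auto
      then have "w = ?\<tau> u" using base_lift[of w] by simp
      then show "w \<in> ?\<tau> ` B" using u w by (auto simp: B_def)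
    qed
  qed
  have dphi: "(\<phi> has_derivative frechet_derivative \<phi> (at u)) (at u)" if "u \<in> B" for u
    using smooth_on_has_derivative[OF U(2)] that by (auto simp: B_def)
  define E where "E u v = \<pi> (frechet_derivative \<phi> (at u) v)" for u v
  have dtau: "(?\<tau> has_derivative E u) (at u)" if "u \<in> B" for u
    unfolding E_def[abs_def] by (rule bounded_linear.has_derivative[OF base_bl dphi[OF that]])
  have inj: "inj_on ?\<tau> B"
  proof (rule inj_onI)
    fix u v assume uv: "u \<in> B" "v \<in> B" "?\<tau> u = ?\<tau> v"
    then have "\<phi> u = \<phi> v" using ret[of u] ret[of v] subsetD[OF A(3)] by (metis B_def IntE vimageE)
    then show "u = v" using uv U(4) by (auto simp: B_def inj_on_def)
  qed
  have area: "area_density \<phi> u = \<bar>det (matrix (E u))\<bar> * area_density \<gamma> (?\<tau> u)" if u: "u \<in> B" for u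
  proof -
    have op: "open (U \<inter> \<phi> -` ball p r)" by (rule continuous_open_preimage[OF U(3,1) open_ball])
    have uo: "u \<in> U \<inter> \<phi> -` ball p r" using u A(3) by (auto simp: B_def)
    have "((\<lambda>u. \<gamma> (?\<tau> u)) has_derivative frechet_derivative \<phi> (at u)) (at u)"
      by (rule has_derivative_transform_within_open[OF dphi[OF u] op uo]) (use ret in auto)
    from area_density_eqI[OF this] have "area_density (\<lambda>u. \<gamma> (?\<tau> u)) u = area_density \<phi> u"
      by (simp add: area_density_def)
    then show ?thesis using area_density_chain[OF lift_deriv dtau[OF u]] by simp
  qed
  have int: "set_integrable lebesgue (?\<tau> ` B) (area_density \<gamma>)"
  proof -
    have "set_integrable lborel (G \<inter> \<gamma> -` A) (area_density \<gamma>)" using area_integrable[OF bC] by simp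
    then show ?thesis unfolding img set_integrable_def
      by (subst integrable_completion) auto
  qed
  have "(\<integral>\<^sup>+u\<in>B. ennreal (area_density \<phi> u) \<partial>lborel) =
      (\<integral>\<^sup>+u\<in>B. ennreal (\<bar>det (matrix (E u))\<bar> * area_density \<gamma> (?\<tau> u)) \<partial>lborel)"
    by (intro nn_integral_cong) (auto simp: indicator_def area)
  also have "\<dots> = (\<integral>\<^sup>+w\<in>?\<tau> ` B. ennreal (area_density \<gamma> w) \<partial>lborel)"
    by (rule nn_change_of_variables[OF bB dtau inj int]) simp_all
  finally show ?thesis unfolding img by (simp only: B_def)
qed

lemma chart_measure_finite:
  assumes "A \<in> sets borel"
  shows "(\<integral>\<^sup>+w\<in>G \<inter> \<gamma> -` A. ennreal (area_density \<gamma> w) \<partial>lborel) < \<infinity>"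
proof -
  have bC: "G \<inter> \<gamma> -` A \<in> sets borel"
    using borel_vimage_open[OF G_open _ assms, of \<gamma>] lift_homeo by (simp add: homeomorphism_def)
  have "set_integrable lebesgue (G \<inter> \<gamma> -` A) (area_density \<gamma>)"
    using area_integrable[OF bC] unfolding set_integrable_def by (subst integrable_completion) auto
  then show ?thesis by (subst set_nn_integral_eq_HK) auto
qed

end

text \<open>
  The predicate inside the description that defines \<open>surface_measure\<close>.
\<close>

definition is_surface_measure :: "(real^3) set \<Rightarrow> (real^3) measure \<Rightarrow> bool" where
  "is_surface_measure S M \<longleftrightarrow> sets M = sets (restrict_space borel S) \<and>
        (\<forall>U \<phi>. regular_patch S U \<phi> \<longrightarrow>
           (\<forall>A\<in>sets M. A \<subseteq> \<phi> ` U \<longrightarrow>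
              emeasure M A = (\<integral>\<^sup>+u\<in>U \<inter> \<phi> -` A. ennreal (area_density \<phi> u) \<partial>lborel)))"

text \<open>
  Finitely many charts cover the compact boundary. Making the balls disjoint (the sets \<open>D i\<close>) turns the sum of
  the chart measures into the surface measure.
\<close>

locale chart_cover =
  fixes \<Omega> :: "(real^3) set" and n :: nat and p :: "nat \<Rightarrow> real^3" and r :: "nat \<Rightarrow> real"
    and T :: "nat \<Rightarrow> real^3 \<Rightarrow> real^3" and h :: "nat \<Rightarrow> real^2 \<Rightarrow> real"
  assumes charts: "\<And>i. i < n \<Longrightarrow> graph_chart \<Omega> (p i) (r i) (T i) (h i)"
    and cover: "frontier \<Omega> \<subseteq> (\<Union>i<n. ball (p i) (r i))"
begin

abbreviation "S \<equiv> frontier \<Omega>"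
definition "D i = disjointed (\<lambda>i. ball (p i) (r i)) i"
definition "\<Gamma> i = lift (T i) (h i)"
definition "V i = \<Gamma> i -` ball (p i) (r i)"
definition "\<mu> i A = (\<integral>\<^sup>+w\<in>V i \<inter> \<Gamma> i -` (A \<inter> D i). ennreal (area_density (\<Gamma> i) w) \<partial>lborel)"

lemma V_eq: "i < n \<Longrightarrow> V i = graph_chart.G (p i) (r i) (T i) (h i)"
  using graph_chart.G_def[OF charts] by (simp add: V_def \<Gamma>_def)

lemma D_sets[measurable]: "D i \<in> sets borel"
proof -
  have "disjointed (\<lambda>i. ball (p i) (r i)) i \<in> sets borel"
    using sets.range_disjointed_sets[of "\<lambda>i. ball (p i) (r i)" borel]
    by (meson borel_open image_subset_iff open_ball rangeI subset_eq)
  then show ?thesis by (simp add: D_def)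
qed

lemma D_sub: "D i \<subseteq> ball (p i) (r i)" unfolding D_def by (rule disjointed_subset)

lemma D_disj: "disjoint_family D"
  using disjoint_family_disjointed[of "\<lambda>i. ball (p i) (r i)"] by (simp add: D_def[abs_def])

lemma D_cover: "S \<subseteq> (\<Union>i<n. D i)"
proof -
  have "(\<Union>i<n. D i) = (\<Union>i<n. ball (p i) (r i))"
    using finite_UN_disjointed_eq[of "\<lambda>i. ball (p i) (r i)" n] by (simp add: D_def lessThan_atLeast0)
  then show ?thesis using cover by simp
qed

lemma S_sets[measurable]: "S \<in> sets borel" by (simp add: frontier_closed borel_closed)

lemma sets_S: "A \<in> sets (restrict_space borel S) \<longleftrightarrow> A \<in> sets borel \<and> A \<subseteq> S"
  using S_sets by (auto simp: sets_restrict_space_iff)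

lemma \<mu>_emeasure:
  assumes "i < n" "A \<in> sets borel"
  shows "\<mu> i A = emeasure (distr (density lborel (\<lambda>w. ennreal (area_density (\<Gamma> i) w) * indicator (V i \<inter> \<Gamma> i -` D i) w)) borel (\<Gamma> i)) A"
proof -
  interpret graph_chart \<Omega> "p i" "r i" "T i" "h i" by (rule charts[OF assms(1)])
  have c: "continuous_on UNIV (\<Gamma> i)" unfolding \<Gamma>_def by (rule smooth_on_continuous[OF lift_smooth])
  then have [measurable]: "\<Gamma> i \<in> borel_measurable borel" by (rule borel_measurable_continuous_onI)
  have [measurable]: "area_density (\<Gamma> i) \<in> borel_measurable borel"
    unfolding \<Gamma>_def by (intro borel_measurable_continuous_onI area_density_continuous lift_smooth)
  have "open (V i)" unfolding V_def using c by (intro open_vimage open_ball)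
  then have [measurable]: "V i \<in> sets borel" by simp
  have [measurable]: "A \<in> sets borel" by fact
  have [measurable]: "\<Gamma> i -` D i \<in> sets borel" "\<Gamma> i -` A \<in> sets borel"
    using measurable_sets[of "\<Gamma> i" borel borel] by auto
  have "emeasure (distr (density lborel (\<lambda>w. ennreal (area_density (\<Gamma> i) w) * indicator (V i \<inter> \<Gamma> i -` D i) w)) borel (\<Gamma> i)) A
     = (\<integral>\<^sup>+w. ennreal (area_density (\<Gamma> i) w) * indicator (V i \<inter> \<Gamma> i -` D i) w * indicator (\<Gamma> i -` A) w \<partial>lborel)"
    by (subst emeasure_distr) (simp_all add: emeasure_density)
  also have "\<dots> = \<mu> i A"
    unfolding \<mu>_def by (intro nn_integral_cong) (auto simp: indicator_def)
  finally show ?thesis by simp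
qed

lemma \<mu>_additive:
  assumes "i < n" "range A \<subseteq> sets borel" "disjoint_family A"
  shows "(\<Sum>j. \<mu> i (A j)) = \<mu> i (\<Union>j. A j)"
proof -
  have A: "A j \<in> sets borel" for j using assms(2) by auto
  then have U: "(\<Union>j. A j) \<in> sets borel" by auto
  show ?thesis
    unfolding \<mu>_emeasure[OF assms(1) A] \<mu>_emeasure[OF assms(1) U]
    using assms(2,3) by (intro suminf_emeasure) auto
qed

definition "M = measure_of S (sets (restrict_space borel S)) (\<lambda>A. \<Sum>i<n. \<mu> i A)"

lemma sets_M: "sets M = sets (restrict_space borel S)"
proof -
  have "sets (restrict_space borel S) \<subseteq> Pow S" using sets_S by auto
  moreover have "sigma_algebra S (sets (restrict_space borel S))"
    using sets.sigma_algebra_axioms[of "restrict_space borel S"] by (simp add: space_restrict_space)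
  ultimately show ?thesis unfolding M_def
    by (simp add: sigma_algebra.sigma_sets_eq)
qed

lemma emeasure_M: "A \<in> sets borel \<Longrightarrow> A \<subseteq> S \<Longrightarrow> emeasure M A = (\<Sum>i<n. \<mu> i A)"
proof -
  assume A: "A \<in> sets borel" "A \<subseteq> S"
  show ?thesis
  proof (rule emeasure_measure_of[OF M_def])
    show "sets (restrict_space borel S) \<subseteq> Pow S" using sets_S by auto
    show "positive (sets M) (\<lambda>A. \<Sum>i<n. \<mu> i A)" by (auto simp: positive_def \<mu>_def)
    show "countably_additive (sets M) (\<lambda>A. \<Sum>i<n. \<mu> i A)"
    proof (rule countably_additiveI)
      fix A :: "nat \<Rightarrow> (real^3) set"
      assume "range A \<subseteq> sets M" "disjoint_family A"
      then have "range A \<subseteq> sets borel" unfolding sets_M using sets_S by blast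
      then show "(\<Sum>j. \<Sum>i<n. \<mu> i (A j)) = (\<Sum>i<n. \<mu> i (\<Union> (range A)))"
        using \<mu>_additive \<open>disjoint_family A\<close> by (subst suminf_sum) (auto intro!: sum.cong)
    qed
    show "A \<in> sets M" unfolding sets_M using A sets_S by blast
  qed
qed

lemma split_D:
  assumes "A \<subseteq> S"
  shows "A = (\<Union>i<n. A \<inter> D i)" using assms D_cover by blast

text \<open>
  On each piece \<open>A \<inter> D i\<close> the patch is compared with the graph chart; the pieces are then added up inside the
  patch.
\<close>

lemma is_surface_measure_M: "is_surface_measure S M"
  unfolding is_surface_measure_def
proof (intro conjI allI impI ballI)
  show "sets M = sets (restrict_space borel S)" by (rule sets_M)
  fix U \<phi> A assume P: "regular_patch S U \<phi>" and "A \<in> sets M" and AU: "A \<subseteq> \<phi> ` U"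
  then have A: "A \<in> sets borel" "A \<subseteq> S" using sets_S unfolding sets_M by auto
  note U = regular_patchD[OF P]
  have i: "\<mu> i A = (\<integral>\<^sup>+u\<in>U \<inter> \<phi> -` (A \<inter> D i). ennreal (area_density \<phi> u) \<partial>lborel)" if "i < n" for i
  proof -
    interpret graph_chart \<Omega> "p i" "r i" "T i" "h i" by (rule charts[OF that])
    show ?thesis unfolding \<mu>_def V_eq[OF that] unfolding \<Gamma>_def
    proof (rule patch_compare[OF P, symmetric])
      show "A \<inter> D i \<in> sets borel" using A D_sets by auto
      show "A \<inter> D i \<subseteq> \<phi> ` U" using AU by blast
      show "A \<inter> D i \<subseteq> ball (p i) (r i)" using D_sub[of i] by blast
    qed
  qed
  have m: "(\<lambda>u. ennreal (area_density \<phi> u) * indicator (U \<inter> \<phi> -` (A \<inter> D i)) u) \<in> borel_measurable lborel" for i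
  proof -
    have "(\<lambda>u. indicator U u *\<^sub>R area_density \<phi> u) \<in> borel_measurable borel"
      using U(1,7) by (intro borel_measurable_continuous_on_indicator) auto
    moreover have [measurable]: "U \<inter> \<phi> -` (A \<inter> D i) \<in> sets borel" using A D_sets by (intro borel_vimage_open[OF U(1,3)]) auto
    ultimately have "(\<lambda>u. ennreal (indicator U u *\<^sub>R area_density \<phi> u) * indicator (U \<inter> \<phi> -` (A \<inter> D i)) u) \<in> borel_measurable lborel"
      by simp
    also have "(\<lambda>u. ennreal (indicator U u *\<^sub>R area_density \<phi> u) * indicator (U \<inter> \<phi> -` (A \<inter> D i)) u) =
       (\<lambda>u. ennreal (area_density \<phi> u) * indicator (U \<inter> \<phi> -` (A \<inter> D i)) u)" by (auto simp: indicator_def)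
    finally show ?thesis .
  qed
  have "emeasure M A = (\<Sum>i<n. \<integral>\<^sup>+u\<in>U \<inter> \<phi> -` (A \<inter> D i). ennreal (area_density \<phi> u) \<partial>lborel)"
    unfolding emeasure_M[OF A] by (intro sum.cong) (auto simp: i)
  also have "\<dots> = (\<integral>\<^sup>+u. (\<Sum>i<n. ennreal (area_density \<phi> u) * indicator (U \<inter> \<phi> -` (A \<inter> D i)) u) \<partial>lborel)"
    by (rule nn_integral_sum[symmetric]) (rule m)
  also have "\<dots> = (\<integral>\<^sup>+u\<in>U \<inter> \<phi> -` A. ennreal (area_density \<phi> u) \<partial>lborel)"
  proof (intro nn_integral_cong)
    fix u
    have "(\<Sum>i<n. indicator (U \<inter> \<phi> -` (A \<inter> D i)) u :: ennreal) = indicator (\<Union>i<n. U \<inter> \<phi> -` (A \<inter> D i)) u"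
      using D_disj by (intro indicator_UN_disjoint[symmetric]) (auto simp: disjoint_family_on_def)
    also have "(\<Union>i<n. U \<inter> \<phi> -` (A \<inter> D i)) = U \<inter> \<phi> -` A" using A(2) D_cover by blast
    finally show "(\<Sum>i<n. ennreal (area_density \<phi> u) * indicator (U \<inter> \<phi> -` (A \<inter> D i)) u) =
      ennreal (area_density \<phi> u) * indicator (U \<inter> \<phi> -` A) u"
      by (simp flip: sum_distrib_left)
  qed
  finally show "emeasure M A = (\<integral>\<^sup>+u\<in>U \<inter> \<phi> -` A. ennreal (area_density \<phi> u) \<partial>lborel)" .
qed

text \<open>
  A competitor is determined on each piece \<open>A \<inter> D i\<close>, since the graph charts are themselves regular patches.
\<close>

lemma emeasure_unique:
  assumes "is_surface_measure S N" "A \<in> sets borel" "A \<subseteq> S"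
  shows "emeasure N A = (\<Sum>i<n. \<mu> i A)"
proof -
  have sN: "sets N = sets (restrict_space borel S)" using assms by (simp add: is_surface_measure_def)
  have AD: "A \<inter> D i \<in> sets N" for i unfolding sN using sets_S assms D_sets by auto
  have "emeasure N A = emeasure N (\<Union>i<n. A \<inter> D i)" using split_D[OF assms(3)] by simp
  also have "\<dots> = (\<Sum>i<n. emeasure N (A \<inter> D i))"
    using AD D_disj by (intro sum_emeasure[symmetric]) (auto simp: disjoint_family_on_def)
  also have "\<dots> = (\<Sum>i<n. \<mu> i A)"
  proof (intro sum.cong refl)
    fix i assume "i \<in> {..<n}"
    then have i: "i < n" by simp
    interpret graph_chart \<Omega> "p i" "r i" "T i" "h i" by (rule charts[OF i])
    have "A \<inter> D i \<subseteq> S \<inter> ball (p i) (r i)" using assms(3) D_sub[of i] by blast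
    then show "emeasure N (A \<inter> D i) = \<mu> i A"
      using assms(1)[unfolded is_surface_measure_def, THEN conjunct2, rule_format, OF lift_patch AD]
      unfolding \<mu>_def V_eq[OF i] unfolding \<Gamma>_def lift_image by simp
  qed
  finally show ?thesis .
qed

lemma surface_measure_is: "is_surface_measure S (surface_measure S)"
proof -
  have "surface_measure S = (THE M. is_surface_measure S M)"
    unfolding surface_measure_def is_surface_measure_def ..
  moreover have "(THE M. is_surface_measure S M) = M"
  proof (rule the_equality)
    show "is_surface_measure S M" by (rule is_surface_measure_M)
    fix N assume N: "is_surface_measure S N"
    show "N = M"
    proof (rule measure_eqI)
      show "sets N = sets M" using N by (simp add: is_surface_measure_def sets_M)
      fix A assume "A \<in> sets N"
      then have "A \<in> sets borel" "A \<subseteq> S" using N sets_S by (auto simp: is_surface_measure_def)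
      then show "emeasure N A = emeasure M A" using emeasure_unique[OF N] emeasure_M by simp
    qed
  qed
  ultimately show ?thesis using is_surface_measure_M by simp
qed

lemma surface_measure_finite: "finite_measure (surface_measure S)"
proof (rule finite_measureI)
  have sp: "space (surface_measure S) = S"
    using surface_measure_is sets_eq_imp_space_eq[of "surface_measure S" "restrict_space borel S"]
    by (simp add: is_surface_measure_def space_restrict_space)
  have "emeasure (surface_measure S) S = (\<Sum>i<n. \<mu> i S)"
    using emeasure_unique[OF surface_measure_is] by simp
  also have "\<dots> < \<infinity>"
  proof -
    have "\<mu> i S < \<infinity>" if "i < n" for i
    proof -
      interpret graph_chart \<Omega> "p i" "r i" "T i" "h i" by (rule charts[OF that])
      have "S \<inter> D i \<in> sets borel" by measurable
      then show ?thesis using chart_measure_finite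
        unfolding \<mu>_def V_eq[OF that] unfolding \<Gamma>_def by blast
    qed
    then show ?thesis by (simp add: less_top)
  qed
  finally show "emeasure (surface_measure S) (space (surface_measure S)) \<noteq> \<infinity>" using sp by simp
qed

end

lemma chart_cover_exists:
  assumes "bounded_smooth_domain \<Omega>"
  shows "\<exists>n p r T h. chart_cover \<Omega> n p r T h"
proof -
  have "\<forall>p\<in>frontier \<Omega>. \<exists>x. fst x > 0 \<and> graph_chart \<Omega> p (fst x) (fst (snd x)) (snd (snd x))"
  proof
    fix p assume "p \<in> frontier \<Omega>"
    from chart_exists[OF assms this] obtain r T h where "r > 0 \<and> graph_chart \<Omega> p r T h" by blast
    then show "\<exists>x. fst x > 0 \<and> graph_chart \<Omega> p (fst x) (fst (snd x)) (snd (snd x))"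
      by (intro exI[of _ "(r, T, h)"]) simp
  qed
  from bchoice[OF this] obtain X where
    X: "\<forall>p\<in>frontier \<Omega>. fst (X p) > 0 \<and> graph_chart \<Omega> p (fst (X p)) (fst (snd (X p))) (snd (snd (X p)))" ..
  define r T h where "r p = fst (X p)" and "T p = fst (snd (X p))" and "h p = snd (snd (X p))" for p
  have ch: "\<And>p. p \<in> frontier \<Omega> \<Longrightarrow> r p > 0 \<and> graph_chart \<Omega> p (r p) (T p) (h p)"
    using X by (simp add: r_def T_def h_def)
  have "compact (frontier \<Omega>)"
    using assms by (intro compact_frontier_bounded) (simp add: bounded_smooth_domain_def)
  moreover have "frontier \<Omega> \<subseteq> (\<Union>p\<in>frontier \<Omega>. ball p (r p))"
    using ch by (auto intro: centre_in_ball[THEN iffD2])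
  ultimately obtain C where C: "C \<subseteq> frontier \<Omega>" "finite C" "frontier \<Omega> \<subseteq> (\<Union>p\<in>C. ball p (r p))"
    using compactE_image[of "frontier \<Omega>" "frontier \<Omega>" "\<lambda>p. ball p (r p)"] by blast
  obtain q where q: "bij_betw q {0..<card C} C" using ex_bij_betw_nat_finite[OF C(2)] by blast
  have "chart_cover \<Omega> (card C) q (\<lambda>i. r (q i)) (\<lambda>i. T (q i)) (\<lambda>i. h (q i))"
  proof (rule chart_cover.intro)
    show "graph_chart \<Omega> (q i) (r (q i)) (T (q i)) (h (q i))" if "i < card C" for i
    proof -
      have "q i \<in> C" using bij_betwE[OF q] that by simp
      then show ?thesis using ch C(1) by blast
    qed
    have "C = q ` {..<card C}" using bij_betw_imp_surj_on[OF q] by (simp add: atLeast0LessThan)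
    then have "(\<Union>p\<in>C. ball p (r p)) = (\<Union>p\<in>q ` {..<card C}. ball p (r p))" by simp
    also have "\<dots> = (\<Union>i<card C. ball (q i) (r (q i)))" by (rule SUP_image[unfolded o_def])
    finally have "(\<Union>p\<in>C. ball p (r p)) = (\<Union>i<card C. ball (q i) (r (q i)))" .
    then show "frontier \<Omega> \<subseteq> (\<Union>i<card C. ball (q i) (r (q i)))" using C(3) by simp
  qed
  then show ?thesis by blast
qed

text \<open>
  The restriction of the surface measure to the image is the push-forward of the area element; both measures
  agree on all measurable sets by the defining property.
\<close>

lemma patch_integral:
  fixes K :: "real^3 \<Rightarrow> real"
  assumes M: "is_surface_measure S M" and S: "S \<in> sets borel" and P: "regular_patch S U \<phi>"
    and B: "compact B" "B \<subseteq> U" and K: "K \<in> borel_measurable M"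
  shows "(\<integral>x. indicator (\<phi> ` B) x * K x \<partial>M) = (\<integral>u. area_density \<phi> u * K (\<phi> u) * indicator B u \<partial>lborel)"
proof -
  note U = regular_patchD[OF P]
  have sM: "sets M = sets (restrict_space borel S)" using M by (simp add: is_surface_measure_def)
  have inM: "A \<in> sets M \<longleftrightarrow> A \<in> sets borel \<and> A \<subseteq> S" for A
    using S by (auto simp: sM sets_restrict_space_iff)
  have bB: "B \<in> sets borel" using B(1) by (simp add: compact_imp_closed borel_closed)
  let ?L = "restrict_space lborel B"
  have "compact (\<phi> ` B)" using B by (intro compact_continuous_image continuous_on_subset[OF U(3)])
  then have \<phi>B: "\<phi> ` B \<in> sets M" using U(5) B(2) by (auto simp: inM compact_imp_closed borel_closed)
  have \<phi>m: "\<phi> \<in> measurable ?L M"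
  proof -
    have "\<phi> \<in> measurable (restrict_space borel B) (restrict_space borel S)"
      using U(5) B(2)
      by (intro measurable_restrict_space2 borel_measurable_continuous_on_restrict continuous_on_subset[OF U(3)])
        (auto simp: space_restrict_space)
    then show ?thesis by (simp add: sM cong: measurable_cong_sets sets_restrict_space_cong)
  qed
  have am: "area_density \<phi> \<in> borel_measurable ?L"
  proof -
    have "area_density \<phi> \<in> borel_measurable (restrict_space borel B)"
      by (intro borel_measurable_continuous_on_restrict continuous_on_subset[OF U(7)] B(2))
    then show ?thesis by (simp cong: measurable_cong_sets sets_restrict_space_cong)
  qed
  have eq: "distr (density ?L (\<lambda>u. ennreal (area_density \<phi> u))) M \<phi> = density M (indicator (\<phi> ` B))"
  proof (rule measure_eqI)
    fix A assume "A \<in> sets (distr (density ?L (\<lambda>u. ennreal (area_density \<phi> u))) M \<phi>)"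
    then have A: "A \<in> sets M" by simp
    have 1: "U \<inter> \<phi> -` (A \<inter> \<phi> ` B) = B \<inter> \<phi> -` A"
      using U(4) B(2) by (auto simp: inj_on_def)
    have Am: "\<phi> -` A \<inter> space ?L \<in> sets ?L" by (rule measurable_sets[OF \<phi>m A])
    have "emeasure (distr (density ?L (\<lambda>u. ennreal (area_density \<phi> u))) M \<phi>) A
      = (\<integral>\<^sup>+u. ennreal (area_density \<phi> u) * indicator (\<phi> -` A \<inter> space ?L) u \<partial>?L)"
      using \<phi>m am A Am by (subst emeasure_distr) (simp_all add: emeasure_density)
    also have "\<dots> = (\<integral>\<^sup>+u. ennreal (area_density \<phi> u) * indicator (\<phi> -` A \<inter> space ?L) u * indicator B u \<partial>lborel)"
      using bB by (subst nn_integral_restrict_space) simp_all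
    also have "\<dots> = (\<integral>\<^sup>+u\<in>U \<inter> \<phi> -` (A \<inter> \<phi> ` B). ennreal (area_density \<phi> u) \<partial>lborel)"
      unfolding 1 by (intro nn_integral_cong) (auto simp: indicator_def space_restrict_space)
    also have "\<dots> = emeasure M (A \<inter> \<phi> ` B)"
    proof -
      have "A \<inter> \<phi> ` B \<in> sets M" using A \<phi>B by auto
      moreover have "A \<inter> \<phi> ` B \<subseteq> \<phi> ` U" using B(2) by auto
      ultimately show ?thesis
        using M[unfolded is_surface_measure_def, THEN conjunct2, rule_format, OF P] by simp
    qed
    also have "\<dots> = emeasure (density M (indicator (\<phi> ` B))) A"
      using A \<phi>B by (subst emeasure_density) (simp_all add: Int_commute flip: indicator_inter_arith)
    finally show "emeasure (distr (density ?L (\<lambda>u. ennreal (area_density \<phi> u))) M \<phi>) A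
       = emeasure (density M (indicator (\<phi> ` B))) A" .
  qed simp
  have Km: "(\<lambda>u. K (\<phi> u)) \<in> borel_measurable ?L" by (rule measurable_compose[OF \<phi>m K])
  have "(\<integral>x. indicator (\<phi> ` B) x * K x \<partial>M) = (\<integral>x. indicat_real (\<phi> ` B) x *\<^sub>R K x \<partial>M)" by simp
  also have "\<dots> = integral\<^sup>L (density M (\<lambda>x. ennreal (indicat_real (\<phi> ` B) x))) K"
    using K \<phi>B by (intro integral_density[symmetric]) auto
  also have "(\<lambda>x. ennreal (indicat_real (\<phi> ` B) x)) = indicator (\<phi> ` B)" by (auto simp: indicator_def)
  also have "integral\<^sup>L (density M (indicator (\<phi> ` B))) K = integral\<^sup>L (distr (density ?L (\<lambda>u. ennreal (area_density \<phi> u))) M \<phi>) K"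
    by (simp add: eq)
  also have "\<dots> = (\<integral>u. K (\<phi> u) \<partial>density ?L (\<lambda>u. ennreal (area_density \<phi> u)))"
    using \<phi>m K by (intro integral_distr) auto
  also have "\<dots> = (\<integral>u. area_density \<phi> u *\<^sub>R K (\<phi> u) \<partial>?L)"
    using Km am by (intro integral_density) auto
  also have "\<dots> = (\<integral>u. indicator B u *\<^sub>R (area_density \<phi> u *\<^sub>R K (\<phi> u)) \<partial>lborel)"
    using bB by (intro integral_restrict_space) simp
  also have "\<dots> = (\<integral>u. area_density \<phi> u * K (\<phi> u) * indicator B u \<partial>lborel)"
    by (intro Bochner_Integration.integral_cong) auto
  finally show ?thesis .
qed

lemma smooth_on_surface_continuous:
  assumes "smooth_on_surface f S" shows "continuous_on S f"
proof (rule continuous_on_eq_continuous_within[THEN iffD2], rule ballI)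
  fix p assume p: "p \<in> S"
  then obtain W F where W: "open W" "p \<in> W" "smooth_on F W" "\<forall>x\<in>W \<inter> S. F x = f x"
    using assms unfolding smooth_on_surface_def by blast
  then obtain d where d: "d > 0" "ball p d \<subseteq> W" using open_contains_ball by blast
  have "continuous (at p) F" using smooth_on_continuous[OF W(3)] W(1,2) by (simp add: continuous_on_eq_continuous_at)
  then have "continuous (at p within S) F" by (rule continuous_at_imp_continuous_at_within)
  then show "continuous (at p within S) f"
    by (rule continuous_transform_within[OF _ d(1) p]) (use d W in \<open>auto simp: subset_eq dist_commute\<close>)
qed

section \<open>The factor s5 and its vanishing moment\<close>

lemma bounded_if_tendsto_0:
  fixes f :: "real \<Rightarrow> real"
  assumes "continuous_on {0..} f" "(f \<longlongrightarrow> 0) at_top"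
  shows "\<exists>A. \<forall>x\<ge>0. \<bar>f x\<bar> \<le> A"
proof -
  have "eventually (\<lambda>x. \<bar>f x\<bar> < 1) at_top"
    using tendstoD[OF assms(2), of 1] by (simp add: dist_real_def)
  then obtain B where B: "\<And>x. x \<ge> B \<Longrightarrow> \<bar>f x\<bar> < 1" by (auto simp: eventually_at_top_linorder)
  have "compact (f ` {0..max 0 B})"
    by (intro compact_continuous_image continuous_on_subset[OF assms(1)]) auto
  then obtain C where C: "\<And>x. x \<in> {0..max 0 B} \<Longrightarrow> \<bar>f x\<bar> \<le> C"
    by (force dest!: compact_imp_bounded simp: bounded_iff)
  have "\<bar>f x\<bar> \<le> max 1 C" if "x \<ge> 0" for x
    using B[of x] C[of x] that by (cases "x \<le> B") auto
  then show ?thesis by blast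
qed

lemma erf_deriv: "(erf has_real_derivative 2 / sqrt pi * exp (- x\<^sup>2)) (at x)"
proof -
  let ?a = "- \<bar>x\<bar> - 1" and ?b = "\<bar>x\<bar> + 1"
  have "((\<lambda>u. LBINT y=(0::real)..u. exp (- y\<^sup>2)) has_vector_derivative exp (- x\<^sup>2)) (at x within {?a..?b})"
    by (rule interval_integral_FTC2) (auto intro!: continuous_intros)
  moreover have "at x within {?a..?b} = at x" by (rule at_within_interior) (auto simp: interior_atLeastAtMost_real)
  ultimately have "((\<lambda>u. LBINT y=(0::real)..u. exp (- y\<^sup>2)) has_real_derivative exp (- x\<^sup>2)) (at x)"
    by (simp add: has_real_derivative_iff_has_vector_derivative)
  from DERIV_cmult[OF this, of "2 / sqrt pi"] show ?thesis
    unfolding erf_def[abs_def] by (simp add: zero_ereal_def)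
qed

lemma erf_limit: "(erf \<longlongrightarrow> 1) at_top"
proof -
  let ?f = "\<lambda>x::real. indicator {0..} x *\<^sub>R exp (- x\<^sup>2)"
  have "integrable lborel ?f" and i: "integral\<^sup>L lborel ?f = sqrt pi / 2"
    using gaussian_moment_0 by (auto simp: has_bochner_integral_iff)
  from tendsto_integral_at_top[OF _ this(1)]
  have "((\<lambda>y. 2 / sqrt pi * (\<integral>x. indicator {..y} x *\<^sub>R ?f x \<partial>lborel)) \<longlongrightarrow> 2 / sqrt pi * (sqrt pi / 2)) at_top"
    unfolding i by (intro tendsto_mult_left) simp
  moreover have "eventually (\<lambda>y. 2 / sqrt pi * (\<integral>x. indicator {..y} x *\<^sub>R ?f x \<partial>lborel) = erf y) at_top"
  proof (rule eventually_mono[OF eventually_ge_at_top[of 0]])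
    fix y :: real assume y: "0 \<le> y"
    have "(LBINT x=0..y. exp (- x\<^sup>2)) = (LBINT x:{0..y}. exp (- x\<^sup>2))"
      using interval_integral_Icc[OF y] by (simp add: zero_ereal_def)
    also have "\<dots> = (\<integral>x. indicator {..y} x *\<^sub>R ?f x \<partial>lborel)"
      unfolding set_lebesgue_integral_def by (intro Bochner_Integration.integral_cong) (auto simp: indicator_def)
    finally show "2 / sqrt pi * (\<integral>x. indicator {..y} x *\<^sub>R ?f x \<partial>lborel) = erf y"
      by (simp add: erf_def)
  qed
  ultimately show ?thesis using Lim_transform_eventually by (auto dest: Lim_transform_eventually)
qed

definition s5' :: "real \<Rightarrow> real" where
  "s5' x = 2 / sqrt pi * (4 * x^2 - 4/3 * x^4) * exp (- x\<^sup>2)"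

lemma s5_deriv: "(s5 has_real_derivative s5' x) (at x)"
proof -
  have "((\<lambda>x. (x - 2 * x^3 / 3) * exp (- x\<^sup>2)) has_real_derivative
     (1 - 2 * x^2) * exp (- x\<^sup>2) + (x - 2 * x^3 / 3) * (exp (- x\<^sup>2) * (- 2 * x))) (at x)"
    by (auto intro!: derivative_eq_intros simp: field_simps power2_eq_square power3_eq_cube)
  from DERIV_diff[OF erf_deriv DERIV_cmult[OF this, of "2 / sqrt pi"]]
  have "((\<lambda>x. erf x - 2 / sqrt pi * (x - 2 * x^3 / 3) * exp (- x\<^sup>2)) has_real_derivative
     2 / sqrt pi * exp (- x\<^sup>2) - 2 / sqrt pi * ((1 - 2 * x^2) * exp (- x\<^sup>2) + (x - 2 * x^3 / 3) * (exp (- x\<^sup>2) * (- 2 * x)))) (at x)"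
    by (simp only: mult.assoc)
  also have "2 / sqrt pi * exp (- x\<^sup>2) - 2 / sqrt pi * ((1 - 2 * x^2) * exp (- x\<^sup>2) + (x - 2 * x^3 / 3) * (exp (- x\<^sup>2) * (- 2 * x)))
     = 2 / sqrt pi * exp (- x\<^sup>2) * (1 - (1 - 2 * x^2) + (x - 2 * x^3 / 3) * (2 * x))" by algebra
  also have "1 - (1 - 2 * x^2) + (x - 2 * x^3 / 3) * (2 * x) = 4 * x^2 - 4/3 * x^4"
    by (simp add: field_simps power2_eq_square power3_eq_cube power4_eq_xxxx)
  also have "2 / sqrt pi * exp (- x\<^sup>2) * (4 * x^2 - 4/3 * x^4) = s5' x" by (simp add: s5'_def)
  finally show ?thesis unfolding s5_def[abs_def] .
qed

lemma s5_continuous: "continuous_on A s5"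
  by (intro continuous_at_imp_continuous_on ballI DERIV_isCont[OF s5_deriv])

lemma s5_borel[measurable]: "s5 \<in> borel_measurable borel"
  by (rule borel_measurable_continuous_onI[OF s5_continuous])

lemma s5_limit: "(s5 \<longlongrightarrow> 1) at_top"
proof -
  have "((\<lambda>x. 2 / sqrt pi * (x - 2 * x^3 / 3) * exp (- x\<^sup>2)) \<longlongrightarrow> 0) at_top" by real_asymp
  from tendsto_diff[OF erf_limit this] show ?thesis unfolding s5_def[abs_def] by simp
qed

lemma s5_derivative_bound:
  "\<exists>A. \<forall>x\<ge>0. \<bar>(1 + x) * s5' x\<bar> \<le> A * exp (- x)"
proof -
  have "\<exists>A. \<forall>x\<ge>0. \<bar>(1 + x) * s5' x * exp x\<bar> \<le> A"
  proof (rule bounded_if_tendsto_0)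
    show "continuous_on {0..} (\<lambda>x. (1 + x) * s5' x * exp x)"
      unfolding s5'_def by (intro continuous_intros) auto
    show "((\<lambda>x. (1 + x) * s5' x * exp x) \<longlongrightarrow> 0) at_top" unfolding s5'_def by real_asymp
  qed
  then obtain A where A: "\<And>x. x \<ge> 0 \<Longrightarrow> \<bar>(1 + x) * s5' x * exp x\<bar> \<le> A" by blast
  have "\<bar>(1 + x) * s5' x\<bar> \<le> A * exp (- x)" if "x \<ge> 0" for x
    using A[OF that] by (simp only: abs_mult[of _ "exp x"] exp_minus abs_exp_cancel pos_le_divide_eq[OF exp_gt_zero] divide_inverse[symmetric])
  then show ?thesis by blast
qed

text \<open>
  The bound on \<open>s5 - 1\<close> comes from the one on the derivative: \<open>s5 x + A exp (- x)\<close> decreases and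
  \<open>s5 x - A exp (- x)\<close> increases, both to the limit 1.
\<close>

lemma s5_exponential_bounds:
  "\<exists>A\<ge>0. \<forall>x\<ge>0. \<bar>s5 x - 1\<bar> \<le> A * exp (- x) \<and> \<bar>x * s5' x\<bar> \<le> A * exp (- x)"
proof -
  obtain A where A: "\<And>x. x \<ge> 0 \<Longrightarrow> \<bar>(1 + x) * s5' x\<bar> \<le> A * exp (- x)" using s5_derivative_bound by blast
  have A0: "0 \<le> A" using A[of 0] by simp
  have A1: "\<bar>s5' x\<bar> \<le> A * exp (- x)" "\<bar>x * s5' x\<bar> \<le> A * exp (- x)" if "x \<ge> 0" for x
  proof -
    have "\<bar>(1 + x) * s5' x\<bar> = \<bar>s5' x\<bar> + \<bar>x * s5' x\<bar>" 
      using that by (simp only: abs_mult) (simp add: distrib_right)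
    then show "\<bar>s5' x\<bar> \<le> A * exp (- x)" "\<bar>x * s5' x\<bar> \<le> A * exp (- x)" using A[OF that] by auto
  qed
  have lim: "((\<lambda>x. A * exp (- x)) \<longlongrightarrow> 0) at_top" by real_asymp
  have "\<bar>s5 x - 1\<bar> \<le> A * exp (- x)" if x: "x \<ge> 0" for x
  proof -
    have up: "s5 y + A * exp (- y) \<le> s5 x + A * exp (- x)" if "y \<ge> x" for y
    proof (rule DERIV_nonpos_imp_nonincreasing[OF that])
      fix z assume "x \<le> z" "z \<le> y"
      moreover have "((\<lambda>x. s5 x + A * exp (- x)) has_real_derivative s5' z - A * exp (- z)) (at z)"
        by (auto intro!: derivative_eq_intros s5_deriv)
      ultimately show "\<exists>d. ((\<lambda>x. s5 x + A * exp (- x)) has_real_derivative d) (at z) \<and> d \<le> 0"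
        using A1(1)[of z] x by (intro exI conjI) auto
    qed
    have lo: "s5 x - A * exp (- x) \<le> s5 y - A * exp (- y)" if "y \<ge> x" for y
    proof (rule DERIV_nonneg_imp_nondecreasing[OF that])
      fix z assume "x \<le> z" "z \<le> y"
      moreover have "((\<lambda>x. s5 x - A * exp (- x)) has_real_derivative s5' z + A * exp (- z)) (at z)"
        by (auto intro!: derivative_eq_intros s5_deriv)
      ultimately show "\<exists>d. ((\<lambda>x. s5 x - A * exp (- x)) has_real_derivative d) (at z) \<and> d \<ge> 0"
        using A1(1)[of z] x by (intro exI[of _ "s5' z + A * exp (- z)"]) auto
    qed
    have "1 + 0 \<le> s5 x + A * exp (- x)"
      by (rule tendsto_upperbound[OF tendsto_add[OF s5_limit lim]])
        (auto intro!: eventually_mono[OF eventually_ge_at_top[of x]] up)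
    moreover have "s5 x - A * exp (- x) \<le> 1 - 0"
      by (rule tendsto_lowerbound[OF tendsto_diff[OF s5_limit lim]])
        (auto intro!: eventually_mono[OF eventually_ge_at_top[of x]] lo)
    ultimately show ?thesis by auto
  qed
  then show ?thesis using A0 A1(2) by blast
qed

text \<open>
  A primitive of \<open>x^2 (s5 x - 1)\<close> that is zero at 0. It decays at infinity, so the second moment of
  \<open>s5 - 1\<close> is zero; this is the condition that determines the coefficient \<open>2/3\<close> in \<open>s5\<close>.
\<close>

definition moment_primitive :: "real \<Rightarrow> real" where
  "moment_primitive x = x^3 * (s5 x - 1) / 3 - 4 / (9 * sqrt pi) * x^6 * exp (- x\<^sup>2)"

lemma moment_primitive_deriv:
  "(moment_primitive has_real_derivative x^2 * (s5 x - 1)) (at x)"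
proof -
  have 1: "((\<lambda>x. x^3 * (s5 x - 1) / 3) has_real_derivative x^2 * (s5 x - 1) + x^3 * s5' x / 3) (at x)"
    by (auto intro!: derivative_eq_intros s5_deriv simp: field_simps)
  have "((\<lambda>x. x^6 * exp (- x\<^sup>2)) has_real_derivative
     6 * x^5 * exp (- x\<^sup>2) + x^6 * (exp (- x\<^sup>2) * (- 2 * x))) (at x)"
    by (auto intro!: derivative_eq_intros simp: algebra_simps)
  from DERIV_diff[OF 1 DERIV_cmult[OF this, of "4 / (9 * sqrt pi)"]]
  have "((\<lambda>x. x^3 * (s5 x - 1) / 3 - 4 / (9 * sqrt pi) * x^6 * exp (- x\<^sup>2)) has_real_derivative
     x^2 * (s5 x - 1) + (x^3 * s5' x / 3 - 4 / (9 * sqrt pi) * (6 * x^5 * exp (- x\<^sup>2) + x^6 * (exp (- x\<^sup>2) * (- 2 * x))))) (at x)"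
    by (simp only: mult.assoc add_diff_eq)
  moreover have "x^3 * s5' x / 3 - 4 / (9 * sqrt pi) * (6 * x^5 * exp (- x\<^sup>2) + x^6 * (exp (- x\<^sup>2) * (- 2 * x))) = 0"
  proof -
    have p: "x^3 * x^2 = x^5" "x^3 * x^4 = x^7" "x^6 * x = x^7" by (simp_all flip: power_add power_Suc2)
    have "x^3 * s5' x / 3 = 2 / sqrt pi * exp (- x\<^sup>2) * (4 * (x^3 * x^2) - 4/3 * (x^3 * x^4)) / 3"
      by (simp add: s5'_def algebra_simps)
    also have "\<dots> = 4 / (9 * sqrt pi) * (6 * x^5 * exp (- x\<^sup>2) + x^6 * (exp (- x\<^sup>2) * (- 2 * x)))"
      unfolding p using p(3) by (simp add: field_simps)
    finally show ?thesis by (simp only: diff_self)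
  qed
  ultimately show ?thesis unfolding moment_primitive_def[abs_def] by (simp only: add_0_right)
qed

lemma moment_primitive_bound: "\<exists>A. \<forall>x>0. \<bar>moment_primitive x\<bar> \<le> A / x^2"
proof -
  obtain A where A: "A \<ge> 0" "\<And>x. x \<ge> 0 \<Longrightarrow> \<bar>s5 x - 1\<bar> \<le> A * exp (- x)" using s5_exponential_bounds by blast
  have "\<exists>B. \<forall>x\<ge>0. \<bar>x^5 * (A * exp (- x)) / 3 + 4 / (9 * sqrt pi) * x^8 * exp (- x\<^sup>2)\<bar> \<le> B"
  proof (rule bounded_if_tendsto_0)
    show "continuous_on {0..} (\<lambda>x. x^5 * (A * exp (- x)) / 3 + 4 / (9 * sqrt pi) * x^8 * exp (- x\<^sup>2))"
      by (intro continuous_intros) auto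
    show "((\<lambda>x. x^5 * (A * exp (- x)) / 3 + 4 / (9 * sqrt pi) * x^8 * exp (- x\<^sup>2)) \<longlongrightarrow> 0) at_top"
      by real_asymp
  qed
  then obtain B where B: "\<And>x. x \<ge> 0 \<Longrightarrow> \<bar>x^5 * (A * exp (- x)) / 3 + 4 / (9 * sqrt pi) * x^8 * exp (- x\<^sup>2)\<bar> \<le> B" by blast
  have "\<bar>moment_primitive x\<bar> \<le> B / x^2" if x: "x > 0" for x
  proof -
    have "\<bar>moment_primitive x\<bar> \<le> \<bar>x^3 * (s5 x - 1) / 3\<bar> + \<bar>4 / (9 * sqrt pi) * x^6 * exp (- x\<^sup>2)\<bar>"
      unfolding moment_primitive_def by (rule abs_triangle_ineq4)
    also have "\<dots> \<le> x^3 * (A * exp (- x)) / 3 + 4 / (9 * sqrt pi) * x^6 * exp (- x\<^sup>2)"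
      using A(2)[of x] x by (auto simp: abs_mult intro!: add_mono mult_left_mono divide_right_mono)
    finally have "x^2 * \<bar>moment_primitive x\<bar> \<le> x^2 * (x^3 * (A * exp (- x)) / 3 + 4 / (9 * sqrt pi) * x^6 * exp (- x\<^sup>2))"
      by (rule mult_left_mono) simp
    also have "\<dots> = x^5 * (A * exp (- x)) / 3 + 4 / (9 * sqrt pi) * x^8 * exp (- x\<^sup>2)"
      by (simp add: distrib_left flip: power_add mult.assoc)
    also have "\<dots> \<le> B" using B[of x] x by auto
    finally show ?thesis using x by (simp add: field_simps)
  qed
  then show ?thesis by blast
qed

text \<open>
  The radial factor of the error integrand: the difference of the regularized and the exact kernel.
\<close>

definition defect :: "real \<Rightarrow> real \<Rightarrow> real" where
  "defect \<delta> \<rho> = (s5 (\<rho> / \<delta>) - 1) / \<rho> ^ 3"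

lemma defect_borel[measurable]: "defect \<delta> \<in> borel_measurable borel"
  unfolding defect_def[abs_def] by measurable

text \<open>
  The constants do not depend on \<open>\<delta>\<close> since the defect is \<open>\<delta>^(-3)\<close> times a fixed function of \<open>\<rho> / \<delta>\<close>. The
  Lipschitz bound beyond radius \<open>a\<close> follows from the size of the derivative there.
\<close>

lemma defect_bounds:
  "\<exists>A\<ge>0. (\<forall>\<delta>>0. \<forall>\<rho>>0. \<bar>defect \<delta> \<rho>\<bar> \<le> A * exp (- \<rho> / \<delta>) / \<rho>^3) \<and>
     (\<forall>\<delta>>0. \<forall>a>0. \<forall>\<rho>\<ge>a. \<forall>\<sigma>\<ge>a. \<bar>defect \<delta> \<rho> - defect \<delta> \<sigma>\<bar> \<le> A * exp (- a / \<delta>) / a^4 * \<bar>\<rho> - \<sigma>\<bar>)"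
proof -
  obtain A where A: "A \<ge> 0" "\<And>x. x \<ge> 0 \<Longrightarrow> \<bar>s5 x - 1\<bar> \<le> A * exp (- x)" "\<And>x. x \<ge> 0 \<Longrightarrow> \<bar>x * s5' x\<bar> \<le> A * exp (- x)"
    using s5_exponential_bounds by blast
  have 1: "\<bar>defect \<delta> \<rho>\<bar> \<le> A * exp (- \<rho> / \<delta>) / \<rho>^3" if "\<delta> > 0" "\<rho> > 0" for \<delta> \<rho>
    using A(2)[of "\<rho> / \<delta>"] that by (simp add: defect_def abs_mult divide_right_mono)
  have 2: "\<bar>defect \<delta> \<rho> - defect \<delta> \<sigma>\<bar> \<le> 4 * A * exp (- a / \<delta>) / a^4 * \<bar>\<rho> - \<sigma>\<bar>"
    if d: "\<delta> > 0" "a > 0" and rs: "\<rho> \<ge> a" "\<sigma> \<ge> a" for \<delta> a \<rho> \<sigma>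
  proof -
    let ?k' = "\<lambda>x. ((x / \<delta>) * s5' (x / \<delta>) - 3 * (s5 (x / \<delta>) - 1)) / x^4"
    have der: "(defect \<delta> has_real_derivative ?k' x) (at x)" if "x \<ge> a" for x
    proof -
      have x: "x > 0" using that d by simp
      have "((\<lambda>x. s5 (x / \<delta>)) has_real_derivative s5' (x / \<delta>) * (1 / \<delta>)) (at x)"
        using d by (intro DERIV_chain2[OF s5_deriv]) (auto intro!: derivative_eq_intros)
      then have "((\<lambda>x. (s5 (x / \<delta>) - 1) / x^3) has_real_derivative
          ((s5' (x / \<delta>) * (1 / \<delta>)) * x^3 - (s5 (x / \<delta>) - 1) * (3 * x^2)) / (x^3 * x^3)) (at x)"
        using x by (auto intro!: derivative_eq_intros)
      also have "((s5' (x / \<delta>) * (1 / \<delta>)) * x^3 - (s5 (x / \<delta>) - 1) * (3 * x^2)) / (x^3 * x^3) = ?k' x"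
        using x d by (simp add: field_simps power2_eq_square power3_eq_cube power4_eq_xxxx)
      finally show ?thesis unfolding defect_def[abs_def] .
    qed
    have bd: "\<bar>?k' x\<bar> \<le> 4 * A * exp (- a / \<delta>) / a^4" if "x \<ge> a" for x
    proof -
      have x: "x > 0" using that d by simp
      have "\<bar>(x / \<delta>) * s5' (x / \<delta>) - 3 * (s5 (x / \<delta>) - 1)\<bar> \<le> \<bar>(x / \<delta>) * s5' (x / \<delta>)\<bar> + \<bar>3 * (s5 (x / \<delta>) - 1)\<bar>"
        by (rule abs_triangle_ineq4)
      also have "\<dots> \<le> 4 * A * exp (- x / \<delta>)" using A(2)[of "x / \<delta>"] A(3)[of "x / \<delta>"] x d by (simp add: abs_mult)
      also have "\<dots> \<le> 4 * A * exp (- a / \<delta>)" using A(1) that d by (auto intro!: mult_left_mono divide_right_mono)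
      finally have n: "\<bar>(x / \<delta>) * s5' (x / \<delta>) - 3 * (s5 (x / \<delta>) - 1)\<bar> \<le> 4 * A * exp (- a / \<delta>)" .
      have "\<bar>?k' x\<bar> = \<bar>(x / \<delta>) * s5' (x / \<delta>) - 3 * (s5 (x / \<delta>) - 1)\<bar> / x^4" using x by simp
      also have "\<dots> \<le> 4 * A * exp (- a / \<delta>) / a^4"
        using n that d A(1) by (intro frac_le) (auto intro!: power_mono)
      finally show ?thesis .
    qed
    have "norm (defect \<delta> \<rho> - defect \<delta> \<sigma>) \<le> (4 * A * exp (- a / \<delta>) / a^4) * norm (\<rho> - \<sigma>)"
      by (rule field_differentiable_bound[of "{a..}"])
        (use rs bd der in \<open>auto intro: has_field_derivative_at_within\<close>)
    then show ?thesis by simp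
  qed
  have "A * exp (- \<rho> / \<delta>) / \<rho>^3 \<le> 4 * A * exp (- \<rho> / \<delta>) / \<rho>^3" if "\<rho> > 0" for \<delta> \<rho>
    using A(1) that by (intro divide_right_mono mult_right_mono) auto
  then show ?thesis using 1 2 A(1) by (intro exI[of _ "4 * A"]) (meson order_trans mult_nonneg_nonneg zero_le_numeral)
qed

lemma defect_moment:
  assumes "\<delta> > 0" "R > 0"
  shows "(\<integral>\<rho>. (\<rho>^5 * defect \<delta> \<rho>) * indicator {0..R} \<rho> \<partial>lborel) = \<delta>^3 * moment_primitive (R / \<delta>)"
proof -
  have e: "\<rho>^5 * defect \<delta> \<rho> = \<rho>^2 * (s5 (\<rho> / \<delta>) - 1)" for \<rho>
    by (cases "\<rho> = 0") (auto simp: defect_def field_simps simp flip: power_add)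
  have "(\<integral>\<rho>. (\<rho>^2 * (s5 (\<rho> / \<delta>) - 1)) * indicator {0..R} \<rho> \<partial>lborel) =
    \<delta>^3 * moment_primitive (R / \<delta>) - \<delta>^3 * moment_primitive (0 / \<delta>)"
  proof (rule integral_FTC_Icc_real)
    fix x
    have "((\<lambda>x. moment_primitive (x / \<delta>)) has_real_derivative ((x / \<delta>)^2 * (s5 (x / \<delta>) - 1)) * (1 / \<delta>)) (at x)"
      using assms by (intro DERIV_chain2[OF moment_primitive_deriv]) (auto intro!: derivative_eq_intros)
    note D = DERIV_cmult[OF this, of "\<delta>^3"]
    show "((\<lambda>x. \<delta>^3 * moment_primitive (x / \<delta>)) has_real_derivative x^2 * (s5 (x / \<delta>) - 1)) (at x)"
    proof -
      have "\<delta>^3 * (((x / \<delta>)^2 * (s5 (x / \<delta>) - 1)) * (1 / \<delta>)) = x^2 * (s5 (x / \<delta>) - 1)"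
        using assms(1) by (simp add: field_simps power2_eq_square power3_eq_cube)
      then show ?thesis using D by (simp only:)
    qed
    have "isCont (\<lambda>x. s5 (x / \<delta>)) x"
      using assms(1) isCont_o2[of x "\<lambda>x. x / \<delta>" s5] DERIV_isCont[OF s5_deriv] by simp
    then show "isCont (\<lambda>x. x^2 * (s5 (x / \<delta>) - 1)) x" by simp
  qed (use assms in auto)
  then show ?thesis by (simp add: e moment_primitive_def)
qed

text \<open>
  The primitive is found by repeated integration by parts; its value at 0 is \<open>- 24 \<delta>^5\<close>.
\<close>

lemma exp_moment:
  fixes \<delta> R :: real
  assumes "\<delta> > 0" "R > 0"
  shows "(\<integral>\<rho>. (\<rho>^4 * exp (- \<rho> / \<delta>)) * indicator {0..R} \<rho> \<partial>lborel) \<le> 24 * \<delta>^5"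
proof -
  let ?F = "\<lambda>x::real. - \<delta> * (x^4 + 4 * \<delta> * x^3 + 12 * \<delta>^2 * x^2 + 24 * \<delta>^3 * x + 24 * \<delta>^4) * exp (- x / \<delta>)"
  have "(\<integral>\<rho>. (\<rho>^4 * exp (- \<rho> / \<delta>)) * indicator {0..R} \<rho> \<partial>lborel) = ?F R - ?F 0"
  proof (rule integral_FTC_Icc_real)
    fix x
    have "(?F has_real_derivative
       - \<delta> * ((4 * x^3 + 12 * \<delta> * x^2 + 24 * \<delta>^2 * x + 24 * \<delta>^3) * exp (- x / \<delta>)
         + (x^4 + 4 * \<delta> * x^3 + 12 * \<delta>^2 * x^2 + 24 * \<delta>^3 * x + 24 * \<delta>^4) * (exp (- x / \<delta>) * (- 1 / \<delta>)))) (at x)"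
      by (auto intro!: derivative_eq_intros simp: algebra_simps)
    also have "- \<delta> * ((4 * x^3 + 12 * \<delta> * x^2 + 24 * \<delta>^2 * x + 24 * \<delta>^3) * exp (- x / \<delta>)
         + (x^4 + 4 * \<delta> * x^3 + 12 * \<delta>^2 * x^2 + 24 * \<delta>^3 * x + 24 * \<delta>^4) * (exp (- x / \<delta>) * (- 1 / \<delta>)))
      = x^4 * exp (- x / \<delta>)"
      using assms(1) by (simp add: field_simps power2_eq_square power3_eq_cube power4_eq_xxxx)
    finally show "(?F has_real_derivative x^4 * exp (- x / \<delta>)) (at x)" .
    show "isCont (\<lambda>x. x^4 * exp (- x / \<delta>)) x" using assms(1) by (intro continuous_intros) auto
  qed (use assms in auto)
  also have "\<dots> \<le> 24 * \<delta>^5"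
  proof -
    have "?F R \<le> 0" using assms by (simp add: mult_nonneg_nonneg add_nonneg_nonneg)
    moreover have "- ?F 0 = 24 * \<delta>^5" by (simp flip: power_Suc)
    ultimately show ?thesis by linarith
  qed
  finally show ?thesis .
qed

section \<open>Homogeneous functions against radial weights\<close>

lemma cball_borel[measurable]: "cball (a :: 'a::euclidean_space) R \<in> sets borel" by simp

lemma nn_integral_scale:
  fixes f :: "'a::euclidean_space \<Rightarrow> ennreal"
  assumes [measurable]: "f \<in> borel_measurable borel" and c: "c > 0"
  shows "(\<integral>\<^sup>+u. f u \<partial>lborel) = ennreal (c ^ DIM('a)) * (\<integral>\<^sup>+u. f (c *\<^sub>R u) \<partial>lborel)"
proof -
  have "c \<noteq> 0" using c by simp
  show ?thesis
    by (subst lborel_affine[OF \<open>c \<noteq> 0\<close>, of 0])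
      (use c in \<open>simp add: nn_integral_density nn_integral_distr nn_integral_cmult\<close>)
qed

lemma integral_odd:
  fixes f :: "'a::euclidean_space \<Rightarrow> real"
  assumes [measurable]: "f \<in> borel_measurable borel" and odd: "\<And>u. f (- u) = - f u"
  shows "integral\<^sup>L lborel f = 0"
proof -
  have "(lborel :: 'a measure) = distr lborel borel (\<lambda>x. 0 + (-1) *\<^sub>R x)"
    using lborel_affine[of "-1" "0::'a"] by (simp add: density_1)
  then have "integral\<^sup>L lborel f = integral\<^sup>L (distr lborel borel (\<lambda>x. 0 + (-1) *\<^sub>R x)) f" by simp
  also have "\<dots> = (\<integral>u. f (- u) \<partial>lborel)" by (subst integral_distr) simp_all
  also have "\<dots> = - integral\<^sup>L lborel f" by (simp add: odd)
  finally show ?thesis by simp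
qed

text \<open>
  Polar coordinates without angles: scaling gives mass \<open>m t^(k + d)\<close> to the ball of radius \<open>t\<close>, and
  these masses determine the distribution of the norm.
\<close>

lemma homogeneous_radial_distr:
  fixes N :: "'a::euclidean_space \<Rightarrow> real"
  assumes cont: "continuous_on UNIV N" and pos: "\<And>u. 0 \<le> N u"
    and hom: "\<And>c u. c > 0 \<Longrightarrow> N (c *\<^sub>R u) = c ^ k * N u" and R: "R > 0"
  shows "\<exists>m\<ge>0. distr (density lborel (\<lambda>u. ennreal (N u * indicator (cball 0 R) u))) borel norm =
    density lborel (\<lambda>\<rho>. ennreal (real (k + DIM('a)) * m * \<rho> ^ (k + DIM('a) - 1) * indicator {0..R} \<rho>))"
proof -
  let ?n = "k + DIM('a)"
  have npos: "0 < ?n" by simp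
  have [measurable]: "N \<in> borel_measurable borel" by (rule borel_measurable_continuous_onI[OF cont])
  define m where "m = (\<integral>u. indicator (cball 0 1) u *\<^sub>R N u \<partial>lborel)"
  have m0: "0 \<le> m" unfolding m_def by (rule integral_nonneg_AE) (simp add: pos)
  have int1: "integrable lborel (\<lambda>u. indicator (cball 0 1) u *\<^sub>R N u)"
    by (rule borel_integrable_compact) (auto intro: continuous_on_subset[OF cont])
  (* The mass of the ball of radius t; closed balls, so that the half lines {x<..} correspond to complements. *)
  define w where "w t = (\<integral>\<^sup>+u. ennreal (N u) * indicator (cball 0 t) u \<partial>lborel)" for t
  have w1: "w 1 = ennreal m"
  proof -
    have "w 1 = (\<integral>\<^sup>+u. ennreal (indicator (cball 0 1) u *\<^sub>R N u) \<partial>lborel)"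
      unfolding w_def by (intro nn_integral_cong) (auto simp: indicator_def)
    then show ?thesis using nn_integral_eq_integral[OF int1] pos by (simp add: m_def)
  qed
  have wt: "w t = ennreal (m * t ^ ?n)" if t: "t > 0" for t
  proof -
    have "w t = ennreal (t ^ DIM('a)) * (\<integral>\<^sup>+u. ennreal (N (t *\<^sub>R u)) * indicator (cball 0 t) (t *\<^sub>R u) \<partial>lborel)"
      unfolding w_def by (rule nn_integral_scale[OF _ t]) measurable
    also have "(\<integral>\<^sup>+u. ennreal (N (t *\<^sub>R u)) * indicator (cball 0 t) (t *\<^sub>R u) \<partial>lborel)
      = (\<integral>\<^sup>+u. ennreal (t ^ k) * (ennreal (N u) * indicator (cball 0 1) u) \<partial>lborel)"
    proof (intro nn_integral_cong)
      fix u :: 'a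
      have "indicator (cball 0 t) (t *\<^sub>R u) = (indicator (cball 0 1) u :: ennreal)"
        using t by (auto simp: indicator_def)
      then show "ennreal (N (t *\<^sub>R u)) * indicator (cball 0 t) (t *\<^sub>R u) = ennreal (t ^ k) * (ennreal (N u) * indicator (cball 0 1) u)"
        using t by (simp add: hom ennreal_mult' mult.assoc)
    qed
    also have "\<dots> = ennreal (t ^ k) * ennreal m" by (subst nn_integral_cmult) (simp_all add: w1[unfolded w_def])
    also have "ennreal (t ^ DIM('a)) * (ennreal (t ^ k) * ennreal m) = ennreal (m * t ^ ?n)"
      using t m0 by (simp add: ennreal_mult'[symmetric] power_add mult_ac)
    finally show ?thesis .
  qed
  have w0: "w 0 = 0"
  proof -
    have "w 0 = (\<integral>\<^sup>+u. ennreal (N 0) * indicator {0::'a} u \<partial>lborel)"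
      unfolding w_def by (intro nn_integral_cong) (auto simp: indicator_def)
    then show ?thesis by (simp add: nn_integral_cmult)
  qed
  have wt0: "w t = ennreal (m * t ^ ?n)" if "t \<ge> 0" for t
    using wt[of t] w0 that npos by (cases "t = 0") (auto simp: zero_power)
  let ?M = "distr (density lborel (\<lambda>u. ennreal (N u * indicator (cball 0 R) u))) borel norm"
  let ?D = "density lborel (\<lambda>\<rho>. ennreal (real ?n * m * \<rho> ^ (?n - 1) * indicator {0..R} \<rho>))"
  have eM: "emeasure ?M {x<..} = (\<integral>\<^sup>+u. ennreal (N u) * indicator {u. x < norm u \<and> norm u \<le> R} u \<partial>lborel)" for x
  proof -
    have "emeasure ?M {x<..} = (\<integral>\<^sup>+u. ennreal (N u * indicator (cball 0 R) u) * indicator (norm -` {x<..}) u \<partial>lborel)"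
    proof -
      have A: "norm -` {x<..} \<in> sets (borel :: 'a measure)"
        by (rule measurable_sets_borel[where M = borel]) simp_all
      have f: "(\<lambda>u. ennreal (N u * indicator (cball 0 R) u)) \<in> borel_measurable borel" by measurable
      show ?thesis by (subst emeasure_distr) (simp_all add: emeasure_density A f)
    qed
    also have "\<dots> = (\<integral>\<^sup>+u. ennreal (N u) * indicator {u. x < norm u \<and> norm u \<le> R} u \<partial>lborel)"
      by (intro nn_integral_cong) (auto simp: indicator_def)
    finally show ?thesis .
  qed
  have eM_add: "emeasure ?M {x<..} + w x = w R" if x: "x \<ge> 0" "x \<le> R" for x
  proof -
    have "emeasure ?M {x<..} + w x = (\<integral>\<^sup>+u. ennreal (N u) * indicator {u. x < norm u \<and> norm u \<le> R} u + ennreal (N u) * indicator (cball 0 x) u \<partial>lborel)"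
      unfolding eM w_def by (subst nn_integral_add) auto
    also have "\<dots> = w R"
      unfolding w_def using x by (intro nn_integral_cong) (auto simp: indicator_def)
    finally show ?thesis .
  qed
  have eMx: "emeasure ?M {x<..} = ennreal (m * R ^ ?n - m * x ^ ?n)" if x: "x \<ge> 0" "x \<le> R" for x
  proof -
    have le: "m * x ^ ?n \<le> m * R ^ ?n" using x m0 by (intro mult_left_mono power_mono) auto
    have "emeasure ?M {x<..} + ennreal (m * x ^ ?n) = ennreal (m * R ^ ?n - m * x ^ ?n) + ennreal (m * x ^ ?n)"
      using eM_add[OF x] wt0[of x] wt0[of R] x R le m0 by (simp flip: ennreal_plus)
    then have "ennreal (m * x ^ ?n) + emeasure ?M {x<..} = ennreal (m * x ^ ?n) + ennreal (m * R ^ ?n - m * x ^ ?n)"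
      by (simp only: add.commute)
    then show ?thesis unfolding ennreal_add_left_cancel by auto
  qed
  have eD: "emeasure ?D {x<..} = (\<integral>\<^sup>+\<rho>. ennreal (real ?n * m * \<rho> ^ (?n - 1)) * indicator {max 0 x..R} \<rho> \<partial>lborel)" for x
  proof -
    have "emeasure ?D {x<..} = (\<integral>\<^sup>+\<rho>. ennreal (real ?n * m * \<rho> ^ (?n - 1) * indicator {0..R} \<rho>) * indicator {x<..} \<rho> \<partial>lborel)"
      by (subst emeasure_density) simp_all
    also have "\<dots> = (\<integral>\<^sup>+\<rho>. ennreal (real ?n * m * \<rho> ^ (?n - 1)) * indicator {max 0 x..R} \<rho> \<partial>lborel)"
      by (rule nn_integral_cong_AE, rule AE_mp[OF AE_lborel_singleton[of x]]) (auto simp: indicator_def intro!: AE_I2)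
    finally show ?thesis .
  qed
  have eDx: "emeasure ?D {x<..} = ennreal (m * R ^ ?n - m * max 0 x ^ ?n)" if x: "max 0 x \<le> R" for x
    unfolding eD
  proof (rule nn_integral_FTC_Icc)
    show "((\<lambda>\<rho>. m * \<rho> ^ ?n) has_real_derivative real ?n * m * t ^ (?n - 1)) (at t)" for t
      by (auto intro!: derivative_eq_intros)
  qed (use x m0 in auto)
  have eM0: "emeasure ?M {x<..} = ennreal (m * R ^ ?n)" if "x < 0" for x
  proof -
    have "emeasure ?M {x<..} = w R" unfolding eM w_def
      using that by (intro nn_integral_cong) (auto simp: indicator_def intro: less_le_trans)
    then show ?thesis using wt[OF R] by simp
  qed
  have eMR: "emeasure ?M {x<..} = 0" if "x > R" for x
  proof -
    have "emeasure ?M {x<..} = (\<integral>\<^sup>+u. 0 \<partial>(lborel :: 'a measure))" unfolding eM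
      using that by (intro nn_integral_cong) (auto simp: indicator_def)
    then show ?thesis by simp
  qed
  have eDR: "emeasure ?D {x<..} = 0" if "x > R" for x
  proof -
    have "emeasure ?D {x<..} = (\<integral>\<^sup>+\<rho>. 0 \<partial>(lborel :: real measure))" unfolding eD
      using that by (intro nn_integral_cong) (auto simp: indicator_def)
    then show ?thesis by simp
  qed
  have eq: "emeasure ?M {x<..} = emeasure ?D {x<..}" and fin: "emeasure ?M {x<..} < \<infinity>" for x
  proof -
    consider "x < 0" | "0 \<le> x" "x \<le> R" | "R < x" by linarith
    then have "emeasure ?M {x<..} = emeasure ?D {x<..} \<and> emeasure ?M {x<..} < \<infinity>"
    proof cases
      case 1 then show ?thesis using eM0[of x] eDx[of x] R npos by (simp add: max_def zero_power)
    next
      case 2 then show ?thesis using eMx[of x] eDx[of x] by (simp add: max_def)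
    next
      case 3 then show ?thesis using eMR[of x] eDR[of x] by simp
    qed
    then show "emeasure ?M {x<..} = emeasure ?D {x<..}" "emeasure ?M {x<..} < \<infinity>" by auto
  qed
  have "?M = ?D"
  proof (rule measure_eqI_lessThan)
    show "emeasure ?M {x<..} < \<infinity>" for x by (rule fin)
  qed (auto simp: eq)
  then show ?thesis using m0 by blast
qed


lemma integrable_on_cball:
  fixes f :: "'a::euclidean_space \<Rightarrow> real"
  assumes "f \<in> borel_measurable borel" "\<And>u. u \<in> cball 0 R \<Longrightarrow> \<bar>f u\<bar> \<le> K"
  shows "integrable lborel (\<lambda>u. f u * indicator (cball 0 R) u)"
proof (rule integrableI_bounded_set[where A = "cball 0 R" and B = K])
  show "(\<lambda>u. f u * indicator (cball 0 R) u) \<in> borel_measurable lborel"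
  proof -
    note [measurable] = assms(1)
    show ?thesis by measurable
  qed
  show "emeasure lborel (cball (0::'a) R) < \<infinity>" by (rule emeasure_lborel_cball_finite)
qed (use assms(2) in \<open>auto simp: indicator_def\<close>)

lemma homogeneous_radial_integral_nonneg:
  fixes N :: "'a::euclidean_space \<Rightarrow> real"
  assumes cont: "continuous_on UNIV N" and pos: "\<And>u. 0 \<le> N u"
    and hom: "\<And>c u. c > 0 \<Longrightarrow> N (c *\<^sub>R u) = c ^ k * N u" and R: "R > 0"
  shows "\<exists>c\<ge>0. \<forall>g\<in>borel_measurable borel. (\<integral>u. N u * g (norm u) * indicator (cball 0 R) u \<partial>lborel) =
    c * (\<integral>\<rho>. \<rho> ^ (k + DIM('a) - 1) * g \<rho> * indicator {0..R} \<rho> \<partial>lborel)"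
proof -
  let ?n = "k + DIM('a)"
  have [measurable]: "N \<in> borel_measurable borel" by (rule borel_measurable_continuous_onI[OF cont])
  obtain m where m: "m \<ge> 0" "distr (density lborel (\<lambda>u. ennreal (N u * indicator (cball 0 R) u))) borel norm =
    density lborel (\<lambda>\<rho>. ennreal (real ?n * m * \<rho> ^ (?n - 1) * indicator {0..R} \<rho>))"
    using homogeneous_radial_distr[OF assms] by blast
  have "(\<integral>u. N u * g (norm u) * indicator (cball 0 R) u \<partial>lborel) =
    (real ?n * m) * (\<integral>\<rho>. \<rho> ^ (?n - 1) * g \<rho> * indicator {0..R} \<rho> \<partial>lborel)"
    if [measurable]: "g \<in> borel_measurable borel" for g :: "real \<Rightarrow> real"
  proof -
    have m': "(\<lambda>u. N u * indicat_real (cball 0 R) u) \<in> borel_measurable borel" by measurable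
    have "(\<integral>u. N u * g (norm u) * indicator (cball 0 R) u \<partial>lborel) =
      (\<integral>u. (N u * indicator (cball 0 R) u) *\<^sub>R g (norm u) \<partial>lborel)"
      by (intro Bochner_Integration.integral_cong) auto
    also have "\<dots> = (\<integral>u. g (norm u) \<partial>density lborel (\<lambda>u. ennreal (N u * indicator (cball 0 R) u)))"
      by (subst integral_density) (auto simp: pos m')
    also have "\<dots> = (\<integral>\<rho>. g \<rho> \<partial>distr (density lborel (\<lambda>u. ennreal (N u * indicator (cball 0 R) u))) borel norm)"
      by (subst integral_distr) auto
    also have "\<dots> = (\<integral>\<rho>. (real ?n * m * \<rho> ^ (?n - 1) * indicator {0..R} \<rho>) *\<^sub>R g \<rho> \<partial>lborel)"
      unfolding m(2) using m(1) by (subst integral_density) (auto simp: indicator_def)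
    also have "\<dots> = (\<integral>\<rho>. (real ?n * m) * (\<rho> ^ (?n - 1) * g \<rho> * indicator {0..R} \<rho>) \<partial>lborel)"
      by (intro Bochner_Integration.integral_cong) auto
    finally show ?thesis by simp
  qed
  then show ?thesis using m(1) by (intro exI[of _ "real ?n * m"]) auto
qed

text \<open>
  A homogeneous function of changing sign is split into its positive and negative parts, which are again
  continuous and homogeneous.
\<close>

lemma homogeneous_radial_integral:
  fixes N :: "'a::euclidean_space \<Rightarrow> real"
  assumes cont: "continuous_on UNIV N"
    and hom: "\<And>c u. c > 0 \<Longrightarrow> N (c *\<^sub>R u) = c ^ k * N u" and R: "R > 0"
  shows "\<exists>c. \<forall>g\<in>borel_measurable borel. (\<exists>K. \<forall>u\<in>cball 0 R. \<bar>N u * g (norm u)\<bar> \<le> K) \<longrightarrow>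
    (\<integral>u. N u * g (norm u) * indicator (cball 0 R) u \<partial>lborel) =
    c * (\<integral>\<rho>. \<rho> ^ (k + DIM('a) - 1) * g \<rho> * indicator {0..R} \<rho> \<partial>lborel)"
proof -
  define P where "P u = max (N u) 0" for u
  define Q where "Q u = max (- N u) 0" for u
  have PQ: "N u = P u - Q u" "0 \<le> P u" "0 \<le> Q u" "P u \<le> \<bar>N u\<bar>" "Q u \<le> \<bar>N u\<bar>" for u
    by (auto simp: P_def Q_def)
  have cP: "continuous_on UNIV P" unfolding P_def[abs_def] by (intro continuous_intros cont)
  have cQ: "continuous_on UNIV Q" unfolding Q_def[abs_def] by (intro continuous_intros cont)
  have hP: "P (c *\<^sub>R u) = c ^ k * P u" if "c > 0" for c u
    using that by (simp add: P_def hom max_mult_distrib_left)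
  have hQ: "Q (c *\<^sub>R u) = c ^ k * Q u" if "c > 0" for c u
    using that by (simp add: Q_def hom max_mult_distrib_left)
  obtain a b where a: "\<And>g. g \<in> borel_measurable borel \<Longrightarrow> (\<integral>u. P u * g (norm u) * indicator (cball 0 R) u \<partial>lborel) =
    a * (\<integral>\<rho>. \<rho> ^ (k + DIM('a) - 1) * g \<rho> * indicator {0..R} \<rho> \<partial>lborel)"
   and b: "\<And>g. g \<in> borel_measurable borel \<Longrightarrow> (\<integral>u. Q u * g (norm u) * indicator (cball 0 R) u \<partial>lborel) =
    b * (\<integral>\<rho>. \<rho> ^ (k + DIM('a) - 1) * g \<rho> * indicator {0..R} \<rho> \<partial>lborel)"
    using homogeneous_radial_integral_nonneg[OF cP PQ(2) hP R] homogeneous_radial_integral_nonneg[OF cQ PQ(3) hQ R] by blast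
  show ?thesis
  proof (intro exI[of _ "a - b"] ballI impI)
    fix g :: "real \<Rightarrow> real" assume g[measurable]: "g \<in> borel_measurable borel"
    assume "\<exists>K. \<forall>u\<in>cball 0 R. \<bar>N u * g (norm u)\<bar> \<le> K"
    then obtain K where K: "\<And>u. u \<in> cball 0 R \<Longrightarrow> \<bar>N u\<bar> * \<bar>g (norm u)\<bar> \<le> K" unfolding abs_mult by blast
    have [measurable]: "P \<in> borel_measurable borel" "Q \<in> borel_measurable borel"
      using cP cQ by (auto intro: borel_measurable_continuous_onI)
    have i1: "integrable lborel (\<lambda>u. (P u * g (norm u)) * indicator (cball 0 R) u)"
    proof (rule integrable_on_cball)
      fix u :: 'a assume "u \<in> cball 0 R"
      from order_trans[OF mult_right_mono[OF PQ(4)] K[OF this]] show "\<bar>P u * g (norm u)\<bar> \<le> K"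
        using PQ(2)[of u] by (simp add: abs_mult)
    qed measurable
    have i2: "integrable lborel (\<lambda>u. (Q u * g (norm u)) * indicator (cball 0 R) u)"
    proof (rule integrable_on_cball)
      fix u :: 'a assume "u \<in> cball 0 R"
      from order_trans[OF mult_right_mono[OF PQ(5)] K[OF this]] show "\<bar>Q u * g (norm u)\<bar> \<le> K"
        using PQ(3)[of u] by (simp add: abs_mult)
    qed measurable
    have "(\<integral>u. N u * g (norm u) * indicator (cball 0 R) u \<partial>lborel) =
      (\<integral>u. P u * g (norm u) * indicator (cball 0 R) u - Q u * g (norm u) * indicator (cball 0 R) u \<partial>lborel)"
      by (intro Bochner_Integration.integral_cong) (auto simp: PQ(1) left_diff_distrib)
    also have "\<dots> = (\<integral>u. P u * g (norm u) * indicator (cball 0 R) u \<partial>lborel) - (\<integral>u. Q u * g (norm u) * indicator (cball 0 R) u \<partial>lborel)"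
      by (rule Bochner_Integration.integral_diff[OF i1 i2])
    finally show "(\<integral>u. N u * g (norm u) * indicator (cball 0 R) u \<partial>lborel) =
      (a - b) * (\<integral>\<rho>. \<rho> ^ (k + DIM('a) - 1) * g \<rho> * indicator {0..R} \<rho> \<partial>lborel)"
      by (simp add: a b left_diff_distrib)
  qed
qed

text \<open>
  In the plane, degree 4 produces the weight \<open>\<rho>^5\<close>, and \<open>\<rho>^5\<close> times the defect is the integrand of the
  vanishing moment. The integral up to \<open>R\<close> is therefore only the tail of the moment.
\<close>

lemma degree_four_moment:
  fixes N :: "real^2 \<Rightarrow> real"
  assumes cont: "continuous_on UNIV N"
    and hom: "\<And>c u. c > 0 \<Longrightarrow> N (c *\<^sub>R u) = c ^ 4 * N u" and bd: "\<And>u. \<bar>N u\<bar> \<le> C * norm u ^ 4" and R: "R > 0"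
  shows "\<exists>K. \<forall>\<delta>>0. \<bar>\<integral>u. N u * defect \<delta> (norm u) * indicator (cball 0 R) u \<partial>lborel\<bar> \<le> K * \<delta>^5"
proof -
  obtain A where A: "A \<ge> 0" "\<And>\<delta> \<rho>. \<delta> > 0 \<Longrightarrow> \<rho> > 0 \<Longrightarrow> \<bar>defect \<delta> \<rho>\<bar> \<le> A * exp (- \<rho> / \<delta>) / \<rho>^3"
    using defect_bounds by blast
  obtain B where B: "\<And>x. x > 0 \<Longrightarrow> \<bar>moment_primitive x\<bar> \<le> B / x^2" using moment_primitive_bound by blast
  obtain c where c: "\<And>g. g \<in> borel_measurable borel \<Longrightarrow> (\<exists>K. \<forall>u\<in>cball 0 R. \<bar>N u * g (norm u)\<bar> \<le> K) \<Longrightarrow>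
    (\<integral>u. N u * g (norm u) * indicator (cball 0 R) u \<partial>lborel) =
    c * (\<integral>\<rho>. \<rho> ^ 5 * g \<rho> * indicator {0..R} \<rho> \<partial>lborel)"
    using homogeneous_radial_integral[OF cont hom R] by auto
  have C0: "0 \<le> C"
  proof -
    have "0 \<le> C * norm (axis 1 1 :: real^2) ^ 4" using bd[of "axis 1 1"] abs_ge_zero order_trans by blast
    then show ?thesis by simp
  qed
  have "\<bar>\<integral>u. N u * defect \<delta> (norm u) * indicator (cball 0 R) u \<partial>lborel\<bar> \<le> \<bar>c\<bar> * B / R^2 * \<delta>^5" if d: "\<delta> > 0" for \<delta>
  proof -
    have "\<bar>N u * defect \<delta> (norm u)\<bar> \<le> C * R * A" if u: "u \<in> cball 0 R" for u
    proof (cases "u = 0")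
      case True then show ?thesis using C0 R A(1) bd[of 0] by simp
    next
      case False
      then have n: "norm u > 0" by simp
      have "\<bar>N u * defect \<delta> (norm u)\<bar> \<le> (C * norm u ^ 4) * (A * exp (- norm u / \<delta>) / norm u ^ 3)"
        unfolding abs_mult using C0 by (intro mult_mono bd A(2) d n) auto
      also have "\<dots> = C * norm u * A * exp (- norm u / \<delta>)" using n by (simp add: field_simps power_eq_if[of _ 4] power3_eq_cube power2_eq_square)
      also have "\<dots> \<le> C * R * A * 1" using C0 A(1) u d R
        by (intro mult_mono) (auto intro!: mult_nonneg_nonneg)
      finally show ?thesis by simp
    qed
    then have "\<exists>K. \<forall>u\<in>cball 0 R. \<bar>N u * defect \<delta> (norm u)\<bar> \<le> K" by blast
    then have "(\<integral>u. N u * defect \<delta> (norm u) * indicator (cball 0 R) u \<partial>lborel) = c * (\<delta>^3 * moment_primitive (R / \<delta>))"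
      using c[OF defect_borel, of \<delta>] defect_moment[OF d R] by auto
    moreover have "\<bar>c * (\<delta>^3 * moment_primitive (R / \<delta>))\<bar> \<le> \<bar>c\<bar> * (\<delta>^3 * (B / (R / \<delta>)^2))"
      unfolding abs_mult using B[of "R / \<delta>"] d R by (intro mult_mono order_refl) simp_all
    moreover have "\<bar>c\<bar> * (\<delta>^3 * (B / (R / \<delta>)^2)) = \<bar>c\<bar> * B / R^2 * \<delta>^5"
      using d R by (simp add: power_divide field_simps flip: power_add)
    ultimately show ?thesis by simp
  qed
  then show ?thesis by blast
qed

lemma cubic_exp_moment:
  fixes R :: real assumes R: "R > 0"
  shows "\<exists>K. \<forall>\<delta>>0. (\<integral>u. norm (u::real^2) ^ 3 * exp (- norm u / \<delta>) * indicator (cball 0 R) u \<partial>lborel) \<le> K * \<delta>^5"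
proof -
  obtain c where c: "c \<ge> 0" "\<And>g. g \<in> borel_measurable borel \<Longrightarrow>
    (\<integral>u. norm (u::real^2) ^ 3 * g (norm u) * indicator (cball 0 R) u \<partial>lborel) =
    c * (\<integral>\<rho>. \<rho> ^ 4 * g \<rho> * indicator {0..R} \<rho> \<partial>lborel)"
    using homogeneous_radial_integral_nonneg[of "\<lambda>u::real^2. norm u ^ 3" 3 R] R
    by (auto simp: power_mult_distrib intro!: continuous_intros)
  have "(\<integral>u. norm (u::real^2) ^ 3 * exp (- norm u / \<delta>) * indicator (cball 0 R) u \<partial>lborel) \<le> (c * 24) * \<delta>^5" if "\<delta> > 0" for \<delta>
    using c(2)[of "\<lambda>\<rho>. exp (- \<rho> / \<delta>)"] mult_left_mono[OF exp_moment[OF that R] c(1)] by simp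
  then show ?thesis by blast
qed

section \<open>The error integral in graph coordinates\<close>

text \<open>
  Writing \<open>N = c (E - 2 \<eta>2) - 2 c (\<eta> - \<eta>2) - (F - c) \<eta>\<close>, with \<open>E\<close> the radial derivative of \<open>\<eta>\<close> and
  \<open>\<eta>2\<close> its quadratic part, shows \<open>N = O(|u|^3)\<close>; hence the parts of \<open>N\<close> of degree less than 3 vanish.
\<close>

lemma numerator_expansion:
  fixes \<eta> F N :: "real^2 \<Rightarrow> real"
  assumes \<eta>: "smooth_on \<eta> (ball 0 R)" "\<eta> 0 = 0" "\<And>v. frechet_derivative \<eta> (at 0) v = 0"
    and F: "smooth_on F (ball 0 R)" "F 0 = c" and R: "0 < R"
  defines "N u \<equiv> c * (frechet_derivative \<eta> (at u) u - \<eta> u) - F u * \<eta> u"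
  obtains N3 N4 N5 \<eta>2 C where
    "continuous_on UNIV N3" "continuous_on UNIV N4" "continuous_on UNIV N5" "continuous_on UNIV \<eta>2"
    "\<And>c u. N3 (c *\<^sub>R u) = c ^ 3 * N3 u" "\<And>c u. N4 (c *\<^sub>R u) = c ^ 4 * N4 u"
    "\<And>c u. N5 (c *\<^sub>R u) = c ^ 5 * N5 u" "\<And>c u. \<eta>2 (c *\<^sub>R u) = c ^ 2 * \<eta>2 u"
    "\<And>u. \<bar>N3 u\<bar> \<le> C * norm u ^ 3" "\<And>u. \<bar>N4 u\<bar> \<le> C * norm u ^ 4" "\<And>u. \<bar>N5 u\<bar> \<le> C * norm u ^ 5"
    "\<And>u. \<bar>\<eta>2 u\<bar> \<le> C * norm u ^ 2"
    "\<And>u. u \<in> ball 0 (R/2) \<Longrightarrow> \<bar>N u - (N3 u + N4 u + N5 u)\<bar> \<le> C * norm u ^ 6"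
    "\<And>u. u \<in> ball 0 (R/2) \<Longrightarrow> \<bar>\<eta> u - \<eta>2 u\<bar> \<le> C * norm u ^ 3"
    "\<And>u. u \<in> ball 0 (R/2) \<Longrightarrow> \<bar>N u\<bar> \<le> C * norm u ^ 3"
    "continuous_on (ball 0 R) N"
proof -
  define E where "E u = frechet_derivative \<eta> (at u) u" for u
  have E_eq: "E u = u $ 1 * frechet_derivative \<eta> (at u) (axis 1 1) + u $ 2 * frechet_derivative \<eta> (at u) (axis 2 1)"
    if "u \<in> ball 0 R" for u
    using linear_real2_expand[OF has_derivative_linear[OF smooth_on_has_derivative[OF \<eta>(1) that]], of u]
    by (simp add: E_def)
  have gC: "Ck k (\<lambda>u. frechet_derivative \<eta> (at u) (axis i 1)) (ball 0 R)" for k i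
    by (intro smooth_on_Ck smooth_on_partial[OF \<eta>(1)]) auto
  have EC: "Ck k E (ball 0 R)" for k
    by (subst Ck_cong[OF open_ball E_eq])
      (assumption, intro Ck_add Ck_mult gC Ck_linear[OF bounded_linear_vec_nth] open_ball)
  have NC: "Ck k N (ball 0 R)" for k
  proof -
    have "Ck k (\<lambda>u. c * (E u + (-1) * \<eta> u) + (-1) * (F u * \<eta> u)) (ball 0 R)"
      by (intro Ck_add Ck_mult Ck_const EC smooth_on_Ck[OF \<eta>(1)] smooth_on_Ck[OF F(1)] open_ball)
    then show ?thesis by (simp add: N_def[abs_def] E_def)
  qed
  obtain G1 where G1: "0 \<le> G1" "\<And>u. u \<in> ball 0 (R/2) \<Longrightarrow> \<bar>frechet_derivative \<eta> (at u) (axis 1 1)\<bar> \<le> G1 * norm u"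
    by (rule C1_Lipschitz_at_0[OF gC[of 1 1] R, unfolded \<eta>(3) diff_0_right]) (rule that)
  obtain G2 where G2: "0 \<le> G2" "\<And>u. u \<in> ball 0 (R/2) \<Longrightarrow> \<bar>frechet_derivative \<eta> (at u) (axis 2 1)\<bar> \<le> G2 * norm u"
    by (rule C1_Lipschitz_at_0[OF gC[of 1 2] R, unfolded \<eta>(3) diff_0_right]) (rule that)
  have E2: "\<bar>E u\<bar> \<le> (G1 + G2) * norm u ^ 2" if u: "u \<in> ball 0 (R/2)" for u
  proof -
    have uR: "u \<in> ball 0 R" using u R by auto
    have "\<bar>E u\<bar> \<le> \<bar>u $ 1\<bar> * \<bar>frechet_derivative \<eta> (at u) (axis 1 1)\<bar> + \<bar>u $ 2\<bar> * \<bar>frechet_derivative \<eta> (at u) (axis 2 1)\<bar>"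
      unfolding E_eq[OF uR] by (simp flip: abs_mult)
    also have "\<dots> \<le> norm u * (G1 * norm u) + norm u * (G2 * norm u)"
      by (intro add_mono mult_mono G1(2)[OF u] G2(2)[OF u] component_le_norm_cart) auto
    finally show ?thesis by (simp add: power2_eq_square algebra_simps)
  qed
  have n6: "0 < (6::nat)" and n3: "0 < (3::nat)" by simp_all
  obtain P C1 M where P: "\<And>k. continuous_on UNIV (P k)" "\<And>k c u. P k (c *\<^sub>R u) = c ^ k * P k u"
    "\<And>k u. \<bar>P k u\<bar> \<le> M k * norm u ^ k" "0 \<le> C1"
    "\<And>u. u \<in> ball 0 (R/2) \<Longrightarrow> \<bar>\<eta> u - (\<Sum>k<3. P k u)\<bar> \<le> C1 * norm u ^ 3"
    "\<And>u. u \<in> ball 0 (R/2) \<Longrightarrow> \<bar>E u - (\<Sum>k<3. real k * P k u)\<bar> \<le> C1 * norm u ^ 3"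
    by (rule homogeneous_Taylor_obtain[OF smooth_on_Ck[OF \<eta>(1), of 3] R n3, folded E_def]) (rule that)
  have s3: "(\<Sum>k<3. g k) = g 0 + g 1 + g 2" for g :: "nat \<Rightarrow> real" by (simp add: eval_nat_numeral)
  have cube: "norm u ^ 3 \<le> R * norm u ^ 2" if "u \<in> ball 0 (R/2)" for u :: "real^2"
  proof -
    have "norm u * norm u ^ 2 \<le> R * norm u ^ 2" using that R by (intro mult_right_mono) auto
    then show ?thesis by (simp add: power3_eq_cube power2_eq_square mult.assoc)
  qed
  have P1: "P 1 u = 0" for u
  proof -
    have "real 1 * P 1 u = 0"
    proof (rule homogeneous_parts_vanish[where P = "\<lambda>k u. real k * P k u" and n = 3 and m = 2 and r = "R/2" and C = "G1 + G2 + C1 * R"])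
      show "\<bar>\<Sum>k<3. real k * P k u\<bar> \<le> (G1 + G2 + C1 * R) * norm u ^ 2" if u: "u \<in> ball 0 (R/2)" for u
      proof -
        note cube[OF u]
        then have "C1 * norm u ^ 3 \<le> C1 * R * norm u ^ 2" using P(4) by (simp add: mult_left_mono mult.assoc)
        then show ?thesis using P(6)[OF u] E2[OF u] unfolding distrib_right by linarith
      qed
    qed (use R P(2) in \<open>auto simp: mult_ac\<close>)
    then show ?thesis by simp
  qed
  have P0: "P 0 u = 0" for u
  proof -
    have "P 2 0 = 0" using P(2)[of 2 0 0] by simp
    then have "P 0 0 = 0" using P(5)[of 0] R \<eta>(2) P1[of 0] by (simp add: s3)
    then show ?thesis using P(2)[of 0 0 u] by simp
  qed
  have \<eta>a: "\<bar>\<eta> u - P 2 u\<bar> \<le> C1 * norm u ^ 3" and Ea: "\<bar>E u - 2 * P 2 u\<bar> \<le> C1 * norm u ^ 3" if "u \<in> ball 0 (R/2)" for u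
    using P(5,6)[OF that] by (simp_all add: s3 P0 P1 P1[unfolded One_nat_def])
  obtain C2 where C2: "0 \<le> C2" "\<And>u. u \<in> ball 0 (R/2) \<Longrightarrow> \<bar>F u - c\<bar> \<le> C2 * norm u"
    by (rule C1_Lipschitz_at_0[OF smooth_on_Ck[OF F(1)] R, unfolded F(2)]) (rule that)
  define C3 where "C3 = 3 * \<bar>c\<bar> * C1 + C2 * (\<bar>M 2\<bar> + C1 * R)"
  have M2: "\<bar>P 2 u\<bar> \<le> \<bar>M 2\<bar> * norm u ^ 2" for u
    using P(3)[of 2 u] by (rule order_trans) (intro mult_right_mono, auto)
  have N3b: "\<bar>N u\<bar> \<le> C3 * norm u ^ 3" if u: "u \<in> ball 0 (R/2)" for u
  proof -
    note cube[OF u]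
    then have "C1 * norm u ^ 3 \<le> C1 * R * norm u ^ 2" using P(4) by (simp add: mult_left_mono mult.assoc)
    then have \<eta>b: "\<bar>\<eta> u\<bar> \<le> (\<bar>M 2\<bar> + C1 * R) * norm u ^ 2" using \<eta>a[OF u] M2[of u] unfolding distrib_right by linarith
    have "N u = c * (E u - 2 * P 2 u) - 2 * c * (\<eta> u - P 2 u) - (F u - c) * \<eta> u"
      by (simp add: N_def E_def algebra_simps)
    then have "\<bar>N u\<bar> \<le> \<bar>c * (E u - 2 * P 2 u)\<bar> + \<bar>2 * c * (\<eta> u - P 2 u)\<bar> + \<bar>(F u - c) * \<eta> u\<bar>" by linarith
    also have "\<dots> \<le> \<bar>c\<bar> * (C1 * norm u ^ 3) + 2 * \<bar>c\<bar> * (C1 * norm u ^ 3) + (C2 * norm u) * ((\<bar>M 2\<bar> + C1 * R) * norm u ^ 2)"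
      unfolding abs_mult using C2(1) by (intro add_mono mult_mono Ea \<eta>a C2(2) \<eta>b u) auto
    also have "\<dots> = C3 * norm u ^ 3" by (simp add: C3_def power3_eq_cube power2_eq_square algebra_simps)
    finally show ?thesis .
  qed
  obtain Q C4 L where Q: "\<And>k. continuous_on UNIV (Q k)" "\<And>k c u. Q k (c *\<^sub>R u) = c ^ k * Q k u"
    "\<And>k u. \<bar>Q k u\<bar> \<le> L k * norm u ^ k" "0 \<le> C4"
    "\<And>u. u \<in> ball 0 (R/2) \<Longrightarrow> \<bar>N u - (\<Sum>k<6. Q k u)\<bar> \<le> C4 * norm u ^ 6"
    "\<And>u. u \<in> ball 0 (R/2) \<Longrightarrow> \<bar>frechet_derivative N (at u) u - (\<Sum>k<6. real k * Q k u)\<bar> \<le> C4 * norm u ^ 6"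
    by (rule homogeneous_Taylor_obtain[OF NC[of 6] R n6]) (rule that)
  have s6: "(\<Sum>k<6. g k) = g 0 + g 1 + g 2 + g 3 + g 4 + g 5" for g :: "nat \<Rightarrow> real" by (simp add: eval_nat_numeral)
  have Q0: "Q k u = 0" if "k < 3" for k u
  proof (rule homogeneous_parts_vanish[where P = Q and n = 6 and m = 3 and r = "R/2" and C = "C3 + C4 * R^3"])
    show "\<bar>\<Sum>k<6. Q k u\<bar> \<le> (C3 + C4 * R^3) * norm u ^ 3" if u: "u \<in> ball 0 (R/2)" for u
    proof -
      have "norm u ^ 3 * norm u ^ 3 \<le> R^3 * norm u ^ 3" using u R
        by (intro mult_right_mono power_mono) auto
      then have "C4 * norm u ^ 6 \<le> C4 * R^3 * norm u ^ 3" using Q(4) by (simp add: mult_left_mono mult.assoc flip: power_add)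
      then show ?thesis using Q(5)[OF u] N3b[OF u] unfolding distrib_right by linarith
    qed
  qed (use R Q(2) that in auto)
  have Qs: "\<bar>N u - (Q 3 u + Q 4 u + Q 5 u)\<bar> \<le> C4 * norm u ^ 6" if "u \<in> ball 0 (R/2)" for u
    using Q(5)[OF that] by (simp add: s6 Q0)
  define C where "C = \<bar>L 3\<bar> + \<bar>L 4\<bar> + \<bar>L 5\<bar> + \<bar>M 2\<bar> + C4 + C1 + \<bar>C3\<bar>"
  have Cle: "a * norm u ^ k \<le> C * norm u ^ k" if "a \<le> C" for a k and u :: "real^2"
    using that by (intro mult_right_mono) auto
  have CC: "L 3 \<le> C" "L 4 \<le> C" "L 5 \<le> C" "M 2 \<le> C" "C4 \<le> C" "C1 \<le> C" "C3 \<le> C"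
    using Q(4) P(4) by (auto simp: C_def)
  show ?thesis
  proof (rule that[of "Q 3" "Q 4" "Q 5" "P 2" C])
    show "\<bar>Q 3 u\<bar> \<le> C * norm u ^ 3" for u by (rule order_trans[OF Q(3) Cle[OF CC(1)]])
    show "\<bar>Q 4 u\<bar> \<le> C * norm u ^ 4" for u by (rule order_trans[OF Q(3) Cle[OF CC(2)]])
    show "\<bar>Q 5 u\<bar> \<le> C * norm u ^ 5" for u by (rule order_trans[OF Q(3) Cle[OF CC(3)]])
    show "\<bar>P 2 u\<bar> \<le> C * norm u ^ 2" for u by (rule order_trans[OF P(3) Cle[OF CC(4)]])
    show "\<bar>N u - (Q 3 u + Q 4 u + Q 5 u)\<bar> \<le> C * norm u ^ 6" if "u \<in> ball 0 (R/2)" for u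
      by (rule order_trans[OF Qs[OF that] Cle[OF CC(5)]])
    show "\<bar>\<eta> u - P 2 u\<bar> \<le> C * norm u ^ 3" if "u \<in> ball 0 (R/2)" for u
      by (rule order_trans[OF \<eta>a[OF that] Cle[OF CC(6)]])
    show "\<bar>N u\<bar> \<le> C * norm u ^ 3" if "u \<in> ball 0 (R/2)" for u
      by (rule order_trans[OF N3b[OF that] Cle[OF CC(7)]])
    show "continuous_on (ball 0 R) N" using Ck_imp_continuous[OF NC[of 0]] .
  qed (use Q(1,2) P(1,2) in auto)
qed

text \<open>
  Three replacements, each costing at most a multiple of \<open>|u|^3 exp (- |u| / \<delta>)\<close> and hence \<open>O(\<delta>^5)\<close> after
  integration: drop the remainder of \<open>N\<close>, replace \<open>\<eta>\<close> by its quadratic part in the radius, and replace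
  the radius by \<open>|u|\<close> in the term of degree 4. The odd terms then cancel and \<open>degree_four_moment\<close> applies.
\<close>

lemma graph_defect_estimate:
  fixes N N3 N4 N5 \<eta> \<eta>2 :: "real^2 \<Rightarrow> real"
  assumes Nm[measurable]: "N \<in> borel_measurable borel" "\<eta> \<in> borel_measurable borel"
    and cont: "continuous_on UNIV N3" "continuous_on UNIV N4" "continuous_on UNIV N5" "continuous_on UNIV \<eta>2"
    and hom: "\<And>c u. N3 (c *\<^sub>R u) = c ^ 3 * N3 u" "\<And>c u. N4 (c *\<^sub>R u) = c ^ 4 * N4 u"
      "\<And>c u. N5 (c *\<^sub>R u) = c ^ 5 * N5 u" "\<And>c u. \<eta>2 (c *\<^sub>R u) = c ^ 2 * \<eta>2 u"
    and bd: "\<And>u. \<bar>N3 u\<bar> \<le> C * norm u ^ 3" "\<And>u. \<bar>N4 u\<bar> \<le> C * norm u ^ 4" "\<And>u. \<bar>N5 u\<bar> \<le> C * norm u ^ 5"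
      "\<And>u. \<bar>\<eta>2 u\<bar> \<le> C * norm u ^ 2"
    and app: "\<And>u. u \<in> cball 0 R \<Longrightarrow> \<bar>N u - (N3 u + N4 u + N5 u)\<bar> \<le> C * norm u ^ 6"
      "\<And>u. u \<in> cball 0 R \<Longrightarrow> \<bar>\<eta> u - \<eta>2 u\<bar> \<le> C * norm u ^ 3"
    and R: "0 < R"
  shows "\<exists>K. \<forall>\<delta>>0. \<bar>\<integral>u. N u * defect \<delta> (sqrt (norm u ^ 2 + \<eta> u ^ 2)) * indicator (cball 0 R) u \<partial>lborel\<bar> \<le> K * \<delta>^5"
proof -
  have [measurable]: "N3 \<in> borel_measurable borel" "N4 \<in> borel_measurable borel" "N5 \<in> borel_measurable borel"
     "\<eta>2 \<in> borel_measurable borel" using cont by (auto intro: borel_measurable_continuous_onI)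
  obtain A where A: "A \<ge> 0" "\<And>\<delta> \<rho>. \<delta> > 0 \<Longrightarrow> \<rho> > 0 \<Longrightarrow> \<bar>defect \<delta> \<rho>\<bar> \<le> A * exp (- \<rho> / \<delta>) / \<rho>^3"
     "\<And>\<delta> a \<rho> \<sigma>. \<delta> > 0 \<Longrightarrow> a > 0 \<Longrightarrow> \<rho> \<ge> a \<Longrightarrow> \<sigma> \<ge> a \<Longrightarrow>
        \<bar>defect \<delta> \<rho> - defect \<delta> \<sigma>\<bar> \<le> A * exp (- a / \<delta>) / a^4 * \<bar>\<rho> - \<sigma>\<bar>"
    using defect_bounds by metis
  obtain K1 where K1: "\<And>\<delta>. \<delta> > 0 \<Longrightarrow> \<bar>\<integral>u. N4 u * defect \<delta> (norm u) * indicator (cball 0 R) u \<partial>lborel\<bar> \<le> K1 * \<delta>^5"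
    using degree_four_moment[OF cont(2) hom(2) bd(2) R] by blast
  obtain K2 where K2: "\<And>\<delta>. \<delta> > 0 \<Longrightarrow> (\<integral>u. norm (u::real^2) ^ 3 * exp (- norm u / \<delta>) * indicator (cball 0 R) u \<partial>lborel) \<le> K2 * \<delta>^5"
    using cubic_exp_moment[OF R] by blast
  have C0: "0 \<le> C"
  proof -
    have "0 \<le> C * norm (axis 1 1 :: real^2) ^ 3" using bd(1)[of "axis 1 1"] abs_ge_zero order_trans by blast
    then show ?thesis by simp
  qed
  define r where "r u = sqrt (norm u ^ 2 + \<eta> u ^ 2)" for u
  define q where "q u = sqrt (norm u ^ 2 + \<eta>2 u ^ 2)" for u
  have [measurable]: "r \<in> borel_measurable borel" "q \<in> borel_measurable borel"
    unfolding r_def[abs_def] q_def[abs_def] by measurable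
  have r_ge: "norm u \<le> r u" and q_ge: "norm u \<le> q u" for u
    unfolding r_def q_def by (simp_all add: real_le_rsqrt)
  have sqrt_diff: "\<bar>sqrt (a^2 + b^2) - sqrt (a^2 + c^2)\<bar> * a \<le> \<bar>b - c\<bar> * (\<bar>b\<bar> + \<bar>c\<bar>)" if "a > 0" for a b c :: real
  proof -
    let ?s = "sqrt (a^2 + b^2)" and ?t = "sqrt (a^2 + c^2)"
    have ge: "a \<le> ?s" "a \<le> ?t" by (simp_all add: real_le_rsqrt)
    have "(?s - ?t) * (?s + ?t) = b^2 - c^2"
      by (simp add: algebra_simps flip: power2_eq_square)
    also have "\<dots> = (b - c) * (b + c)" by (simp add: algebra_simps power2_eq_square)
    finally have "\<bar>(?s - ?t) * (?s + ?t)\<bar> = \<bar>(b - c) * (b + c)\<bar>" by (rule arg_cong)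
    moreover have p: "0 \<le> ?s + ?t" using ge that by linarith
    ultimately have e: "\<bar>?s - ?t\<bar> * (?s + ?t) = \<bar>b - c\<bar> * \<bar>b + c\<bar>"
      by (simp only: abs_mult abs_of_nonneg[OF p])
    have "\<bar>?s - ?t\<bar> * a \<le> \<bar>?s - ?t\<bar> * (?s + ?t)" using ge that by (intro mult_left_mono) linarith+
    also have "\<dots> \<le> \<bar>b - c\<bar> * (\<bar>b\<bar> + \<bar>c\<bar>)" unfolding e by (intro mult_left_mono abs_triangle_ineq) simp
    finally show ?thesis .
  qed
  define L where "L = C * A + C * (1 + R + R^2) * A * (C * (2 * C + C * R)) + C * A * (C * C)"
  (* The pointwise error of the three replacements. *)
  define D where "D \<delta> u = N u * defect \<delta> (r u) - (N3 u + N5 u) * defect \<delta> (q u) - N4 u * defect \<delta> (norm u)" for \<delta> u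
  have D_bd: "\<bar>D \<delta> u\<bar> \<le> L * (norm u ^ 3 * exp (- norm u / \<delta>))" if d: "\<delta> > 0" and u: "u \<in> cball 0 R" "u \<noteq> 0" for \<delta> u
  proof -
    let ?a = "norm u" and ?e = "exp (- norm u / \<delta>)"
    have a: "0 < ?a" "?a \<le> R" using u by auto
    have ee: "exp (- r u / \<delta>) \<le> ?e" using r_ge[of u] d by (simp add: divide_right_mono)
    have g1: "\<bar>defect \<delta> (r u)\<bar> \<le> A * ?e / ?a^3"
    proof -
      have "\<bar>defect \<delta> (r u)\<bar> \<le> A * exp (- r u / \<delta>) / r u^3" using r_ge[of u] a by (intro A(2) d) linarith
      also have "\<dots> \<le> A * ?e / ?a^3"
        using r_ge[of u] a A(1) ee by (intro frac_le mult_mono power_mono) auto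
      finally show ?thesis .
    qed
    have e2: "\<bar>\<eta>2 u\<bar> \<le> C * ?a^2" by (rule bd(4))
    have e1: "\<bar>\<eta> u\<bar> \<le> C * ?a^2 + C * ?a^3" using app(2)[OF u(1)] e2 by linarith
    have "\<bar>r u - q u\<bar> * ?a \<le> \<bar>\<eta> u - \<eta>2 u\<bar> * (\<bar>\<eta> u\<bar> + \<bar>\<eta>2 u\<bar>)"
      unfolding r_def q_def by (rule sqrt_diff[OF a(1)])
    also have "\<dots> \<le> (C * ?a^3) * ((C * ?a^2 + C * ?a^3) + C * ?a^2)"
      using app(2)[OF u(1)] e1 e2 C0 by (intro mult_mono add_mono) auto
    also have "\<dots> = (C * ?a^4) * (2 * C + C * ?a) * ?a" by (simp add: field_simps power_numeral_reduce)
    finally have rq: "\<bar>r u - q u\<bar> \<le> (C * ?a^4) * (2 * C + C * ?a)" using a(1) by simp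
    also have "\<dots> \<le> (C * ?a^4) * (2 * C + C * R)" using C0 a by (intro mult_left_mono add_left_mono) auto
    finally have rq: "\<bar>r u - q u\<bar> \<le> (C * (2 * C + C * R)) * ?a^4" by (simp add: mult_ac)
    have "\<bar>q u - ?a\<bar> * ?a \<le> \<bar>\<eta>2 u\<bar> * \<bar>\<eta>2 u\<bar>"
      using sqrt_diff[OF a(1), of "\<eta>2 u" 0] by (simp add: q_def)
    also have "\<dots> \<le> (C * ?a^2) * (C * ?a^2)" using e2 C0 by (intro mult_mono) auto
    also have "\<dots> = (C * C * ?a^3) * ?a" by (simp add: field_simps power_numeral_reduce)
    finally have qa: "\<bar>q u - ?a\<bar> \<le> C * C * ?a^3" using a(1) by simp
    have g2: "\<bar>defect \<delta> (r u) - defect \<delta> (q u)\<bar> \<le> A * ?e * (C * (2 * C + C * R))"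
    proof -
      have "\<bar>defect \<delta> (r u) - defect \<delta> (q u)\<bar> \<le> A * ?e / ?a^4 * \<bar>r u - q u\<bar>"
        by (rule A(3)[OF d a(1) r_ge q_ge])
      also have "\<dots> \<le> A * ?e / ?a^4 * ((C * (2 * C + C * R)) * ?a^4)" using rq A(1) by (intro mult_left_mono) auto
      finally show ?thesis using a by simp
    qed
    have g3: "\<bar>defect \<delta> (q u) - defect \<delta> ?a\<bar> \<le> A * ?e / ?a * (C * C)"
    proof -
      have "\<bar>defect \<delta> (q u) - defect \<delta> ?a\<bar> \<le> A * ?e / ?a^4 * \<bar>q u - ?a\<bar>"
        by (rule A(3)[OF d a(1) q_ge order_refl])
      also have "\<dots> \<le> A * ?e / ?a^4 * (C * C * ?a^3)" using qa A(1) by (intro mult_left_mono) auto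
      also have "\<dots> = A * ?e / ?a * (C * C)" using a by (simp add: field_simps power_numeral_reduce)
      finally show ?thesis .
    qed
    have n345: "\<bar>N3 u + N4 u + N5 u\<bar> \<le> C * (1 + R + R^2) * ?a^3"
    proof -
      have "\<bar>N3 u + N4 u + N5 u\<bar> \<le> C * ?a^3 + C * ?a^4 + C * ?a^5" using bd(1-3)[of u] by linarith
      also have "\<dots> = C * (1 + ?a + ?a^2) * ?a^3" by (simp add: field_simps power_numeral_reduce)
      also have "\<dots> \<le> C * (1 + R + R^2) * ?a^3"
        using a C0 by (intro mult_right_mono mult_left_mono add_mono power_mono) auto
      finally show ?thesis .
    qed
    have "D \<delta> u = (N u - (N3 u + N4 u + N5 u)) * defect \<delta> (r u) + (N3 u + N4 u + N5 u) * (defect \<delta> (r u) - defect \<delta> (q u))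
       + N4 u * (defect \<delta> (q u) - defect \<delta> ?a)" by (simp add: D_def algebra_simps)
    then have "\<bar>D \<delta> u\<bar> \<le> \<bar>(N u - (N3 u + N4 u + N5 u)) * defect \<delta> (r u)\<bar> + \<bar>(N3 u + N4 u + N5 u) * (defect \<delta> (r u) - defect \<delta> (q u))\<bar>
       + \<bar>N4 u * (defect \<delta> (q u) - defect \<delta> ?a)\<bar>" by linarith
    also have "\<dots> \<le> (C * ?a^6) * (A * ?e / ?a^3) + (C * (1 + R + R^2) * ?a^3) * (A * ?e * (C * (2 * C + C * R)))
       + (C * ?a^4) * (A * ?e / ?a * (C * C))"
      unfolding abs_mult using C0 R
      by (intro add_mono mult_mono app(1)[OF u(1)] g1 g2 g3 n345 bd(2)) auto
    also have "(C * ?a^6) * (A * ?e / ?a^3) = C * A * (?a^3 * ?e)" using a by (simp add: field_simps power_numeral_reduce)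
    also have "(C * ?a^4) * (A * ?e / ?a * (C * C)) = C * A * (C * C) * (?a^3 * ?e)" using a by (simp add: field_simps power_numeral_reduce)
    also have "C * A * (?a^3 * ?e) + (C * (1 + R + R^2) * ?a^3) * (A * ?e * (C * (2 * C + C * R))) + C * A * (C * C) * (?a^3 * ?e)
       = L * (?a^3 * ?e)" unfolding L_def by (simp add: algebra_simps)
    finally show ?thesis .
  qed
  have L0: "0 \<le> L" unfolding L_def using C0 A(1) R by (intro add_nonneg_nonneg mult_nonneg_nonneg) auto
  have N0: "N 0 = 0" "N3 0 = 0" "N4 0 = 0" "N5 0 = 0"
    using app(1)[of 0] R bd(1)[of 0] bd(2)[of 0] bd(3)[of 0] by auto
  have main: "\<bar>\<integral>u. N u * defect \<delta> (r u) * indicator (cball 0 R) u \<partial>lborel\<bar> \<le> (L * K2 + K1) * \<delta>^5" if d: "\<delta> > 0" for \<delta>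
  proof -
    have b3: "\<bar>defect \<delta> s\<bar> * norm u ^ 3 \<le> A" if "u \<noteq> 0" "norm u \<le> s" for s and u :: "real^2"
    proof -
      have "0 < norm u" using that by simp
      then have s: "0 < s" "0 < norm u" using that by linarith+
      have "\<bar>defect \<delta> s\<bar> * norm u ^ 3 \<le> (A * exp (- s / \<delta>) / s^3) * s^3"
        using s that A(2)[OF d s(1)] A(1) by (intro mult_mono power_mono) auto
      also have "\<dots> = A * exp (- s / \<delta>)" using s by simp
      also have "\<dots> \<le> A * 1" using A(1) s d by (intro mult_left_mono) auto
      finally show ?thesis by simp
    qed
    have iq: "integrable lborel (\<lambda>u. ((N3 u + N5 u) * defect \<delta> (q u)) * indicator (cball 0 R) u)"
    proof (rule integrable_on_cball)
      fix u :: "real^2" assume u: "u \<in> cball 0 R"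
      show "\<bar>(N3 u + N5 u) * defect \<delta> (q u)\<bar> \<le> (C + C * R^2) * A"
      proof (cases "u = 0")
        case False
        have "\<bar>N3 u + N5 u\<bar> \<le> (C + C * norm u ^ 2) * norm u ^ 3"
        proof -
          have "C * norm u ^ 5 = C * norm u ^ 2 * norm u ^ 3" by (simp add: mult.assoc flip: power_add)
          then show ?thesis unfolding distrib_right using bd(1)[of u] bd(3)[of u] by linarith
        qed
        also have "\<dots> \<le> (C + C * R^2) * norm u ^ 3"
          using C0 u by (intro mult_right_mono add_left_mono mult_left_mono power_mono) auto
        finally have "\<bar>(N3 u + N5 u) * defect \<delta> (q u)\<bar> \<le> (C + C * R^2) * norm u ^ 3 * \<bar>defect \<delta> (q u)\<bar>"
          unfolding abs_mult by (rule mult_right_mono) simp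
        also have "\<dots> \<le> (C + C * R^2) * A" unfolding mult.assoc
          using b3[OF False q_ge] C0 by (intro mult_left_mono) (auto simp: mult.commute)
        finally show ?thesis .
      qed (use N0 C0 A(1) in simp)
    qed measurable
    have i4: "integrable lborel (\<lambda>u. (N4 u * defect \<delta> (norm u)) * indicator (cball 0 R) u)"
    proof (rule integrable_on_cball)
      fix u :: "real^2" assume u: "u \<in> cball 0 R"
      show "\<bar>N4 u * defect \<delta> (norm u)\<bar> \<le> (C * R) * A"
      proof (cases "u = 0")
        case False
        have "\<bar>N4 u\<bar> \<le> (C * norm u) * norm u ^ 3"
          using bd(2)[of u] by (simp add: power_numeral_reduce mult_ac)
        also have "\<dots> \<le> (C * R) * norm u ^ 3"
          using C0 u by (intro mult_right_mono mult_left_mono) auto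
        finally have "\<bar>N4 u * defect \<delta> (norm u)\<bar> \<le> (C * R) * norm u ^ 3 * \<bar>defect \<delta> (norm u)\<bar>"
          unfolding abs_mult by (rule mult_right_mono) simp
        also have "\<dots> \<le> (C * R) * A" unfolding mult.assoc[of "C * R"]
          using b3[OF False order_refl] C0 R by (intro mult_left_mono) (auto simp: mult.commute)
        finally show ?thesis .
      qed (use N0 C0 A(1) R in simp)
    qed measurable
    have DK: "\<bar>D \<delta> u\<bar> \<le> L * (norm u ^ 3 * exp (- norm u / \<delta>))" if "u \<in> cball 0 R" for u
      using D_bd[OF d that] N0 by (cases "u = 0") (auto simp: D_def)
    have i3: "integrable lborel (\<lambda>u. (norm (u::real^2) ^ 3 * exp (- norm u / \<delta>)) * indicator (cball 0 R) u)"
    proof (rule integrable_on_cball)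
      fix u :: "real^2" assume "u \<in> cball 0 R"
      then show "\<bar>norm u ^ 3 * exp (- norm u / \<delta>)\<bar> \<le> R^3 * 1"
        unfolding abs_mult using d R by (intro mult_mono) (auto intro!: power_mono)
    qed measurable
    have iD: "integrable lborel (\<lambda>u. D \<delta> u * indicator (cball 0 R) u)"
    proof (rule Bochner_Integration.integrable_bound[OF integrable_mult_right[OF i3, of L]])
      show "(\<lambda>u. D \<delta> u * indicator (cball 0 R) u) \<in> borel_measurable lborel" unfolding D_def by measurable
      show "AE u in lborel. norm (D \<delta> u * indicator (cball 0 R) u) \<le> norm (L * (norm u ^ 3 * exp (- norm u / \<delta>) * indicator (cball 0 R) u))"
        using DK L0 by (intro AE_I2) (auto simp: indicator_def abs_mult)
    qed
    have intD: "\<bar>\<integral>u. D \<delta> u * indicator (cball 0 R) u \<partial>lborel\<bar> \<le> L * K2 * \<delta>^5"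
    proof -
      have "\<bar>\<integral>u. D \<delta> u * indicator (cball 0 R) u \<partial>lborel\<bar> \<le> (\<integral>u. L * (norm (u::real^2) ^ 3 * exp (- norm u / \<delta>) * indicator (cball 0 R) u) \<partial>lborel)"
        by (rule order_trans[OF integral_abs_bound integral_mono[OF integrable_abs[OF iD] integrable_mult_right[OF i3]]])
          (use DK in \<open>auto simp: indicator_def abs_mult\<close>)
      also have "\<dots> \<le> L * (K2 * \<delta>^5)" using K2[OF d] L0 by (simp add: mult_left_mono)
      finally show ?thesis by (simp add: mult_ac)
    qed
    have odd: "(\<integral>u. ((N3 u + N5 u) * defect \<delta> (q u)) * indicator (cball 0 R) u \<partial>lborel) = 0"
    proof (rule integral_odd)
      have "N3 (- u) = - N3 u" "N5 (- u) = - N5 u" "\<eta>2 (- u) = \<eta>2 u" for u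
        using hom(1)[of "-1" u] hom(3)[of "-1" u] hom(4)[of "-1" u] by auto
      then show "((N3 (- u) + N5 (- u)) * defect \<delta> (q (- u))) * indicator (cball 0 R) (- u) = - (((N3 u + N5 u) * defect \<delta> (q u)) * indicator (cball 0 R) u)" for u
        by (simp add: q_def indicator_def algebra_simps)
    qed measurable
    have "(\<integral>u. N u * defect \<delta> (r u) * indicator (cball 0 R) u \<partial>lborel) =
      (\<integral>u. (D \<delta> u * indicator (cball 0 R) u + ((N3 u + N5 u) * defect \<delta> (q u)) * indicator (cball 0 R) u)
         + (N4 u * defect \<delta> (norm u)) * indicator (cball 0 R) u \<partial>lborel)"
      by (intro Bochner_Integration.integral_cong) (auto simp: D_def indicator_def)
    also have "\<dots> = (\<integral>u. D \<delta> u * indicator (cball 0 R) u \<partial>lborel)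
       + (\<integral>u. ((N3 u + N5 u) * defect \<delta> (q u)) * indicator (cball 0 R) u \<partial>lborel)
       + (\<integral>u. (N4 u * defect \<delta> (norm u)) * indicator (cball 0 R) u \<partial>lborel)"
      by (simp only: Bochner_Integration.integral_add[OF Bochner_Integration.integrable_add[OF iD iq] i4]
           Bochner_Integration.integral_add[OF iD iq])
    finally show ?thesis using intD odd K1[OF d] by (simp add: distrib_right)
  qed
  then show ?thesis unfolding r_def by blast
qed

section \<open>The boundary as a graph over a tangent plane\<close>

lemma norm_vector_3: "norm (vector [a, b, c] :: real^3) = sqrt (a\<^sup>2 + b\<^sup>2 + c\<^sup>2)"
  by (simp add: norm_eq_sqrt_inner inner_vec_def sum_3 power2_eq_square)

definition graph_over :: "real^3 \<Rightarrow> (real^3 \<Rightarrow> real^3) \<Rightarrow> (real^2 \<Rightarrow> real) \<Rightarrow> real^2 \<Rightarrow> real^3" where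
  "graph_over y Q \<eta> u = y + Q (vector [u $ 1, u $ 2, \<eta> u])"

text \<open>
  Parametrize by the tangential coordinates at \<open>y\<close>. In terms of the base point \<open>w\<close> of a boundary chart these
  are \<open>\<tau> w\<close>, and the derivative of \<open>\<tau>\<close> at the base point of \<open>y\<close> is injective, because a tangent vector without
  tangential components at \<open>y\<close> is zero. The inverse function theorem gives \<open>\<psi>\<close>, and the patch is \<open>\<gamma> \<circ> \<psi>\<close>.
  The normal at a nearby point is orthogonal to both tangent vectors of the patch, which determines it up to
  sign; the sign is fixed by continuity, on a disc where \<open>m (\<psi> u) \<bullet> n\<close> stays positive.
\<close>

lemma tangent_patch:
  assumes dom: "bounded_smooth_domain \<Omega>" and y: "y \<in> frontier \<Omega>"
  obtains Q :: "real^3 \<Rightarrow> real^3" and R \<eta> where "orthogonal_transformation Q"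
    "Q (axis 3 1) = outward_unit_normal \<Omega> y" "R > 0"
    "smooth_on \<eta> (ball 0 R)" "\<eta> 0 = 0" "\<And>v. frechet_derivative \<eta> (at 0) v = 0"
    "regular_patch (frontier \<Omega>) (ball 0 R) (graph_over y Q \<eta>)"
    "\<And>\<rho>. \<rho> \<le> R \<Longrightarrow>
      openin (top_of_set (frontier \<Omega>)) (graph_over y Q \<eta> ` ball 0 \<rho>)"
    "\<And>u. u \<in> ball 0 R \<Longrightarrow> area_density (graph_over y Q \<eta>) u =
        sqrt (1 + (frechet_derivative \<eta> (at u) (axis 1 1))\<^sup>2 + (frechet_derivative \<eta> (at u) (axis 2 1))\<^sup>2)"
    "\<And>u. u \<in> ball 0 R \<Longrightarrow> area_density (graph_over y Q \<eta>) u *\<^sub>R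
        outward_unit_normal \<Omega> (graph_over y Q \<eta> u) =
      Q (vector [- frechet_derivative \<eta> (at u) (axis 1 1), - frechet_derivative \<eta> (at u) (axis 2 1), 1])"
proof -
  obtain r T h where r: "r > 0" "graph_chart \<Omega> y r T h" using chart_exists[OF assms] by blast
  interpret graph_chart \<Omega> y r T h by (rule r(2))
  have yb: "y \<in> ball y r" using r(1) by simp
  define w0 where "w0 = \<pi> y"
  have gw0: "\<gamma> w0 = y" using lift_base frontier_iff[OF yb] y by (simp add: w0_def)
  have w0G: "w0 \<in> G" using yb gw0 by (simp add: G_def)
  define n where "n = outward_unit_normal \<Omega> y"
  have n: "n = m w0 /\<^sub>R norm (m w0)" unfolding n_def w0_def by (rule normal_eq[OF yb y])
  have nn: "norm n = 1" unfolding n by simp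
  obtain Q :: "real^3 \<Rightarrow> real^3" where Q: "orthogonal_transformation Q" "Q (axis 3 1) = n"
    using orthogonal_transformation_exists[of "axis 3 1 :: real^3" n] nn by auto
  have Qlin: "linear Q" and Qin: "Q a \<bullet> Q b = a \<bullet> b" for a b
    using Q(1) by (auto simp: orthogonal_transformation_def)
  have Qn: "norm (Q a) = norm a" for a using Q(1) by (rule orthogonal_transformation_norm)
  have Qinv[simp]: "Q (inv Q x) = x" "inv Q (Q x) = x" for x
    using orthogonal_transformation_bij[OF Q(1)] by (simp_all add: bij_is_surj surj_f_inv_f bij_is_inj)
  have iQlin: "linear (inv Q)"
    using orthogonal_transformation_inv[OF Q(1)] by (simp add: orthogonal_transformation_def)
  have iQbl: "bounded_linear (inv Q)" using iQlin by (simp add: linear_conv_bounded_linear)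
  have Qbl: "bounded_linear Q" using Qlin by (simp add: linear_conv_bounded_linear)
  have iQin: "inv Q x \<bullet> a = x \<bullet> Q a" for x a using Qin[of "inv Q x" a] by simp
  define Dg where "Dg w v = inv T (vector [v $ 1, v $ 2, Dh w v])" for w v
  have dg: "(\<gamma> has_derivative Dg w) (at w)" for w unfolding Dg_def by (rule lift_deriv)
  have mDg: "m w \<bullet> Dg w v = 0" for w v unfolding Dg_def by (rule m_lift)
  define c where "c w = inv Q (\<gamma> w - y)" for w
  have cC: "Ck k c UNIV" for k
  proof -
    have "Ck k (\<lambda>w. \<gamma> w + (- y)) UNIV"
      by (intro Ck_add Ck_const smooth_on_Ck[OF lift_smooth]) auto
    from Ck_bounded_linear[OF iQbl _ this] show ?thesis by (simp add: c_def[abs_def])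
  qed
  have cd: "(c has_derivative (\<lambda>v. inv Q (Dg w v))) (at w)" for w
    unfolding c_def[abs_def]
    by (rule bounded_linear.has_derivative[OF iQbl]) (use has_derivative_diff[OF dg has_derivative_const] in simp)
  define \<tau> where "\<tau> w = (vector [c w $ 1, c w $ 2] :: real^2)" for w
  have \<tau>C: "Ck k \<tau> UNIV" for k
  proof (rule Ck_vector[OF open_UNIV])
    fix i :: 2
    have "Ck k (\<lambda>w. c w $ 1) UNIV" "Ck k (\<lambda>w. c w $ 2) UNIV"
      by (intro Ck_bounded_linear[OF bounded_linear_vec_nth] open_UNIV cC)+
    then show "Ck k (\<lambda>w. \<tau> w $ i) UNIV"
      unfolding \<tau>_def using exhaust_2[of i] by (elim disjE) (simp_all only: vector_2)
  qed
  then have \<tau>s: "smooth_on \<tau> A" if "open A" for A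
    using Ck_subset by (intro smooth_onI) blast
  define D\<tau> where "D\<tau> w = frechet_derivative \<tau> (at w)" for w
  have d\<tau>: "(\<tau> has_derivative D\<tau> w) (at w)" for w
    unfolding D\<tau>_def by (rule Ck_SucD[OF \<tau>C UNIV_I])
  have D\<tau>_eq: "D\<tau> w v = vector [inv Q (Dg w v) $ 1, inv Q (Dg w v) $ 2]" for w v
  proof -
    have "(\<tau> has_derivative (\<lambda>v. vector [inv Q (Dg w v) $ 1, inv Q (Dg w v) $ 2])) (at w)"
      unfolding \<tau>_def[abs_def] vector_2_axis
      by (intro has_derivative_add has_derivative_scaleR_left bounded_linear.has_derivative[OF bounded_linear_vec_nth] cd)
    from fun_cong[OF has_derivative_unique[OF d\<tau> this]] show ?thesis .
  qed
  have \<tau>0: "\<tau> w0 = 0"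
    by (simp add: \<tau>_def c_def gw0 linear_0[OF iQlin] vec_eq_iff forall_2)
  (* The normal component of a tangent vector at y is zero by mDg, so its tangential components determine it. *)
  have inj0: "v = 0" if "D\<tau> w0 v = 0" for v
  proof -
    have "inv Q (Dg w0 v) $ 3 = inv Q (Dg w0 v) \<bullet> axis 3 1" by (simp add: inner_axis)
    also have "\<dots> = Dg w0 v \<bullet> n" by (simp only: iQin Q(2))
    also have "\<dots> = 0" using mDg[of w0 v] by (simp add: n inner_commute[of "Dg w0 v"])
    finally have 3: "inv Q (Dg w0 v) $ 3 = 0" .
    have "inv Q (Dg w0 v) $ 1 = 0" "inv Q (Dg w0 v) $ 2 = 0"
      using that by (simp_all add: D\<tau>_eq vec_eq_iff forall_2)
    then have "inv Q (Dg w0 v) = 0" using 3 by (simp add: vec_eq_iff forall_3)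
    then have "Dg w0 v = Q 0" using Qinv(1)[of "Dg w0 v"] by simp
    then have "Dg w0 v = 0" using linear_0[OF Qlin] by simp
    then have "\<pi> (Dg w0 v) = 0" using linear_0[OF base_lin] by simp
    moreover have "\<pi> (Dg w0 v) = v" by (simp add: Dg_def base_def vec_eq_iff forall_2)
    ultimately show ?thesis by simp
  qed
  define f' where "f' w = Blinfun (D\<tau> w)" for w
  have f'[simp]: "blinfun_apply (f' w) = D\<tau> w" for w
    unfolding f'_def by (rule bounded_linear_Blinfun_apply[OF has_derivative_bounded_linear[OF d\<tau>]])
  have contf': "continuous_on G f'"
  proof (rule continuous_on_blinfun_componentwise)
    fix i :: "real^2" assume "i \<in> Basis"
    then have "continuous_on UNIV (\<lambda>w. D\<tau> w i)"
      unfolding D\<tau>_def by (intro smooth_on_continuous smooth_on_partial \<tau>s) auto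
    then show "continuous_on G (\<lambda>w. blinfun_apply (f' w) i)"
      unfolding f' by (rule continuous_on_subset) simp
  qed
  have linD: "linear (D\<tau> w)" for w by (rule has_derivative_linear[OF d\<tau>])
  have "inj (D\<tau> w0)" using inj0 linear_injective_0[OF linD] by blast
  then obtain g where g: "linear g" "g \<circ> D\<tau> w0 = id"
    using linear_injective_left_inverse[OF linD] by blast
  have gbl: "bounded_linear g" using g(1) by (simp add: linear_conv_bounded_linear)
  have invf: "Blinfun g o\<^sub>L f' w0 = id_blinfun"
    using g(2) by (intro blinfun_eqI) (simp add: bounded_linear_Blinfun_apply[OF gbl] o_def fun_eq_iff)
  obtain U' V \<psi> \<psi>' where IFT: "open U'" "U' \<subseteq> G" "w0 \<in> U'" "open V" "\<tau> w0 \<in> V" "homeomorphism U' V \<tau> \<psi>"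
    "\<And>v. v \<in> V \<Longrightarrow> (\<psi> has_derivative \<psi>' v) (at v)" "\<And>v. v \<in> V \<Longrightarrow> \<psi>' v = inv (D\<tau> (\<psi> v))"
    "\<And>v. v \<in> V \<Longrightarrow> bij (D\<tau> (\<psi> v))"
  proof -
    have "\<And>w. w \<in> G \<Longrightarrow> (\<tau> has_derivative blinfun_apply (f' w)) (at w)" using d\<tau> by simp
    from inverse_function_theorem[OF G_open this contf' w0G invf] that show ?thesis by (metis f')
  qed
  have \<psi>im: "\<psi> ` V = U'" and \<tau>\<psi>: "\<And>v. v \<in> V \<Longrightarrow> \<tau> (\<psi> v) = v" and \<psi>c: "continuous_on V \<psi>"
    and \<psi>\<tau>: "\<And>w. w \<in> U' \<Longrightarrow> \<psi> (\<tau> w) = w"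
    using IFT(6) by (auto simp: homeomorphism_def)
  have \<psi>0: "\<psi> 0 = w0" using \<psi>\<tau>[OF IFT(3)] \<tau>0 by simp
  have \<psi>s: "smooth_on \<psi> V"
    by (rule smooth_inverse[OF IFT(4,1) _ \<tau>s[OF IFT(1)] \<psi>c])
      (use \<psi>im IFT(7-9) in \<open>auto simp: D\<tau>_def\<close>)
  have "continuous_on V (\<lambda>v. m (\<psi> v) \<bullet> n)"
    by (intro continuous_intros continuous_on_compose2[OF m_continuous \<psi>c]) auto
  then have "open (V \<inter> (\<lambda>v. m (\<psi> v) \<bullet> n) -` {0<..})"
    by (rule continuous_open_preimage[OF _ IFT(4) open_greaterThan])
  moreover have "0 \<in> V \<inter> (\<lambda>v. m (\<psi> v) \<bullet> n) -` {0<..}"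
    using IFT(5) \<tau>0 \<psi>0 by (simp add: n divide_pos_pos)
  ultimately obtain R where R: "R > 0" "ball 0 R \<subseteq> V \<inter> (\<lambda>v. m (\<psi> v) \<bullet> n) -` {0<..}"
    by (meson open_contains_ball)
  have RV: "ball 0 R \<subseteq> V" using R(2) by auto
  define \<eta> where "\<eta> u = c (\<psi> u) $ 3" for u
  define \<phi> where "\<phi> = graph_over y Q \<eta>"
  have \<phi>_apply: "\<phi> = (\<lambda>u. y + Q (vector [u $ 1, u $ 2, \<eta> u]))"
    by (rule ext) (simp add: \<phi>_def graph_over_def)
  have \<phi>_eq: "\<phi> u = \<gamma> (\<psi> u)" if "u \<in> V" for u
  proof -
    have "vector [u $ 1, u $ 2, \<eta> u] = c (\<psi> u)"
      using \<tau>\<psi>[OF that] by (auto simp: \<tau>_def \<eta>_def vec_eq_iff forall_2 forall_3)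
    then show ?thesis by (simp add: \<phi>_apply c_def)
  qed
  have \<eta>s: "smooth_on \<eta> (ball 0 R)"
  proof (rule smooth_onI)
    fix k
    have "Ck k (\<lambda>u. c (\<psi> u)) (ball 0 R)"
      by (rule Ck_compose[OF open_ball open_UNIV Ck_subset[OF smooth_on_Ck[OF \<psi>s] RV] cC]) simp
    then show "Ck k \<eta> (ball 0 R)"
      unfolding \<eta>_def[abs_def] by (rule Ck_bounded_linear[OF bounded_linear_vec_nth open_ball])
  qed
  have \<phi>s: "smooth_on \<phi> (ball 0 R)"
  proof (rule smooth_onI)
    fix k
    have "Ck k (\<lambda>u. \<gamma> (\<psi> u)) (ball 0 R)"
      by (rule Ck_compose[OF open_ball open_UNIV Ck_subset[OF smooth_on_Ck[OF \<psi>s] RV] smooth_on_Ck[OF lift_smooth]]) simp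
    then show "Ck k \<phi> (ball 0 R)"
      by (subst Ck_cong[OF open_ball, of _ _ _ "\<lambda>u. \<gamma> (\<psi> u)"]) (use \<phi>_eq RV in auto)
  qed
  define D\<eta> where "D\<eta> u = frechet_derivative \<eta> (at u)" for u
  have d\<eta>: "(\<eta> has_derivative D\<eta> u) (at u)" if "u \<in> ball 0 R" for u
    unfolding D\<eta>_def by (rule smooth_on_has_derivative[OF \<eta>s that])
  have d\<phi>: "(\<phi> has_derivative (\<lambda>v. Q (vector [v $ 1, v $ 2, D\<eta> u v]))) (at u)" if "u \<in> ball 0 R" for u
  proof -
    have "((\<lambda>w. vector [w $ 1, w $ 2, \<eta> w] :: real^3) has_derivative (\<lambda>v. vector [v $ 1, v $ 2, D\<eta> u v])) (at u)"
      unfolding vector_3_axis by (auto intro!: derivative_eq_intros d\<eta>[OF that] bounded_linear_imp_has_derivative[OF bounded_linear_vec_nth])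
    from has_derivative_add[OF has_derivative_const[of y] bounded_linear.has_derivative[OF Qbl this]]
    show ?thesis unfolding \<phi>_apply by simp
  qed
  have perp: "m (\<psi> u) \<bullet> Q (vector [v $ 1, v $ 2, D\<eta> u v]) = 0" if u: "u \<in> ball 0 R" for u v
  proof -
    have uV: "u \<in> V" using u RV by auto
    have "((\<lambda>u. \<gamma> (\<psi> u)) has_derivative (\<lambda>v. Dg (\<psi> u) (\<psi>' u v))) (at u)"
      by (rule has_derivative_compose[OF IFT(7)[OF uV] dg])
    then have "(\<phi> has_derivative (\<lambda>v. Dg (\<psi> u) (\<psi>' u v))) (at u)"
      by (rule has_derivative_transform_within_open[OF _ IFT(4) uV]) (simp add: \<phi>_eq)
    from fun_cong[OF has_derivative_unique[OF d\<phi>[OF u] this], of v] show ?thesis by (simp add: mDg)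
  qed
  have main: "area_density \<phi> u = sqrt (1 + (D\<eta> u (axis 1 1))\<^sup>2 + (D\<eta> u (axis 2 1))\<^sup>2) \<and>
      area_density \<phi> u *\<^sub>R outward_unit_normal \<Omega> (\<phi> u) = Q (vector [- D\<eta> u (axis 1 1), - D\<eta> u (axis 2 1), 1])"
    if u: "u \<in> ball 0 R" for u
  proof -
    let ?a = "D\<eta> u (axis 1 1)" and ?b = "D\<eta> u (axis 2 1)"
    let ?q = "vector [- ?a, - ?b, 1] :: real^3" and ?j = "sqrt (1 + ?a\<^sup>2 + ?b\<^sup>2)"
    have uV: "u \<in> V" using u RV by auto
    have jp: "?j > 0" by (simp add: add_pos_nonneg)
    have area: "area_density \<phi> u = ?j"
    proof -
      let ?x = "vector [1, 0, ?a] :: real^3" and ?z = "vector [0, 1, ?b] :: real^3"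
      have "area_density \<phi> u = norm (cross3 (Q ?x) (Q ?z))"
        using area_density_eqI[OF d\<phi>[OF u]] by (simp add: axis_def)
      moreover have "(norm (cross3 (Q ?x) (Q ?z)))\<^sup>2 = 1 + ?a\<^sup>2 + ?b\<^sup>2"
        unfolding norm_cross Qn Qin
        by (simp add: power2_norm_eq_inner inner_vec_def sum_3) (simp add: power2_eq_square algebra_simps)
      ultimately show ?thesis by (metis norm_ge_zero real_sqrt_unique)
    qed
    define z where "z = inv Q (m (\<psi> u))"
    have zi: "z \<bullet> vector [v $ 1, v $ 2, D\<eta> u v] = 0" for v
      using perp[OF u, of v] by (simp add: z_def iQin)
    have z3: "z $ 3 > 0"
    proof -
      have "z $ 3 = z \<bullet> axis 3 1" by (simp add: inner_axis)
      then show ?thesis using R(2) u by (auto simp: z_def iQin Q(2))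
    qed
    have "z = z $ 3 *\<^sub>R ?q"
      using zi[of "axis 1 1"] zi[of "axis 2 1"]
      by (auto simp: vec_eq_iff forall_3 inner_vec_def sum_3 axis_def)
    then have "Q z = z $ 3 *\<^sub>R Q ?q" by (metis linear_scale[OF Qlin])
    then have mq: "m (\<psi> u) = z $ 3 *\<^sub>R Q ?q" by (simp add: z_def)
    have nq: "norm (Q ?q) = ?j" by (simp add: Qn norm_vector_3 add_ac)
    have "\<phi> u \<in> ball y r" using \<psi>im IFT(2) uV by (auto simp: \<phi>_eq G_def)
    moreover have "\<phi> u \<in> frontier \<Omega>" using frontier_iff[OF calculation] uV by (simp add: \<phi>_eq)
    ultimately have "outward_unit_normal \<Omega> (\<phi> u) = m (\<psi> u) /\<^sub>R norm (m (\<psi> u))"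
      using normal_eq uV by (simp add: \<phi>_eq)
    also have "\<dots> = Q ?q /\<^sub>R ?j" using z3 jp by (simp add: mq nq)
    finally have "area_density \<phi> u *\<^sub>R outward_unit_normal \<Omega> (\<phi> u) = Q ?q" using jp area by simp
    then show ?thesis using area by blast
  qed
  have \<eta>0: "\<eta> 0 = 0" by (simp add: \<eta>_def \<psi>0 c_def gw0 linear_0[OF iQlin])
  have D\<eta>0: "D\<eta> 0 v = 0" for v
  proof -
    have 0: "0 \<in> ball 0 R" using R(1) by simp
    have "m (\<psi> 0) \<bullet> x = norm (m w0) * (n \<bullet> x)" for x by (simp add: \<psi>0 n)
    then have "n \<bullet> Q (vector [v $ 1, v $ 2, D\<eta> 0 v]) = 0"
      using perp[OF 0, of v] by simp
    then show ?thesis unfolding Q(2)[symmetric] Qin by (simp add: inner_vec_def sum_3 axis_def)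
  qed
  have op: "openin (top_of_set (frontier \<Omega>)) (\<phi> ` ball 0 \<rho>)" if "\<rho> \<le> R" for \<rho>
  proof -
    have sub: "ball 0 \<rho> \<subseteq> V" using RV that by (meson order_trans subset_ball)
    have "openin (top_of_set V) (ball 0 \<rho>)" using sub IFT(4) by (simp add: openin_open_eq)
    then have "openin (top_of_set U') (\<psi> ` ball 0 \<rho>)"
      by (rule homeomorphism_imp_open_map[OF IFT(6)[THEN homeomorphism_symD]])
    then have "open (\<psi> ` ball 0 \<rho>)" "\<psi> ` ball 0 \<rho> \<subseteq> U'" using IFT(1) by (simp_all add: openin_open_eq)
    then have "openin (top_of_set G) (\<psi> ` ball 0 \<rho>)" using IFT(2) G_open by (auto simp: openin_open_eq)
    then have "openin (top_of_set (\<gamma> ` G)) (\<gamma> ` \<psi> ` ball 0 \<rho>)"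
      by (rule homeomorphism_imp_open_map[OF lift_homeo])
    moreover have "openin (top_of_set (frontier \<Omega>)) (\<gamma> ` G)"
      using lift_patch by (simp add: regular_patch_def)
    ultimately have "openin (top_of_set (frontier \<Omega>)) (\<gamma> ` \<psi> ` ball 0 \<rho>)" by (rule openin_trans)
    moreover have "\<gamma> ` \<psi> ` ball 0 \<rho> = \<phi> ` ball 0 \<rho>" unfolding image_image using sub \<phi>_eq by (intro image_cong) auto
    ultimately show ?thesis by simp
  qed
  have patch: "regular_patch (frontier \<Omega>) (ball 0 R) \<phi>"
    unfolding regular_patch_def
  proof (intro conjI ballI)
    show "openin (top_of_set (frontier \<Omega>)) (\<phi> ` ball 0 R)" by (rule op) simp
    have vec: "vector [u $ 1, u $ 2] = u" for u :: "real^2" by (simp add: vec_eq_iff forall_2)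
    have "homeomorphism (ball 0 R) (\<phi> ` ball 0 R) \<phi> (\<lambda>x. vector [inv Q (x - y) $ 1, inv Q (x - y) $ 2])"
    proof (rule homeomorphismI)
      show "continuous_on (ball 0 R) \<phi>" by (rule smooth_on_continuous[OF \<phi>s])
      show "continuous_on (\<phi> ` ball 0 R) (\<lambda>x. vector [inv Q (x - y) $ 1, inv Q (x - y) $ 2] :: real^2)"
        unfolding vector_2_axis by (intro continuous_intros bounded_linear.continuous_on[OF iQbl])
    qed (auto simp: \<phi>_apply vec)
    then show "\<exists>\<psi>. homeomorphism (ball 0 R) (\<phi> ` ball 0 R) \<phi> \<psi>" by blast
    fix u :: "real^2" assume "u \<in> ball 0 R"
    then show "area_density \<phi> u \<noteq> 0"
      using main[of u] by (smt (verit) real_sqrt_eq_zero_cancel_iff zero_le_power2)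
  qed (use \<phi>s in auto)
  have a1: "\<And>u. u \<in> ball 0 R \<Longrightarrow> area_density \<phi> u = sqrt (1 + (D\<eta> u (axis 1 1))\<^sup>2 + (D\<eta> u (axis 2 1))\<^sup>2)"
    and a2: "\<And>u. u \<in> ball 0 R \<Longrightarrow>
      area_density \<phi> u *\<^sub>R outward_unit_normal \<Omega> (\<phi> u) = Q (vector [- D\<eta> u (axis 1 1), - D\<eta> u (axis 2 1), 1])"
    using main by blast+
  show ?thesis
    by (rule that[OF Q(1) Q(2)[unfolded n_def] R(1) \<eta>s \<eta>0 D\<eta>0[unfolded D\<eta>_def] patch[unfolded \<phi>_def]
          op[unfolded \<phi>_def] a1[unfolded \<phi>_def D\<eta>_def] a2[unfolded \<phi>_def D\<eta>_def]])
qed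

section \<open>Near and far contributions\<close>

text \<open>
  In the tangent patch the integrand times the area density is \<open>N / (4 \<pi>)\<close> times the defect. Since \<open>N = O(|u|^3)\<close>, the
  kernel is bounded near \<open>y\<close>, so no singular integral arises.
\<close>

lemma near_field:
  assumes dom: "bounded_smooth_domain \<Omega>" and f: "smooth_on_surface f (frontier \<Omega>)" and y: "y \<in> frontier \<Omega>"
    and Msurf: "is_surface_measure (frontier \<Omega>) M"
    and K_def: "\<And>x. K x = ((f x *\<^sub>R outward_unit_normal \<Omega> y + f y *\<^sub>R outward_unit_normal \<Omega> x) \<bullet> (y - x))
      / (4 * pi * norm (x - y) ^ 3)"
    and Km: "K \<in> borel_measurable M"
  obtains X \<epsilon> A B where "X \<in> sets M" "0 < \<epsilon>" "\<And>x. x \<in> frontier \<Omega> - X \<Longrightarrow> \<epsilon> \<le> norm (x - y)"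
    "\<And>x. x \<in> X \<Longrightarrow> \<bar>K x\<bar> \<le> B"
    "\<And>\<delta>. \<delta> > 0 \<Longrightarrow> \<bar>\<integral>x. indicator X x * (K x * (s5 (norm (x - y) / \<delta>) - 1)) \<partial>M\<bar> \<le> A * \<delta> ^ 5"
proof -
  define n where "n = outward_unit_normal \<Omega> y"
  obtain Q :: "real^3 \<Rightarrow> real^3" and R \<eta> where Q: "orthogonal_transformation Q" "Q (axis 3 1) = n"
    and R: "R > 0" and \<eta>: "smooth_on \<eta> (ball 0 R)" "\<eta> 0 = 0" "\<And>v. frechet_derivative \<eta> (at 0) v = 0"
    and patch: "regular_patch (frontier \<Omega>) (ball 0 R) (graph_over y Q \<eta>)"
    and op: "\<And>\<rho>. \<rho> \<le> R \<Longrightarrow> openin (top_of_set (frontier \<Omega>)) (graph_over y Q \<eta> ` ball 0 \<rho>)"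
    and ar: "\<And>u. u \<in> ball 0 R \<Longrightarrow> area_density (graph_over y Q \<eta>) u =
        sqrt (1 + (frechet_derivative \<eta> (at u) (axis 1 1))\<^sup>2 + (frechet_derivative \<eta> (at u) (axis 2 1))\<^sup>2)"
    and nu: "\<And>u. u \<in> ball 0 R \<Longrightarrow> area_density (graph_over y Q \<eta>) u *\<^sub>R
        outward_unit_normal \<Omega> (graph_over y Q \<eta> u) =
      Q (vector [- frechet_derivative \<eta> (at u) (axis 1 1), - frechet_derivative \<eta> (at u) (axis 2 1), 1])"
    by (rule tangent_patch[OF dom y, folded n_def]) (rule that)
  define \<phi> where "\<phi> = graph_over y Q \<eta>"
  have \<phi>_apply: "\<phi> u = y + Q (vector [u $ 1, u $ 2, \<eta> u])" for u
    by (simp add: \<phi>_def graph_over_def)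
  define \<eta>1 where "\<eta>1 u = frechet_derivative \<eta> (at u) (axis 1 1)" for u
  define \<eta>2 where "\<eta>2 u = frechet_derivative \<eta> (at u) (axis 2 1)" for u
  note patch = patch[folded \<phi>_def] and op = op[folded \<phi>_def]
    and ar = ar[folded \<phi>_def \<eta>1_def \<eta>2_def] and nu = nu[folded \<phi>_def \<eta>1_def \<eta>2_def]
  note U = regular_patchD[OF patch]
  have Qlin: "linear Q" and Qin: "Q a \<bullet> Q b = a \<bullet> b" for a b
    using Q(1) by (auto simp: orthogonal_transformation_def)
  have Qn: "norm (Q a) = norm a" for a using Q(1) by (rule orthogonal_transformation_norm)
  have \<phi>0: "\<phi> 0 = y"
  proof -
    have "vector [0, 0, 0] = (0 :: real^3)" by (simp add: vec_eq_iff forall_3)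
    then show ?thesis by (simp add: \<phi>_apply \<eta>(2) linear_0[OF Qlin])
  qed
  obtain W Fh where W: "open W" "y \<in> W" "smooth_on Fh W" "\<forall>x\<in>W \<inter> frontier \<Omega>. Fh x = f x"
    using bspec[OF f[unfolded smooth_on_surface_def] y] by (elim exE conjE) (rule that)
  have "open (ball 0 R \<inter> \<phi> -` W)" by (rule continuous_open_preimage[OF U(3,1) W(1)])
  moreover have "0 \<in> ball 0 R \<inter> \<phi> -` W" using R W(2) \<phi>0 by simp
  ultimately obtain R0 where R0: "R0 > 0" "ball 0 R0 \<subseteq> ball 0 R \<inter> \<phi> -` W" by (meson open_contains_ball)
  have R0R: "ball 0 R0 \<subseteq> ball (0::real^2) R" using R0 by auto
  have \<eta>s: "smooth_on \<eta> (ball 0 R0)" using Ck_subset[OF smooth_on_Ck[OF \<eta>(1)] R0R] by (rule smooth_onI)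
  define F where "F u = Fh (\<phi> u) * (1 + \<eta>1 u * \<eta>1 u + \<eta>2 u * \<eta>2 u) powr (1/2)" for u
  have Fs: "smooth_on F (ball 0 R0)"
  proof (rule smooth_onI)
    fix k
    have e1: "Ck k \<eta>1 (ball 0 R0)" unfolding \<eta>1_def[abs_def]
      by (intro smooth_on_Ck smooth_on_partial[OF \<eta>s]) auto
    have e2: "Ck k \<eta>2 (ball 0 R0)" unfolding \<eta>2_def[abs_def]
      by (intro smooth_on_Ck smooth_on_partial[OF \<eta>s]) auto
    have e3: "Ck k (\<lambda>u. Fh (\<phi> u)) (ball 0 R0)"
      by (rule Ck_compose[OF open_ball W(1) Ck_subset[OF smooth_on_Ck[OF U(2)] R0R] smooth_on_Ck[OF W(3)]]) (use R0(2) in blast)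
    show "Ck k F (ball 0 R0)" unfolding F_def[abs_def]
      by (intro Ck_mult Ck_powr Ck_add Ck_const e1 e2 e3 open_ball) (simp add: add_pos_nonneg)
  qed
  have F_eq: "F u = f (\<phi> u) * area_density \<phi> u" if "u \<in> ball 0 R0" for u
  proof -
    have "\<phi> u \<in> W \<inter> frontier \<Omega>" using subsetD[OF R0(2) that] U(5) by blast
    moreover have "area_density \<phi> u = (1 + \<eta>1 u * \<eta>1 u + \<eta>2 u * \<eta>2 u) powr (1/2)"
      using ar[OF subsetD[OF R0R that]] by (auto simp: powr_half_sqrt power2_eq_square)
    ultimately show ?thesis using W(4) by (simp add: F_def)
  qed
  have F0: "F 0 = f y"
    using F_eq[of 0] ar[of 0] R R0(1) by (simp add: \<phi>0 \<eta>1_def \<eta>2_def \<eta>(3))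
  define N where "N u = f y * (frechet_derivative \<eta> (at u) u - \<eta> u) - F u * \<eta> u" for u
  obtain N3 N4 N5 h2 C where E:
    "continuous_on UNIV N3" "continuous_on UNIV N4" "continuous_on UNIV N5" "continuous_on UNIV h2"
    "\<And>c u. N3 (c *\<^sub>R u) = c ^ 3 * N3 u" "\<And>c u. N4 (c *\<^sub>R u) = c ^ 4 * N4 u"
    "\<And>c u. N5 (c *\<^sub>R u) = c ^ 5 * N5 u" "\<And>c u. h2 (c *\<^sub>R u) = c ^ 2 * h2 u"
    "\<And>u. \<bar>N3 u\<bar> \<le> C * norm u ^ 3" "\<And>u. \<bar>N4 u\<bar> \<le> C * norm u ^ 4" "\<And>u. \<bar>N5 u\<bar> \<le> C * norm u ^ 5"
    "\<And>u. \<bar>h2 u\<bar> \<le> C * norm u ^ 2"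
    "\<And>u. u \<in> ball 0 (R0/2) \<Longrightarrow> \<bar>N u - (N3 u + N4 u + N5 u)\<bar> \<le> C * norm u ^ 6"
    "\<And>u. u \<in> ball 0 (R0/2) \<Longrightarrow> \<bar>\<eta> u - h2 u\<bar> \<le> C * norm u ^ 3"
    "\<And>u. u \<in> ball 0 (R0/2) \<Longrightarrow> \<bar>N u\<bar> \<le> C * norm u ^ 3"
    "continuous_on (ball 0 R0) N"
  proof (rule numerator_expansion[OF \<eta>s \<eta>(2,3) Fs F0 R0(1), folded N_def], goal_cases)
    case 1
    show ?case by (rule that[OF 1(2-)])
  qed
  define R1 where "R1 = R0 / 3"
  have R1: "0 < R1" "cball 0 R1 \<subseteq> ball 0 (R0/2)" "ball 0 (R0/2) \<subseteq> ball (0::real^2) R0"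
    using R0(1) by (auto simp: R1_def)
  define N' where "N' u = indicator (ball 0 R0) u *\<^sub>R N u" for u
  define \<eta>' where "\<eta>' u = indicator (ball 0 R0) u *\<^sub>R \<eta> u" for u
  have N'm: "N' \<in> borel_measurable borel" unfolding N'_def[abs_def]
    by (rule borel_measurable_continuous_on_indicator[OF _ E(16)]) simp
  have \<eta>'m: "\<eta>' \<in> borel_measurable borel" unfolding \<eta>'_def[abs_def]
    by (rule borel_measurable_continuous_on_indicator[OF _ smooth_on_continuous[OF \<eta>s]]) simp
  have same: "N' u = N u" "\<eta>' u = \<eta> u" if "u \<in> cball 0 R1" for u
    using subsetD[OF R1(3) subsetD[OF R1(2) that]] by (simp_all add: N'_def \<eta>'_def)
  have e13: "\<bar>N' u - (N3 u + N4 u + N5 u)\<bar> \<le> C * norm u ^ 6" and e14: "\<bar>\<eta>' u - h2 u\<bar> \<le> C * norm u ^ 3"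
    if "u \<in> cball 0 R1" for u
    using E(13)[OF subsetD[OF R1(2) that]] E(14)[OF subsetD[OF R1(2) that]] same[OF that] by simp_all
  have "\<exists>K. \<forall>\<delta>>0. \<bar>\<integral>u. N' u * defect \<delta> (sqrt (norm u ^ 2 + \<eta>' u ^ 2)) * indicator (cball 0 R1) u \<partial>lborel\<bar> \<le> K * \<delta>^5"
    by (rule graph_defect_estimate[OF N'm \<eta>'m E(1-12) e13 e14 R1(1)])
  then obtain A where A: "\<And>\<delta>. \<delta> > 0 \<Longrightarrow>
    \<bar>\<integral>u. N' u * defect \<delta> (sqrt (norm u ^ 2 + \<eta>' u ^ 2)) * indicator (cball 0 R1) u \<partial>lborel\<bar> \<le> A * \<delta>^5" by blast
  have rad: "norm (\<phi> u - y) = sqrt (norm u ^ 2 + \<eta> u ^ 2)" for u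
  proof -
    have "norm u ^ 2 = (u $ 1)\<^sup>2 + (u $ 2)\<^sup>2"
      unfolding power2_norm_eq_inner by (simp add: inner_vec_def sum_2 power2_eq_square)
    then show ?thesis by (simp add: \<phi>_apply Qn norm_vector_3)
  qed
  have num: "area_density \<phi> u * ((f (\<phi> u) *\<^sub>R n + f y *\<^sub>R outward_unit_normal \<Omega> (\<phi> u)) \<bullet> (y - \<phi> u)) = N u"
    if u: "u \<in> ball 0 R0" for u
  proof -
    let ?v = "vector [u $ 1, u $ 2, \<eta> u] :: real^3"
    have uR: "u \<in> ball 0 R" by (rule subsetD[OF R0R u])
    have yv: "y - \<phi> u = - Q ?v" by (simp add: \<phi>_apply)
    have 1: "n \<bullet> Q ?v = \<eta> u" unfolding Q(2)[symmetric] Qin by (simp add: inner_vec_def sum_3 axis_def)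
    have 2: "Q (vector [- \<eta>1 u, - \<eta>2 u, 1]) \<bullet> Q ?v = \<eta> u - frechet_derivative \<eta> (at u) u"
      unfolding Qin
      using linear_real2_expand[OF has_derivative_linear[OF smooth_on_has_derivative[OF \<eta>(1) uR]], of u]
      by (simp add: inner_vec_def sum_3 \<eta>1_def \<eta>2_def)
    have "area_density \<phi> u * ((f (\<phi> u) *\<^sub>R n + f y *\<^sub>R outward_unit_normal \<Omega> (\<phi> u)) \<bullet> (y - \<phi> u))
      = - (f (\<phi> u) * area_density \<phi> u * (n \<bullet> Q ?v) + f y * ((area_density \<phi> u *\<^sub>R outward_unit_normal \<Omega> (\<phi> u)) \<bullet> Q ?v))"
      unfolding yv by (simp add: inner_add_left algebra_simps)
    also have "\<dots> = N u" unfolding nu[OF uR] 1 2 N_def F_eq[OF u] by (simp add: algebra_simps)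
    finally show ?thesis .
  qed
  define X where "X = \<phi> ` cball 0 R1"
  have sub: "cball 0 R1 \<subseteq> ball (0::real^2) R" using R1 R0R by blast
  have sM: "sets M = sets (restrict_space borel (frontier \<Omega>))" using Msurf by (simp add: is_surface_measure_def)
  have Sb: "frontier \<Omega> \<in> sets borel" by (simp add: frontier_closed borel_closed)
  have XM: "X \<in> sets M"
  proof -
    have "compact X" unfolding X_def by (intro compact_continuous_image continuous_on_subset[OF U(3)] sub compact_cball)
    moreover have "X \<subseteq> frontier \<Omega>" unfolding X_def using U(5) sub by blast
    ultimately show ?thesis using Sb by (auto simp: sM sets_restrict_space_iff compact_imp_closed borel_closed)
  qed
  have "R1 \<le> R"
  proof -
    have "ball (0::real^2) R1 \<subseteq> ball 0 R" using sub by auto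
    then show ?thesis using R1(1) by (simp add: ball_subset_ball_iff)
  qed
  from op[OF this] obtain Y where Y: "open Y" "\<phi> ` ball 0 R1 = frontier \<Omega> \<inter> Y" by (auto simp: openin_open)
  have "y \<in> Y" using Y(2) \<phi>0 R1(1) by (metis IntD2 centre_in_ball imageI)
  then obtain \<epsilon> where \<epsilon>: "\<epsilon> > 0" "ball y \<epsilon> \<subseteq> Y" using Y(1) open_contains_ball by blast
  have far: "\<epsilon> \<le> norm (x - y)" if "x \<in> frontier \<Omega> - X" for x
  proof (rule ccontr)
    assume "\<not> \<epsilon> \<le> norm (x - y)"
    then have "x \<in> ball y \<epsilon>" by (simp add: dist_norm norm_minus_commute)
    then have "x \<in> \<phi> ` ball 0 R1" using \<epsilon>(2) Y(2) that by blast
    then show False using that ball_subset_cball[of 0 R1] unfolding X_def by blast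
  qed
  have Kphi: "area_density \<phi> u * K (\<phi> u) = N u / (4 * pi * sqrt (norm u ^ 2 + \<eta> u ^ 2) ^ 3)" if u: "u \<in> ball 0 R0" for u
    using num[OF u] unfolding K_def rad n_def[symmetric] by simp
  have Kbd: "\<bar>K x\<bar> \<le> C / (4 * pi)" if "x \<in> X" for x
  proof -
    obtain u where u: "u \<in> cball 0 R1" "x = \<phi> u" using \<open>x \<in> X\<close> by (auto simp: X_def)
    have u2: "u \<in> ball 0 (R0/2)" by (rule subsetD[OF R1(2) u(1)])
    have u0: "u \<in> ball 0 R0" by (rule subsetD[OF R1(3) u2])
    have uR: "u \<in> ball 0 R" by (rule subsetD[OF R0R u0])
    have C0: "0 \<le> C"
    proof -
      have "0 \<le> C * norm (axis 1 1 :: real^2) ^ 3" using E(9)[of "axis 1 1"] abs_ge_zero order_trans by blast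
      then show ?thesis by simp
    qed
    show ?thesis
    proof (cases "u = 0")
      case True
      then show ?thesis using C0 by (simp add: u(2) \<phi>0 K_def)
    next
      case False
      let ?r = "sqrt (norm u ^ 2 + \<eta> u ^ 2)"
      have a1: "1 \<le> area_density \<phi> u" unfolding ar[OF uR] by (rule real_le_rsqrt) simp
      have un: "0 < norm u" using False by simp
      have rn: "norm u \<le> ?r" by (rule real_le_rsqrt) simp
      have "\<bar>K x\<bar> \<le> area_density \<phi> u * \<bar>K x\<bar>" using a1 mult_right_mono[OF a1, of "\<bar>K x\<bar>"] by simp
      also have "\<dots> = \<bar>N u / (4 * pi * ?r ^ 3)\<bar>" using Kphi[OF u0] by (simp add: u(2) abs_mult flip: Kphi[OF u0])
      also have "\<dots> = \<bar>N u\<bar> / (4 * pi * ?r ^ 3)" using un rn by (simp add: abs_mult)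
      also have "\<dots> \<le> (C * norm u ^ 3) / (4 * pi * norm u ^ 3)"
        using E(15)[OF u2] un rn C0 by (intro frac_le mult_left_mono power_mono) auto
      also have "\<dots> = C / (4 * pi)" using un by simp
      finally show ?thesis .
    qed
  qed
  have near: "\<bar>\<integral>x. indicator X x * (K x * (s5 (norm (x - y) / \<delta>) - 1)) \<partial>M\<bar> \<le> A / (4 * pi) * \<delta> ^ 5" if d: "\<delta> > 0" for \<delta>
  proof -
    have nm: "(\<lambda>x. norm (x - y)) \<in> borel_measurable M"
    proof -
      have "(\<lambda>x. norm (x - y)) \<in> borel_measurable (restrict_space borel (frontier \<Omega>))"
        by (intro borel_measurable_continuous_on_restrict continuous_intros)
      then show ?thesis by (simp add: sM cong: measurable_cong_sets)
    qed
    have s5m: "(\<lambda>x. s5 (norm (x - y) / \<delta>)) \<in> borel_measurable M"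
      by (rule measurable_compose[OF borel_measurable_divide[OF nm borel_measurable_const] s5_borel])
    have m: "(\<lambda>x. K x * (s5 (norm (x - y) / \<delta>) - 1)) \<in> borel_measurable M"
      using Km s5m by (intro borel_measurable_times borel_measurable_diff) auto
    have "(\<integral>x. indicator X x * (K x * (s5 (norm (x - y) / \<delta>) - 1)) \<partial>M)
      = (\<integral>u. area_density \<phi> u * (K (\<phi> u) * (s5 (norm (\<phi> u - y) / \<delta>) - 1)) * indicator (cball 0 R1) u \<partial>lborel)"
      unfolding X_def by (rule patch_integral[OF Msurf Sb patch compact_cball sub m])
    also have "\<dots> = (\<integral>u. (1 / (4 * pi)) * (N' u * defect \<delta> (sqrt (norm u ^ 2 + \<eta>' u ^ 2)) * indicator (cball 0 R1) u) \<partial>lborel)"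
    proof (intro Bochner_Integration.integral_cong refl)
      fix u :: "real^2"
      show "area_density \<phi> u * (K (\<phi> u) * (s5 (norm (\<phi> u - y) / \<delta>) - 1)) * indicator (cball 0 R1) u =
        (1 / (4 * pi)) * (N' u * defect \<delta> (sqrt (norm u ^ 2 + \<eta>' u ^ 2)) * indicator (cball 0 R1) u)"
      proof (cases "u \<in> cball 0 R1")
        case True
        have u0: "u \<in> ball 0 R0" by (rule subsetD[OF R1(3) subsetD[OF R1(2) True]])
        have "area_density \<phi> u * (K (\<phi> u) * (s5 (norm (\<phi> u - y) / \<delta>) - 1)) =
          (area_density \<phi> u * K (\<phi> u)) * (s5 (norm (\<phi> u - y) / \<delta>) - 1)" by (simp only: mult.assoc)
        then show ?thesis unfolding Kphi[OF u0] rad same[OF True] by (simp add: defect_def)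
      qed simp
    qed
    also have "\<dots> = (1 / (4 * pi)) * (\<integral>u. N' u * defect \<delta> (sqrt (norm u ^ 2 + \<eta>' u ^ 2)) * indicator (cball 0 R1) u \<partial>lborel)"
      by (rule integral_mult_right_zero)
    finally have "\<bar>\<integral>x. indicator X x * (K x * (s5 (norm (x - y) / \<delta>) - 1)) \<partial>M\<bar>
      = (1 / (4 * pi)) * \<bar>\<integral>u. N' u * defect \<delta> (sqrt (norm u ^ 2 + \<eta>' u ^ 2)) * indicator (cball 0 R1) u \<partial>lborel\<bar>"
      by (simp add: abs_mult)
    also have "\<dots> \<le> (1 / (4 * pi)) * (A * \<delta> ^ 5)" by (rule mult_left_mono[OF A[OF d]]) simp
    finally show ?thesis by simp
  qed
  show ?thesis by (rule that[OF XM \<epsilon>(1) far Kbd near])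
qed

theorem mainTheorem3:
  fixes \<Omega> :: "(real^3) set" and f :: "real^3 \<Rightarrow> real" and y :: "real^3"
  assumes "bounded_smooth_domain \<Omega>"
    and "smooth_on_surface f (frontier \<Omega>)"
    and "y \<in> frontier \<Omega>"
  shows "(\<lambda>\<delta>. regularized_layer_potential \<Omega> f \<delta> y - layer_potential \<Omega> f y)
           \<in> O[at_right 0](\<lambda>\<delta>. \<delta> ^ 5)"
proof -
  let ?S = "frontier \<Omega>"
  define M where "M = surface_measure ?S"
  define \<nu> where "\<nu> = outward_unit_normal \<Omega>"
  define K where "K x = ((f x *\<^sub>R \<nu> y + f y *\<^sub>R \<nu> x) \<bullet> (y - x)) / (4 * pi * norm (x - y) ^ 3)" for x
  obtain n p r T h where cover: "chart_cover \<Omega> n p r T h" using chart_cover_exists[OF assms(1)] by blast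
  have Mis: "is_surface_measure ?S M" unfolding M_def by (rule chart_cover.surface_measure_is[OF cover])
  interpret finite_measure M unfolding M_def by (rule chart_cover.surface_measure_finite[OF cover])
  have sM: "sets M = sets (restrict_space borel ?S)" using Mis by (simp add: is_surface_measure_def)
  have spM: "space M = ?S" using sets_eq_imp_space_eq[OF sM] by (simp add: space_restrict_space)
  have cont_m: "g \<in> borel_measurable M" if "continuous_on ?S g" for g :: "real^3 \<Rightarrow> 'b::topological_space"
    using borel_measurable_continuous_on_restrict[OF that] by (simp add: sM cong: measurable_cong_sets)
  have fm[measurable]: "f \<in> borel_measurable M" by (rule cont_m[OF smooth_on_surface_continuous[OF assms(2)]])
  have \<nu>m[measurable]: "\<nu> \<in> borel_measurable M" unfolding \<nu>_def by (rule cont_m[OF outward_unit_normal_continuous[OF assms(1)]])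
  have xm[measurable]: "(\<lambda>x. x) \<in> borel_measurable M" by (rule cont_m) (rule continuous_on_id)
  have Km[measurable]: "K \<in> borel_measurable M" unfolding K_def[abs_def] by measurable
  obtain X \<epsilon> A B where X: "X \<in> sets M" "0 < \<epsilon>" "\<And>x. x \<in> ?S - X \<Longrightarrow> \<epsilon> \<le> norm (x - y)" "\<And>x. x \<in> X \<Longrightarrow> \<bar>K x\<bar> \<le> B"
    "\<And>\<delta>. \<delta> > 0 \<Longrightarrow> \<bar>\<integral>x. indicator X x * (K x * (s5 (norm (x - y) / \<delta>) - 1)) \<partial>M\<bar> \<le> A * \<delta> ^ 5"
    by (rule near_field[OF assms Mis K_def[unfolded \<nu>_def] Km]) (rule that)
  obtain Bf where Bf: "\<And>x. x \<in> ?S \<Longrightarrow> \<bar>f x\<bar> \<le> Bf"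
  proof -
    have "compact ?S" using assms(1) by (intro compact_frontier_bounded) (simp add: bounded_smooth_domain_def)
    then have "bounded (f ` ?S)"
      by (intro compact_imp_bounded compact_continuous_image smooth_on_surface_continuous assms(2))
    then obtain b where b: "\<forall>z\<in>f ` ?S. norm z \<le> b" unfolding bounded_iff by blast
    have "\<bar>f x\<bar> \<le> b" if "x \<in> ?S" for x using bspec[OF b imageI[OF that]] by simp
    then show ?thesis by (rule that)
  qed
  define L where "L = max B (2 * Bf / (4 * pi * \<epsilon>\<^sup>2))"
  have Bf0: "0 \<le> Bf" using Bf[OF assms(3)] by linarith
  have L0: "0 \<le> L" unfolding L_def using Bf0 by (simp add: le_max_iff_disj)
  have KL: "\<bar>K x\<bar> \<le> L" if x: "x \<in> ?S" for x
  proof (cases "x \<in> X")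
    case True then show ?thesis using X(4)[OF True] by (simp add: L_def)
  next
    case False
    then have e: "\<epsilon> \<le> norm (x - y)" using X(3) x by blast
    have "\<bar>(f x *\<^sub>R \<nu> y + f y *\<^sub>R \<nu> x) \<bullet> (y - x)\<bar> \<le> norm (f x *\<^sub>R \<nu> y + f y *\<^sub>R \<nu> x) * norm (y - x)"
      by (rule Cauchy_Schwarz_ineq2)
    also have "\<dots> \<le> (\<bar>f x\<bar> * norm (\<nu> y) + \<bar>f y\<bar> * norm (\<nu> x)) * norm (y - x)"
      by (intro mult_right_mono order_trans[OF norm_triangle_ineq]) auto
    also have "\<dots> \<le> (2 * Bf) * norm (x - y)"
      using Bf[OF x] Bf[OF assms(3)] outward_unit_normal_norm[OF assms(1)] x assms(3)
      by (intro mult_mono) (auto simp: \<nu>_def norm_minus_commute)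
    finally have n: "\<bar>(f x *\<^sub>R \<nu> y + f y *\<^sub>R \<nu> x) \<bullet> (y - x)\<bar> \<le> (2 * Bf) * norm (x - y)" .
    have np: "0 < norm (x - y)" using e X(2) by linarith
    have "\<bar>K x\<bar> = \<bar>(f x *\<^sub>R \<nu> y + f y *\<^sub>R \<nu> x) \<bullet> (y - x)\<bar> / (4 * pi * norm (x - y) ^ 3)"
      by (simp add: K_def abs_mult)
    also have "\<dots> \<le> ((2 * Bf) * norm (x - y)) / (4 * pi * norm (x - y) ^ 3)"
      using n by (rule divide_right_mono) simp
    also have "\<dots> = 2 * Bf / (4 * pi * norm (x - y) ^ 2)" using np by (simp add: power3_eq_cube power2_eq_square)
    also have "\<dots> \<le> 2 * Bf / (4 * pi * \<epsilon>\<^sup>2)"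
      using e X(2) Bf0 by (intro divide_left_mono mult_left_mono power_mono mult_pos_pos) auto
    finally show ?thesis by (simp add: L_def)
  qed
  obtain A5 where A5: "A5 \<ge> 0" "\<And>x. x \<ge> 0 \<Longrightarrow> \<bar>s5 x - 1\<bar> \<le> A5 * exp (- x)" using s5_exponential_bounds by blast
  have "\<exists>D. \<forall>x\<ge>0. \<bar>x ^ 5 * exp (- x)\<bar> \<le> (D::real)"
  proof (rule bounded_if_tendsto_0)
    show "continuous_on {0..} (\<lambda>x::real. x ^ 5 * exp (- x))" by (intro continuous_intros)
    show "((\<lambda>x::real. x ^ 5 * exp (- x)) \<longlongrightarrow> 0) at_top" by real_asymp
  qed
  then obtain D where D: "\<And>x. x \<ge> 0 \<Longrightarrow> \<bar>x ^ 5 * exp (- x)\<bar> \<le> (D::real)" by blast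
  have est: "\<bar>regularized_layer_potential \<Omega> f \<delta> y - layer_potential \<Omega> f y\<bar> \<le> (A + L * A5 * D / \<epsilon> ^ 5 * measure M ?S) * \<delta> ^ 5"
    if d: "\<delta> > 0" for \<delta>
  proof -
    define s where "s x = s5 (norm (x - y) / \<delta>)" for x
    have sm[measurable]: "s \<in> borel_measurable M" unfolding s_def[abs_def] by measurable
    have sb: "\<bar>s x - 1\<bar> \<le> A5 * exp (- norm (x - y) / \<delta>)" for x
      using A5(2)[of "norm (x - y) / \<delta>"] d by (simp add: s_def)
    have sb1: "\<bar>s x - 1\<bar> \<le> A5" for x
    proof -
      have "A5 * exp (- norm (x - y) / \<delta>) \<le> A5 * 1" using A5(1) d by (intro mult_left_mono) auto
      then show ?thesis using sb[of x] by simp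
    qed
    have iK: "integrable M K"
      by (rule integrable_const_bound[where B = L]) (use KL spM in \<open>auto intro!: AE_I2\<close>)
    have iD: "integrable M (\<lambda>x. K x * (s x - 1))"
    proof (rule integrable_const_bound[where B = "L * A5"])
      show "AE x in M. norm (K x * (s x - 1)) \<le> L * A5"
        using KL sb1 L0 spM by (intro AE_I2) (auto simp: abs_mult intro!: mult_mono)
    qed measurable
    have iX: "integrable M (\<lambda>x. indicator X x * (K x * (s x - 1)))"
      using integrable_mult_indicator[OF X(1) iD] by simp
    have iY: "integrable M (\<lambda>x. indicator (?S - X) x * (K x * (s x - 1)))"
      using integrable_mult_indicator[OF _ iD, of "?S - X"] X(1) sets.top[of M] by (simp add: spM sets.Diff)
    have "integral\<^sup>L M (\<lambda>x. K x * s x) = integral\<^sup>L M (\<lambda>x. K x + K x * (s x - 1))"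
      by (intro Bochner_Integration.integral_cong) (auto simp: algebra_simps)
    also have "\<dots> = integral\<^sup>L M K + integral\<^sup>L M (\<lambda>x. K x * (s x - 1))"
      by (rule Bochner_Integration.integral_add[OF iK iD])
    also have "integral\<^sup>L M (\<lambda>x. K x * (s x - 1)) =
      integral\<^sup>L M (\<lambda>x. indicator X x * (K x * (s x - 1)) + indicator (?S - X) x * (K x * (s x - 1)))"
      by (intro Bochner_Integration.integral_cong) (auto simp: spM indicator_def)
    also have "\<dots> = integral\<^sup>L M (\<lambda>x. indicator X x * (K x * (s x - 1))) + integral\<^sup>L M (\<lambda>x. indicator (?S - X) x * (K x * (s x - 1)))"
      by (rule Bochner_Integration.integral_add[OF iX iY])
    finally have split: "integral\<^sup>L M (\<lambda>x. K x * s x) - integral\<^sup>L M K =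
      integral\<^sup>L M (\<lambda>x. indicator X x * (K x * (s x - 1))) + integral\<^sup>L M (\<lambda>x. indicator (?S - X) x * (K x * (s x - 1)))"
      by simp
    have farb: "\<bar>indicator (?S - X) x * (K x * (s x - 1))\<bar> \<le> L * A5 * D / \<epsilon> ^ 5 * \<delta> ^ 5" if "x \<in> ?S" for x
    proof (cases "x \<in> X")
      case True
      have "0 \<le> D" using D[of 0] by simp
      then show ?thesis using True L0 A5(1) X(2) d by simp
    next
      case False
      then have e: "\<epsilon> \<le> norm (x - y)" using X(3) that by blast
      have "\<bar>s x - 1\<bar> \<le> A5 * exp (- norm (x - y) / \<delta>)" by (rule sb)
      also have "\<dots> \<le> A5 * exp (- (\<epsilon> / \<delta>))" using e d A5(1) by (intro mult_left_mono) (auto simp: divide_right_mono)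
      also have "exp (- (\<epsilon> / \<delta>)) \<le> D / \<epsilon> ^ 5 * \<delta> ^ 5"
        using D[of "\<epsilon> / \<delta>"] d X(2) by (simp add: power_divide field_simps abs_mult)
      finally have "\<bar>s x - 1\<bar> \<le> A5 * (D / \<epsilon> ^ 5 * \<delta> ^ 5)" using A5(1) by (simp add: mult_left_mono)
      then have "\<bar>K x\<bar> * \<bar>s x - 1\<bar> \<le> L * (A5 * (D / \<epsilon> ^ 5 * \<delta> ^ 5))"
        using KL[OF that] L0 by (intro mult_mono) auto
      then show ?thesis using False that by (simp add: abs_mult mult_ac)
    qed
    have "\<bar>integral\<^sup>L M (\<lambda>x. indicator (?S - X) x * (K x * (s x - 1)))\<bar> \<le> integral\<^sup>L M (\<lambda>x. L * A5 * D / \<epsilon> ^ 5 * \<delta> ^ 5)"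
      by (rule order_trans[OF integral_abs_bound integral_mono[OF integrable_abs[OF iY]]]) (use farb spM in auto)
    also have "\<dots> = L * A5 * D / \<epsilon> ^ 5 * measure M ?S * \<delta> ^ 5" by (simp add: spM)
    finally have "\<bar>integral\<^sup>L M (\<lambda>x. K x * s x) - integral\<^sup>L M K\<bar> \<le> (A + L * A5 * D / \<epsilon> ^ 5 * measure M ?S) * \<delta> ^ 5"
      using X(5)[OF d, folded s_def] unfolding split distrib_right by linarith
    moreover have "regularized_layer_potential \<Omega> f \<delta> y - layer_potential \<Omega> f y = integral\<^sup>L M (\<lambda>x. K x * s x) - integral\<^sup>L M K"
      unfolding regularized_layer_potential_def layer_potential_def K_def s_def M_def \<nu>_def by simp
    ultimately show ?thesis by simp
  qed
  show ?thesis
  proof (rule bigoI)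
    show "eventually (\<lambda>\<delta>. norm (regularized_layer_potential \<Omega> f \<delta> y - layer_potential \<Omega> f y) \<le>
      (A + L * A5 * D / \<epsilon> ^ 5 * measure M ?S) * norm (\<delta> ^ 5)) (at_right 0)"
      using eventually_at_right_less[of 0] by (rule eventually_mono) (use est in simp)
  qed
qed

end
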